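(* Let $K$ be a CM-field of degree $2N$ over $\mathbb{Q}$ with maximal totally real subfield $K_0$, let $K_0^c$ be the Galois closure of $K_0$ over $\mathbb{Q}$, and let $\varphi_1,\dots,\varphi_N$ be the embeddings of $K_0$ into $\mathbb{C}$. For a totally positive $d\in K_0$ with $K=K_0(\sqrt{-d})$, define the Pfister form over $K_0^c$ $$q:=\langle1,\varphi_1(d)\rangle\otimes\cdots\otimes\langle1,\varphi_N(d)\rangle$$ and the $K_0^c$-algebra $$V:=K_0^c(\sqrt{-\varphi_1(d)})\otimes_{K_0^c}\cdots\otimes_{K_0^c}K_0^c(\sqrt{-\varphi_N(d)}),$$ where $q$ is regarded as a quadratic form on $V$. Let $\Lambda$ be a system of representatives for the conjugacy classes of the CM-types of $K$. Then there is an isomorphism of $K_0^c$-algebras $$\phi_\Lambda: K_0^c\otimes_{\mathbb{Q}}\Big(\bigoplus_{\Phi\in\Lambda}K^*(\Phi)\Big)\xrightarrow{\ \cong\ }V.$$ Furthermore, such isomorphisms satisfy $q(\phi_\Lambda(w))=2^{-N}\,(K_0^c\otimes_{\mathbb{Q}}Q_\Lambda)(w)$ for all $w$, where $Q_\Lambda$ is the orthogonal sum over $\Phi\in\Lambda$ of the quadratic forms $a\mapsto\mathrm{Tr}_{K^*(\Phi)/\mathbb{Q}}(\bar a a)$ on $K^*(\Phi)$, and $K_0^c\otimes_{\mathbb{Q}}Q_\Lambda$ is its extension of scalars to $K_0^c$.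
   Context: CM-types and reflex fields: $K^c$ is the Galois closure of $K$ over $\mathbb{Q}$ (inside $\mathbb{C}$), $G=\mathrm{Gal}(K^c/\mathbb{Q})$, $H=\mathrm{Gal}(K^c/K)$, $\iota\in G$ complex conjugation (central), and $\bar a=\iota a$. A CM-type $(K,\Phi)$ is a set $\Phi$ of embeddings $K\hookrightarrow\mathbb{C}$ with $\Phi\cap\iota\Phi=\emptyset$ and $\Phi\cup\iota\Phi$ equal to the set of all embeddings; embeddings are identified with cosets in $G/H$. CM-types $\Phi,\Phi'$ of $K$ are conjugate if $\Phi'=\tau\Phi$ for some $\tau\in G$. With $S_\Phi=\bigcup_{\varphi\in\Phi}\varphi H$, the reflex field $K^*(\Phi)$ is the fixed field in $K^c$ of $H^*(\Phi)=\{\sigma\in G:\sigma S_\Phi=S_\Phi\}$; it is a CM-field. Quadratic forms: $\langle1,a\rangle$ denotes the form $x^2+ay^2$. The form $q$ on $V$ is the tensor product of the norm forms $N_{K_0^c(\sqrt{-\varphi_i(d)})/K_0^c}$. Explicitly, for $I\subset\{1,\dots,N\}$ let $v_I=c_1\otimes\cdots\otimes c_N$ with $c_i=\sqrt{-\varphi_i(d)}$ if $i\in I$ and $c_i=1$ otherwise; the $v_I$ form a $K_0^c$-basis of $V$, orthogonal for $q$, with $q(v_I)=\prod_{i\in I}\varphi_i(d)$. The direct sum $\bigoplus_{\Phi\in\Lambda}K^*(\Phi)$ is a $\mathbb{Q}$-algebra with componentwise multiplication. *)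

theory Defs
  imports "HOL-Analysis.Analysis" "HOL-Algebra.Algebra" "HOL-Algebra.Algebraic_Closure_Type"
begin

section \<open>Number fields inside the complex numbers\<close>

abbreviation CC :: "complex ring" where
  "CC \<equiv> ring_of_type_algebra"

definition number_field :: "complex set \<Rightarrow> bool" where
  "number_field L \<longleftrightarrow> subfield L CC \<and> ring.finite_dimension CC \<rat> L"

text \<open>Maps defined on a field are extensional, so that two of them are equal as soon as they
  agree on that field.\<close>

definition embeddings :: "complex set \<Rightarrow> (complex \<Rightarrow> complex) set" where
  "embeddings L = ring_hom (CC\<lparr>carrier := L\<rparr>) CC \<inter> extensional L"

definition embeddings_over :: "complex set \<Rightarrow> complex set \<Rightarrow> (complex \<Rightarrow> complex) set" where
  "embeddings_over F L = {\<sigma> \<in> embeddings L. \<forall>x\<in>F. \<sigma> x = x}"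

definition adjoin :: "complex set \<Rightarrow> complex \<Rightarrow> complex set" where
  "adjoin F s = generate_field CC (insert s F)"

definition field_trace :: "complex set \<Rightarrow> complex set \<Rightarrow> complex \<Rightarrow> complex" where
  "field_trace F L x = (\<Sum>\<sigma>\<in>embeddings_over F L. \<sigma> x)"

definition field_norm :: "complex set \<Rightarrow> complex set \<Rightarrow> complex \<Rightarrow> complex" where
  "field_norm F L x = (\<Prod>\<sigma>\<in>embeddings_over F L. \<sigma> x)"

definition galois_over_rat :: "complex set \<Rightarrow> bool" where
  "galois_over_rat L \<longleftrightarrow> number_field L \<and> (\<forall>\<sigma>\<in>embeddings L. \<sigma> ` L \<subseteq> L)"

definition galois_closure :: "complex set \<Rightarrow> complex set" where
  "galois_closure K = \<Inter>{L. K \<subseteq> L \<and> galois_over_rat L}"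

definition gal_group :: "complex set \<Rightarrow> (complex \<Rightarrow> complex) monoid" where
  "gal_group L = \<lparr>carrier = {\<sigma> \<in> embeddings L. \<sigma> ` L = L},
                  mult = (\<lambda>\<sigma> \<tau>. compose L \<sigma> \<tau>), one = (\<lambda>x\<in>L. x)\<rparr>"

definition totally_real :: "complex set \<Rightarrow> bool" where
  "totally_real L \<longleftrightarrow> number_field L \<and> (\<forall>\<sigma>\<in>embeddings L. \<sigma> ` L \<subseteq> \<real>)"

definition totally_imaginary :: "complex set \<Rightarrow> bool" where
  "totally_imaginary L \<longleftrightarrow> number_field L \<and> (\<forall>\<sigma>\<in>embeddings L. \<not> \<sigma> ` L \<subseteq> \<real>)"

definition CM_field :: "complex set \<Rightarrow> bool" where
  "CM_field K \<longleftrightarrow> totally_imaginary K \<and>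
     (\<exists>L. L \<subseteq> K \<and> totally_real L \<and> ring.dimension CC 2 L K)"

definition maximal_totally_real_subfield :: "complex set \<Rightarrow> complex set \<Rightarrow> bool" where
  "maximal_totally_real_subfield L K \<longleftrightarrow> L \<subseteq> K \<and> totally_real L \<and>
     (\<forall>M. L \<subseteq> M \<and> M \<subseteq> K \<and> totally_real M \<longrightarrow> M = L)"

definition totally_positive :: "complex set \<Rightarrow> complex \<Rightarrow> bool" where
  "totally_positive L d \<longleftrightarrow> d \<in> L \<and> (\<forall>\<sigma>\<in>embeddings L. \<sigma> d \<in> \<real> \<and> 0 < Re (\<sigma> d))"


section \<open>CM-types and reflex fields\<close>

text \<open>\<open>compose K \<tau> ` \<Phi>\<close> is the set of all \<open>\<tau> \<circ> \<phi>\<close> for \<open>\<phi>\<close> in \<open>\<Phi>\<close>.\<close>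

definition CM_type :: "complex set \<Rightarrow> (complex \<Rightarrow> complex) set \<Rightarrow> bool" where
  "CM_type K \<Phi> \<longleftrightarrow> \<Phi> \<subseteq> embeddings K \<and>
     \<Phi> \<inter> compose K cnj ` \<Phi> = {} \<and> \<Phi> \<union> compose K cnj ` \<Phi> = embeddings K"

definition conjugate_types ::
  "complex set \<Rightarrow> (complex \<Rightarrow> complex) set \<Rightarrow> (complex \<Rightarrow> complex) set \<Rightarrow> bool" where
  "conjugate_types K \<Phi> \<Phi>' \<longleftrightarrow>
     (\<exists>\<tau>\<in>carrier (gal_group (galois_closure K)). \<Phi>' = compose K \<tau> ` \<Phi>)"

definition representatives_of_CM_types ::
  "complex set \<Rightarrow> (complex \<Rightarrow> complex) set set \<Rightarrow> bool" where
  "representatives_of_CM_types K \<Lambda> \<longleftrightarrow> (\<forall>\<Phi>\<in>\<Lambda>. CM_type K \<Phi>) \<and>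
     (\<forall>\<Phi>. CM_type K \<Phi> \<longrightarrow> (\<exists>!\<Psi>. \<Psi> \<in> \<Lambda> \<and> conjugate_types K \<Phi> \<Psi>))"

text \<open>With $G = \mathrm{Gal}(K^c/\mathbb{Q})$ and $H = \mathrm{Gal}(K^c/K)$, an embedding \<open>\<phi>\<close> of
  \<open>K\<close> is identified with the coset \<open>\<phi>H\<close> of all elements of \<open>G\<close> that restrict to \<open>\<phi>\<close> on
  \<open>K\<close>.\<close>

definition coset_of_embedding ::
  "complex set \<Rightarrow> (complex \<Rightarrow> complex) \<Rightarrow> (complex \<Rightarrow> complex) set" where
  "coset_of_embedding K \<phi> =
     {\<sigma> \<in> carrier (gal_group (galois_closure K)). restrict \<sigma> K = \<phi>}"

definition S_type :: "complex set \<Rightarrow> (complex \<Rightarrow> complex) set \<Rightarrow> (complex \<Rightarrow> complex) set" where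
  "S_type K \<Phi> = (\<Union>\<phi>\<in>\<Phi>. coset_of_embedding K \<phi>)"

definition reflex_group ::
  "complex set \<Rightarrow> (complex \<Rightarrow> complex) set \<Rightarrow> (complex \<Rightarrow> complex) set" where
  "reflex_group K \<Phi> = {\<sigma> \<in> carrier (gal_group (galois_closure K)).
     \<sigma> <#\<^bsub>gal_group (galois_closure K)\<^esub> S_type K \<Phi> = S_type K \<Phi>}"

definition reflex_field :: "complex set \<Rightarrow> (complex \<Rightarrow> complex) set \<Rightarrow> complex set" where
  "reflex_field K \<Phi> = {x \<in> galois_closure K. \<forall>\<sigma>\<in>reflex_group K \<Phi>. \<sigma> x = x}"


section \<open>Algebras over subfields of the complex numbers\<close>

definition field_algebra :: "complex set \<Rightarrow> (complex, complex) module" where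
  "field_algebra L =
     \<lparr>carrier = L, monoid.mult = (*), one = 1, ring.zero = 0, add = (+), smult = (*)\<rparr>"

definition prod_algebra ::
  "'i set \<Rightarrow> ('i \<Rightarrow> (complex, 'a) module) \<Rightarrow> (complex, 'i \<Rightarrow> 'a) module" where
  "prod_algebra I A =
     \<lparr>carrier = (\<Pi>\<^sub>E i\<in>I. carrier (A i)),
      mult = (\<lambda>x y. \<lambda>i\<in>I. x i \<otimes>\<^bsub>A i\<^esub> y i), one = (\<lambda>i\<in>I. \<one>\<^bsub>A i\<^esub>),
      ring.zero = (\<lambda>i\<in>I. \<zero>\<^bsub>A i\<^esub>), add = (\<lambda>x y. \<lambda>i\<in>I. x i \<oplus>\<^bsub>A i\<^esub> y i),
      smult = (\<lambda>c x. \<lambda>i\<in>I. c \<odot>\<^bsub>A i\<^esub> x i)\<rparr>"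

definition algebra_iso ::
  "complex set \<Rightarrow> (complex, 'a) module \<Rightarrow> (complex, 'b) module \<Rightarrow> ('a \<Rightarrow> 'b) set" where
  "algebra_iso F A B =
     {h \<in> ring_iso A B. \<forall>c\<in>F. \<forall>x\<in>carrier A. h (c \<odot>\<^bsub>A\<^esub> x) = c \<odot>\<^bsub>B\<^esub> h x}"

text \<open>The monoid algebra \<open>k[M]\<close>, that is the free \<open>k\<close>-vector space on the elements of \<open>M\<close>
  with the convolution product; \<open>single m c\<close> is the element \<open>c[m]\<close>.\<close>

definition single :: "'m \<Rightarrow> complex \<Rightarrow> 'm \<Rightarrow> complex" where
  "single m c = (\<lambda>x. if x = m then c else 0)"

definition monoid_algebra ::
  "complex set \<Rightarrow> ('m, 'z) monoid_scheme \<Rightarrow> ('m \<Rightarrow> complex) ring" where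
  "monoid_algebra k M =
     \<lparr>carrier = {f. range f \<subseteq> k \<and> finite {x. f x \<noteq> 0} \<and> {x. f x \<noteq> 0} \<subseteq> carrier M},
      mult = (\<lambda>f g z. \<Sum>(x, y) | f x \<noteq> 0 \<and> g y \<noteq> 0 \<and> x \<otimes>\<^bsub>M\<^esub> y = z. f x * g y),
      one = single \<one>\<^bsub>M\<^esub> 1, ring.zero = (\<lambda>x. 0), add = (\<lambda>f g x. f x + g x)\<rparr>"

text \<open>The quotient of \<open>R\<close> by the ideal generated by \<open>S\<close>, where a scalar \<open>c\<close> acts as
  multiplication by the class of \<open>u c\<close>.\<close>

definition quotient_algebra ::
  "'r ring \<Rightarrow> 'r set \<Rightarrow> (complex \<Rightarrow> 'r) \<Rightarrow> (complex, 'r set) module" where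
  "quotient_algebra R S u = (let J = Idl\<^bsub>R\<^esub> S; Q = R Quot J in
     \<lparr>carrier = carrier Q, mult = monoid.mult Q, one = monoid.one Q, ring.zero = ring.zero Q, add = ring.add Q,
      smult = (\<lambda>c Y. (J +>\<^bsub>R\<^esub> u c) \<otimes>\<^bsub>Q\<^esub> Y)\<rparr>)"

text \<open>Tensor products are quotients of the free vector space on the (tuples of) factors by the
  multilinearity relations. The product of such a relation with a generator is again such a
  relation, so the ideal generated by the relations is just the subspace they span, and
  the product of the monoid algebra induces the usual product of pure tensors, computed
  factor by factor.\<close>

definition tensor_relations ::
  "complex set \<Rightarrow> 'i set \<Rightarrow> ('i \<Rightarrow> (complex, 'a) module) \<Rightarrow> (('i \<Rightarrow> 'a) \<Rightarrow> complex) set" where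
  "tensor_relations k I A =
     {single (x(i := a \<oplus>\<^bsub>A i\<^esub> b)) 1 - single (x(i := a)) 1 - single (x(i := b)) 1 |x i a b.
        x \<in> carrier (prod_algebra I A) \<and> i \<in> I \<and> a \<in> carrier (A i) \<and> b \<in> carrier (A i)} \<union>
     {single (x(i := c \<odot>\<^bsub>A i\<^esub> a)) 1 - single (x(i := a)) c |x i a c.
        x \<in> carrier (prod_algebra I A) \<and> i \<in> I \<and> a \<in> carrier (A i) \<and> c \<in> k}"

definition tensor_algebra ::
  "complex set \<Rightarrow> 'i set \<Rightarrow> ('i \<Rightarrow> (complex, 'a) module) \<Rightarrow>
     (complex, (('i \<Rightarrow> 'a) \<Rightarrow> complex) set) module" where
  "tensor_algebra k I A =
     quotient_algebra (monoid_algebra k (prod_algebra I A)) (tensor_relations k I A)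
       (\<lambda>c. single \<one>\<^bsub>prod_algebra I A\<^esub> c)"

text \<open>The extension of scalars \<open>F \<otimes>\<^sub>k A\<close> of a \<open>k\<close>-algebra \<open>A\<close> to a field \<open>F\<close> containing
  \<open>k\<close>, as an \<open>F\<close>-algebra.\<close>

definition base_change_relations ::
  "complex set \<Rightarrow> complex set \<Rightarrow> (complex, 'a) module \<Rightarrow> (complex \<times> 'a \<Rightarrow> complex) set" where
  "base_change_relations k F A =
     {single (x + y, a) 1 - single (x, a) 1 - single (y, a) 1 |x y a.
        x \<in> F \<and> y \<in> F \<and> a \<in> carrier A} \<union>
     {single (x, a \<oplus>\<^bsub>A\<^esub> b) 1 - single (x, a) 1 - single (x, b) 1 |x a b.
        x \<in> F \<and> a \<in> carrier A \<and> b \<in> carrier A} \<union>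
     {single (c * x, a) 1 - single (x, a) c |c x a. c \<in> k \<and> x \<in> F \<and> a \<in> carrier A} \<union>
     {single (x, c \<odot>\<^bsub>A\<^esub> a) 1 - single (x, a) c |c x a. c \<in> k \<and> x \<in> F \<and> a \<in> carrier A}"

definition base_change ::
  "complex set \<Rightarrow> complex set \<Rightarrow> (complex, 'a) module \<Rightarrow>
     (complex, (complex \<times> 'a \<Rightarrow> complex) set) module" where
  "base_change k F A =
     quotient_algebra (monoid_algebra k (field_algebra F \<times>\<times> A)) (base_change_relations k F A)
       (\<lambda>c. single (c, \<one>\<^bsub>A\<^esub>) 1)"


section \<open>Quadratic forms\<close>

text \<open>The symmetric bilinear form \<open>b\<close> with \<open>b(x, x) = Q(x)\<close>.\<close>

definition bilin :: "(complex, 'a) module \<Rightarrow> ('a \<Rightarrow> complex) \<Rightarrow> 'a \<Rightarrow> 'a \<Rightarrow> complex" where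
  "bilin A Q x y = (Q (x \<oplus>\<^bsub>A\<^esub> y) - Q x - Q y) / 2"

text \<open>The quadratic form \<open>v \<mapsto> b(v, v)\<close> on a quotient of a free vector space, for the bilinear
  form \<open>b\<close> with values \<open>b([x], [y]) = \<beta> x y\<close> on generators. For a quotient by multilinearity
  relations and \<open>\<beta>\<close> multilinear in either argument, the representative \<open>f\<close> of \<open>Y\<close> is
  irrelevant.\<close>

definition induced_form :: "('m \<Rightarrow> 'm \<Rightarrow> complex) \<Rightarrow> ('m \<Rightarrow> complex) set \<Rightarrow> complex" where
  "induced_form \<beta> Y = (let f = (SOME f. f \<in> Y) in
     \<Sum>x | f x \<noteq> 0. \<Sum>y | f y \<noteq> 0. f x * f y * \<beta> x y)"

definition tensor_form ::
  "'i set \<Rightarrow> ('i \<Rightarrow> (complex, 'a) module) \<Rightarrow> ('i \<Rightarrow> 'a \<Rightarrow> complex) \<Rightarrow>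
     (('i \<Rightarrow> 'a) \<Rightarrow> complex) set \<Rightarrow> complex" where
  "tensor_form I A Q = induced_form (\<lambda>x y. \<Prod>i\<in>I. bilin (A i) (Q i) (x i) (y i))"

definition base_change_form ::
  "(complex, 'a) module \<Rightarrow> ('a \<Rightarrow> complex) \<Rightarrow> (complex \<times> 'a \<Rightarrow> complex) set \<Rightarrow> complex" where
  "base_change_form A Q = induced_form (\<lambda>(s, a) (t, b). s * t * bilin A Q a b)"


section \<open>The two algebras and their forms\<close>

text \<open>The $i$-th factor $K_0^c(\sqrt{-\varphi_i(d)})$; both square roots generate the same
  field.\<close>

definition pfister_factor ::
  "complex set \<Rightarrow> (nat \<Rightarrow> complex \<Rightarrow> complex) \<Rightarrow> complex \<Rightarrow> nat \<Rightarrow> complex set" where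
  "pfister_factor K\<^sub>0 \<phi> d i = adjoin (galois_closure K\<^sub>0) (csqrt (- \<phi> i d))"

definition pfister_algebra ::
  "complex set \<Rightarrow> nat \<Rightarrow> (nat \<Rightarrow> complex \<Rightarrow> complex) \<Rightarrow> complex \<Rightarrow>
     (complex, ((nat \<Rightarrow> complex) \<Rightarrow> complex) set) module" where
  "pfister_algebra K\<^sub>0 N \<phi> d =
     tensor_algebra (galois_closure K\<^sub>0) {1..N} (\<lambda>i. field_algebra (pfister_factor K\<^sub>0 \<phi> d i))"

lemma field_norm_quadratic:
  fixes c x y :: complex
  assumes F: "subfield F CC" "F \<subseteq> \<real>" and c: "c \<in> F" "0 < Re c" and xy: "x \<in> F" "y \<in> F"
  shows "field_norm F (adjoin F (csqrt (- c))) (x + y * csqrt (- c)) = x\<^sup>2 + c * y\<^sup>2"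
proof -
  define s where "s = csqrt (- c)"
  have s2: "s * s = - c"
    unfolding s_def by (metis power2_csqrt power2_eq_square)
  have cR: "c = of_real (Re c)" using c F by (auto simp: complex_is_Real_iff complex_eq_iff)
  have "s \<noteq> 0" using s2 c by auto
  have cnj_s: "cnj s = - s"
  proof -
    have "- c = of_real (- Re c)" by (subst cR) simp
    hence "csqrt (- c) = \<i> * of_real (sqrt (Re c))"
      using c by (metis csqrt_of_real_nonpos Re_complex_of_real abs_minus_cancel abs_of_pos
          Im_complex_of_real neg_less_0_iff_less order_less_imp_le)
    thus ?thesis unfolding s_def by simp
  qed
  have CCs [simp]: "\<one>\<^bsub>CC\<^esub> = 1" "\<zero>\<^bsub>CC\<^esub> = 0" "carrier CC = UNIV" "\<And>a b. a \<otimes>\<^bsub>CC\<^esub> b = a * b"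
    "\<And>a b. a \<oplus>\<^bsub>CC\<^esub> b = a + b"
    by (auto simp: ring_of_type_algebra_def)
  have fCC: "field CC" by (rule field_from_type_algebra)
  interpret R: field CC by fact
  have minus [simp]: "\<ominus>\<^bsub>CC\<^esub> a = - a" for a
    by (rule sym, rule R.sum_zero_eq_neg) auto
  have minv: "inv\<^bsub>CC\<^esub> a = inverse a" if "a \<noteq> 0" for a
    by (rule R.comm_inv_char) (use that in auto)
  have F0: "0 \<in> F" "1 \<in> F" using subfieldE[OF F(1)] subringE[of F CC] by auto
  have sub: "subring F CC" using F(1) by (simp add: subfieldE(1))
  have Fadd: "a + b \<in> F" if "a \<in> F" "b \<in> F" for a b using subringE(7)[OF sub that] by simp
  have Fmul: "a * b \<in> F" if "a \<in> F" "b \<in> F" for a b using subringE(6)[OF sub that] by simp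
  have Fneg: "- a \<in> F" if "a \<in> F" for a using subringE(5)[OF sub that] by simp
  have Finv: "inverse a \<in> F" if "a \<in> F" "a \<noteq> 0" for a
    using R.subfield_m_inv(1)[OF F(1), of a] that minv by auto
  have Fcnj: "cnj a = a" if "a \<in> F" for a using F(2) that by (auto simp: Reals_cnj_iff)
  define E where "E = {u + v * s |u v. u \<in> F \<and> v \<in> F}"
  have EI: "u + v * s \<in> E" if "u \<in> F" "v \<in> F" for u v using that E_def by auto
  have Eneg: "- a \<in> E" if a: "a \<in> E" for a
  proof -
    obtain u v where "a = u + v * s" "u \<in> F" "v \<in> F" using a E_def by auto
    thus ?thesis using EI[of "- u" "- v"] Fneg by simp
  qed
  have Eadd: "a + b \<in> E" if ab: "a \<in> E" "b \<in> E" for a b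
  proof -
    obtain u v where a: "a = u + v * s" "u \<in> F" "v \<in> F" using ab E_def by auto
    obtain u' v' where b: "b = u' + v' * s" "u' \<in> F" "v' \<in> F" using ab E_def by auto
    have eq: "a + b = (u + u') + (v + v') * s" by (simp add: a b algebra_simps)
    show ?thesis unfolding eq by (intro EI Fadd a b)
  qed
  have Emul: "a * b \<in> E" if ab: "a \<in> E" "b \<in> E" for a b
  proof -
    obtain u v where a: "a = u + v * s" "u \<in> F" "v \<in> F" using ab E_def by auto
    obtain u' v' where b: "b = u' + v' * s" "u' \<in> F" "v' \<in> F" using ab E_def by auto
    have "a * b = u * u' + v * v' * (s * s) + (u * v' + v * u') * s"
      by (simp add: a b algebra_simps)
    also have "\<dots> = (u * u' + - (c * (v * v'))) + (u * v' + v * u') * s"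
      by (simp add: s2 algebra_simps)
    finally have eq: "a * b = (u * u' + - (c * (v * v'))) + (u * v' + v * u') * s" .
    show ?thesis unfolding eq by (intro EI Fadd Fneg Fmul a b c)
  qed
  have Einv: "inverse a \<in> E" if ab: "a \<in> E" "a \<noteq> 0" for a
  proof -
    obtain u v where a: "a = u + v * s" "u \<in> F" "v \<in> F" using ab E_def by auto
    define n where "n = u * u + c * (v * v)"
    have "a * cnj a = u * u - v * v * (s * s)"
      using a by (simp add: cnj_s Fcnj algebra_simps)
    hence n: "n = a * cnj a"
      by (simp add: n_def s2)
    have n0: "n \<noteq> 0" using n ab by simp
    have nF: "n \<in> F" unfolding n_def using Fadd Fmul a c by simp
    have eq: "inverse a = u * inverse n + (- (v * inverse n)) * s"
    proof -
      have "inverse a = cnj a * inverse n" using ab n by (simp add: field_simps)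
      also have "cnj a = u - v * s" using a by (simp add: cnj_s Fcnj)
      finally show ?thesis by (simp add: algebra_simps)
    qed
    show ?thesis unfolding eq by (intro EI Fmul Fneg Finv n0 a nF)
  qed
  have adj: "adjoin F s = E"
  proof
    have "a \<in> E" if "a \<in> generate_field CC (insert s F)" for a
      using that
    proof induction
      case one show ?case using EI[of 1 0] F0 by simp
    next
      case (incl h) thus ?case using EI[of 0 1] EI[of h 0] F0 by auto
    qed (auto simp: Eneg Einv Eadd Emul minv)
    thus "adjoin F s \<subseteq> E" unfolding adjoin_def by auto
  next
    show "E \<subseteq> adjoin F s"
    proof
      fix a assume "a \<in> E"
      then obtain u v where a: "a = u + v * s" "u \<in> F" "v \<in> F" using E_def by auto
      have "u \<oplus>\<^bsub>CC\<^esub> v \<otimes>\<^bsub>CC\<^esub> s \<in> generate_field CC (insert s F)"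
        using a by (intro generate_field.eng_add generate_field.eng_mult generate_field.incl) auto
      thus "a \<in> adjoin F s" using a by (simp add: adjoin_def)
    qed
  qed
  have sE: "s \<in> E" and FE: "F \<subseteq> E" using EI[of 0 1] EI[of _ 0] F0 by auto
  have E1: "1 \<in> E" using FE F0 by auto
  have "embeddings_over F E = {restrict id E, restrict cnj E}"
  proof
    show "embeddings_over F E \<subseteq> {restrict id E, restrict cnj E}"
    proof
      fix \<sigma> assume \<sigma>: "\<sigma> \<in> embeddings_over F E"
      have add: "\<sigma> (a + b) = \<sigma> a + \<sigma> b" and mul: "\<sigma> (a * b) = \<sigma> a * \<sigma> b"
        if "a \<in> E" "b \<in> E" for a b
        using \<sigma> that by (auto simp: embeddings_over_def embeddings_def ring_hom_def)
      have fixF: "\<sigma> a = a" if "a \<in> F" for a using \<sigma> that by (auto simp: embeddings_over_def)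
      have ext: "\<sigma> \<in> extensional E" using \<sigma> by (auto simp: embeddings_over_def embeddings_def)
      have "\<sigma> s * \<sigma> s = s * s" using mul[OF sE sE] s2 fixF[OF Fneg[OF c(1)]] by simp
      hence "\<sigma> s = s \<or> \<sigma> s = - s" by (simp add: square_eq_iff)
      moreover have val: "\<sigma> (u + v * s) = u + v * \<sigma> s" if "u \<in> F" "v \<in> F" for u v
      proof -
        have "u \<in> E" "v \<in> E" using that FE by auto
        thus ?thesis
          using add[of u "v * s"] mul[of v s] Emul[of v s] sE that fixF by simp
      qed
      moreover have "\<sigma> = restrict id E" if "\<sigma> s = s"
        by (rule extensionalityI[OF ext restrict_extensional]) (use val that E_def in auto)
      moreover have "\<sigma> = restrict cnj E" if "\<sigma> s = - s"
        by (rule extensionalityI[OF ext restrict_extensional])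
          (use val that E_def Fcnj cnj_s in auto)
      ultimately show "\<sigma> \<in> {restrict id E, restrict cnj E}" by blast
    qed
    show "{restrict id E, restrict cnj E} \<subseteq> embeddings_over F E"
      using Eadd Emul E1 FE Fcnj
      by (auto simp: embeddings_over_def embeddings_def ring_hom_def subset_iff)
  qed
  moreover have "restrict id E \<noteq> restrict cnj E"
  proof
    assume "restrict id E = restrict cnj E"
    from fun_cong[OF this, of s] show False using sE cnj_s \<open>s \<noteq> 0\<close> by simp
  qed
  ultimately have "field_norm F E (x + y * s) = (x + y * s) * cnj (x + y * s)"
    using EI xy by (simp add: field_norm_def)
  also have "\<dots> = x * x - y * y * (s * s)"
    using xy by (simp add: Fcnj cnj_s algebra_simps)
  also have "\<dots> = x\<^sup>2 + c * y\<^sup>2" by (simp add: s2 power2_eq_square algebra_simps)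
  finally show ?thesis using adj by (simp add: s_def)
qed

text \<open>The $i$-th norm form is $\langle 1, \varphi_i(d)\rangle$ with respect to the basis
  $1, \sqrt{-\varphi_i(d)}$, see \<open>field_norm_quadratic\<close> above.\<close>

definition pfister_form ::
  "complex set \<Rightarrow> nat \<Rightarrow> (nat \<Rightarrow> complex \<Rightarrow> complex) \<Rightarrow> complex \<Rightarrow>
     ((nat \<Rightarrow> complex) \<Rightarrow> complex) set \<Rightarrow> complex" where
  "pfister_form K\<^sub>0 N \<phi> d =
     tensor_form {1..N} (\<lambda>i. field_algebra (pfister_factor K\<^sub>0 \<phi> d i))
       (\<lambda>i. field_norm (galois_closure K\<^sub>0) (pfister_factor K\<^sub>0 \<phi> d i))"

definition reflex_algebra ::
  "complex set \<Rightarrow> (complex \<Rightarrow> complex) set set \<Rightarrow>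
     (complex, (complex \<Rightarrow> complex) set \<Rightarrow> complex) module" where
  "reflex_algebra K \<Lambda> = prod_algebra \<Lambda> (\<lambda>\<Phi>. field_algebra (reflex_field K \<Phi>))"

definition trace_form ::
  "complex set \<Rightarrow> (complex \<Rightarrow> complex) set set \<Rightarrow>
     ((complex \<Rightarrow> complex) set \<Rightarrow> complex) \<Rightarrow> complex" where
  "trace_form K \<Lambda> a = (\<Sum>\<Phi>\<in>\<Lambda>. field_trace \<rat> (reflex_field K \<Phi>) (cnj (a \<Phi>) * a \<Phi>))"

end

theory Submission
  imports Defs
begin

text \<open>
  Write \<open>F\<close> and \<open>L\<close> for the Galois closures of \<open>K\<^sub>0\<close> and \<open>K\<close>, and let \<open>G\<close> be the group of
  automorphisms of \<open>L\<close>. Both algebras are \<open>F\<close>-forms of an algebra of functions on the finite set of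
  CM-types of \<open>K\<close>, and the theorem holds because they are the same form.

  A CM-type \<open>\<Phi>\<close> contains exactly one extension of every embedding \<open>\<phi>\<^sub>i\<close> of \<open>K\<^sub>0\<close>, that is, it
  chooses a square root of every \<open>-\<phi>\<^sub>i(d)\<close> (\<open>signs_bij\<close>). As \<open>F\<close> is real, the two embeddings of
  \<open>F(\<surd>-\<phi>\<^sub>i(d))\<close> over \<open>F\<close> are the identity and complex conjugation, so \<open>\<Phi>\<close> gives a homomorphism from
  \<open>V\<close> to the complex numbers. Together these homomorphisms embed \<open>V\<close> into the functions on the set of
  CM-types. On the other side, a family \<open>(b\<^sub>\<Phi>)\<close> of elements of the reflex fields, with
  \<open>\<Phi>\<close> in \<open>\<Lambda>\<close>, extends uniquely to a \<open>G\<close>-equivariant function \<open>\<tau>\<Phi> \<mapsto> \<tau>(b\<^sub>\<Phi>)\<close>, because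
  the reflex group is the stabilizer of \<open>\<Phi>\<close> and \<open>\<Lambda>\<close> represents the orbits. So the base change of the
  reflex algebra is mapped to functions as well. Both images consist of the functions with values in \<open>L\<close> that are
  equivariant under the automorphisms fixing \<open>F\<close> (\<open>E_eq\<close>, \<open>V_iso\<close>, \<open>W_iso\<close>), which
  gives the isomorphism. For \<open>V\<close> this is Fourier inversion on the group of sign changes (\<open>inversion\<close>): the
  coefficients of an equivariant function are fixed by \<open>Gal(L/F)\<close> and hence in \<open>F\<close>. For the
  other algebra it is Galois descent along \<open>F/\<rat>\<close>. Descent is carried out with a tensor
  \<open>\<Sum>\<^sub>j y\<^sub>j \<otimes> x\<^sub>j\<close> such that \<open>\<Sum>\<^sub>j y\<^sub>j \<sigma>(x\<^sub>j)\<close> is \<open>1\<close> for the identity and \<open>0\<close>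
  for the other automorphisms of \<open>F\<close> (\<open>separating_family\<close>); it yields both \<open>z = \<Sum>\<^sub>j y\<^sub>j Tr(x\<^sub>j z)\<close>
  and a way to write an equivariant function as a combination of \<open>G\<close>-equivariant ones.

  In terms of functions the forms are easy to compare: \<open>q(v)\<close> is \<open>2\<^sup>-\<^sup>N\<close> times the sum of
  \<open>\<bar>v(\<Phi>)\<bar>\<^sup>2\<close> over all CM-types (\<open>V_form\<close>), since the norm form has the bilinear form
  \<open>(x \<cdot> cnj y + cnj x \<cdot> y)/2\<close>; and the trace form is the sum of \<open>\<bar>w(\<Phi>)\<bar>\<^sup>2\<close> (\<open>W_form\<close>),
  since the embeddings of a reflex field correspond to the orbit of its CM-type. An arbitrary isomorphism
  becomes an automorphism of the algebra of functions. A homomorphism from that algebra to the complex numbers is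
  determined by the images of the square roots of the \<open>-\<phi>\<^sub>i(d)\<close>, so it is the evaluation at a CM-type; therefore
  the automorphism permutes the CM-types and does not change the sum of squares
  (\<open>automorphism_preserves_norm\<close>).

  The field theory rests on two facts, obtained from minimal polynomials: embeddings extend to larger number fields
  (\<open>extend_embedding\<close>), and an element fixed by all embeddings over a subfield lies in that subfield
  (\<open>fixed_by_embeddings_imp_mem\<close>).
\<close>

section \<open>Subfields of the complex numbers and their embeddings\<close>

interpretation CC: domain CC
  using field_from_type_algebra by (rule field.axioms)

lemma CC_simps [simp]:
  "\<one>\<^bsub>CC\<^esub> = 1" "\<zero>\<^bsub>CC\<^esub> = 0" "carrier CC = UNIV" "a \<otimes>\<^bsub>CC\<^esub> b = a * b" "a \<oplus>\<^bsub>CC\<^esub> b = a + b"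
  by (auto simp: ring_of_type_algebra_def)

lemma CC_minus [simp]: "\<ominus>\<^bsub>CC\<^esub> a = - a"
  by (rule sym, rule CC.sum_zero_eq_neg) auto

lemma CC_inv: "a \<noteq> 0 \<Longrightarrow> inv\<^bsub>CC\<^esub> a = inverse a"
  by (rule CC.comm_inv_char) auto

lemma CC_pow [simp]: "a [^]\<^bsub>CC\<^esub> (n::nat) = a ^ n"
  by (induction n) (auto simp: mult.commute)

lemma
  assumes "subfield F CC"
  shows subfield_0: "0 \<in> F" and subfield_1: "1 \<in> F"
    and subfield_add: "a \<in> F \<Longrightarrow> b \<in> F \<Longrightarrow> a + b \<in> F"
    and subfield_mult: "a \<in> F \<Longrightarrow> b \<in> F \<Longrightarrow> a * b \<in> F"
    and subfield_uminus: "a \<in> F \<Longrightarrow> - a \<in> F"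
  using subringE[OF subfieldE(1)[OF assms]] by simp_all

lemma subfield_minus: "subfield F CC \<Longrightarrow> a \<in> F \<Longrightarrow> b \<in> F \<Longrightarrow> a - b \<in> F"
  using subfield_add[of F a "- b"] subfield_uminus[of F b] by simp

lemma subfield_inverse:
  assumes "subfield F CC" "a \<in> F"
  shows "inverse a \<in> F"
proof (cases "a = 0")
  case False
  have "inv\<^bsub>CC\<^esub> a \<in> F" using CC.subfield_m_inv(1)[OF assms(1)] False assms(2) by simp
  thus ?thesis unfolding CC_inv[OF False] .
qed (use assms in simp)

lemma subfield_divide: "subfield F CC \<Longrightarrow> a \<in> F \<Longrightarrow> b \<in> F \<Longrightarrow> a / b \<in> F"
  unfolding divide_inverse by (intro subfield_mult subfield_inverse)

lemma subfield_sum: "subfield F CC \<Longrightarrow> (\<And>i. i \<in> I \<Longrightarrow> f i \<in> F) \<Longrightarrow> sum f I \<in> F"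
  by (induction I rule: infinite_finite_induct) (auto intro: subfield_0 subfield_add)

lemma subfield_prod: "subfield F CC \<Longrightarrow> (\<And>i. i \<in> I \<Longrightarrow> f i \<in> F) \<Longrightarrow> prod f I \<in> F"
  by (induction I rule: infinite_finite_induct) (auto intro: subfield_1 subfield_mult)

lemma subfield_power: "subfield F CC \<Longrightarrow> a \<in> F \<Longrightarrow> a ^ n \<in> F"
  by (induction n) (auto intro: subfield_1 subfield_mult)

lemma subfield_of_nat: "subfield F CC \<Longrightarrow> of_nat n \<in> F"
  by (induction n) (auto intro: subfield_0 subfield_1 subfield_add)

lemma subfield_Rats:
  assumes "subfield F CC"
  shows "\<rat> \<subseteq> F"
proof
  fix q :: complex assume "q \<in> \<rat>"
  then obtain a b where q: "q = of_int a / of_int b" by (elim Rats_cases') auto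
  have n: "of_nat n \<in> F" for n by (rule subfield_of_nat[OF assms])
  have z: "of_int z \<in> F" for z
  proof (cases z rule: int_cases2)
    case (nonneg n) thus ?thesis using n[of n] by simp
  next
    case (nonpos n) thus ?thesis using subfield_uminus[OF assms n[of n]] by simp
  qed
  show "q \<in> F" unfolding q by (rule subfield_divide[OF assms z z])
qed

lemma subfield_CC_I:
  assumes "1 \<in> F" "\<And>a b. a \<in> F \<Longrightarrow> b \<in> F \<Longrightarrow> a + b \<in> F" "\<And>a b. a \<in> F \<Longrightarrow> b \<in> F \<Longrightarrow> a * b \<in> F"
    "\<And>a. a \<in> F \<Longrightarrow> - a \<in> F" "\<And>a. a \<in> F \<Longrightarrow> a \<noteq> 0 \<Longrightarrow> inverse a \<in> F"
  shows "subfield F CC"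
proof (rule field.subfieldI'[OF field_from_type_algebra])
  show "subring F CC" by (rule CC.subringI) (use assms in auto)
qed (use assms CC_inv in auto)

lemma subfield_Rats_CC: "subfield \<rat> CC"
  by (rule subfield_CC_I) auto

lemma number_field_subfield: "number_field L \<Longrightarrow> subfield L CC"
  by (simp add: number_field_def)

lemma embeddings_iff:
  "\<sigma> \<in> embeddings L \<longleftrightarrow> \<sigma> \<in> extensional L \<and> \<sigma> 1 = 1 \<and>
     (\<forall>a\<in>L. \<forall>b\<in>L. \<sigma> (a + b) = \<sigma> a + \<sigma> b \<and> \<sigma> (a * b) = \<sigma> a * \<sigma> b)"
  by (auto simp: embeddings_def ring_hom_def)

lemma embeddings_ext:
  "\<sigma> \<in> embeddings L \<Longrightarrow> \<tau> \<in> embeddings L \<Longrightarrow> (\<And>x. x \<in> L \<Longrightarrow> \<sigma> x = \<tau> x) \<Longrightarrow> \<sigma> = \<tau>"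
  by (auto simp: embeddings_iff intro: extensionalityI)

lemma
  assumes "\<sigma> \<in> embeddings L"
  shows emb_1: "\<sigma> 1 = 1"
    and emb_add: "a \<in> L \<Longrightarrow> b \<in> L \<Longrightarrow> \<sigma> (a + b) = \<sigma> a + \<sigma> b"
    and emb_mult: "a \<in> L \<Longrightarrow> b \<in> L \<Longrightarrow> \<sigma> (a * b) = \<sigma> a * \<sigma> b"
  using assms by (auto simp: embeddings_iff)

context
  fixes L \<sigma>
  assumes L: "subfield L CC" and \<sigma>: "\<sigma> \<in> embeddings L"
begin

lemma emb_0: "\<sigma> 0 = 0"
  using emb_add[OF \<sigma>, of 0 0] subfield_0[OF L] by simp

lemma emb_uminus: "a \<in> L \<Longrightarrow> \<sigma> (- a) = - \<sigma> a"
  using emb_add[OF \<sigma>, of a "- a"] subfield_uminus[OF L, of a] emb_0 by (simp add: add_eq_0_iff)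

lemma emb_minus: "a \<in> L \<Longrightarrow> b \<in> L \<Longrightarrow> \<sigma> (a - b) = \<sigma> a - \<sigma> b"
  using emb_add[OF \<sigma>, of a "- b"] subfield_uminus[OF L, of b] emb_uminus by simp

lemma emb_eq_0_iff: "a \<in> L \<Longrightarrow> \<sigma> a = 0 \<longleftrightarrow> a = 0"
  using emb_mult[OF \<sigma>, of a "inverse a"] subfield_inverse[OF L, of a] emb_0 emb_1[OF \<sigma>]
  by (cases "a = 0") auto

lemma emb_inj: "inj_on \<sigma> L"
proof (rule inj_onI)
  fix a b assume "a \<in> L" "b \<in> L" "\<sigma> a = \<sigma> b"
  thus "a = b" using emb_eq_0_iff[of "a - b"] emb_minus[of a b] subfield_minus[OF L, of a b] by simp
qed

lemma emb_inverse: "a \<in> L \<Longrightarrow> \<sigma> (inverse a) = inverse (\<sigma> a)"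
  using emb_mult[OF \<sigma>, of "inverse a" a] subfield_inverse[OF L, of a] emb_0 emb_1[OF \<sigma>]
  by (cases "a = 0") (auto simp: inverse_unique mult.commute intro: inverse_unique[symmetric])

lemma emb_divide: "a \<in> L \<Longrightarrow> b \<in> L \<Longrightarrow> \<sigma> (a / b) = \<sigma> a / \<sigma> b"
  unfolding divide_inverse using emb_mult[OF \<sigma>, of a "inverse b"] subfield_inverse[OF L, of b]
    emb_inverse by simp

lemma emb_sum: "(\<And>i. i \<in> I \<Longrightarrow> f i \<in> L) \<Longrightarrow> \<sigma> (sum f I) = (\<Sum>i\<in>I. \<sigma> (f i))"
  by (induction I rule: infinite_finite_induct)
    (auto simp: emb_0 emb_add[OF \<sigma>] subfield_sum[OF L])

lemma emb_prod: "(\<And>i. i \<in> I \<Longrightarrow> f i \<in> L) \<Longrightarrow> \<sigma> (prod f I) = (\<Prod>i\<in>I. \<sigma> (f i))"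
  by (induction I rule: infinite_finite_induct)
    (auto simp: emb_1[OF \<sigma>] emb_mult[OF \<sigma>] subfield_prod[OF L])

lemma emb_power: "a \<in> L \<Longrightarrow> \<sigma> (a ^ n) = \<sigma> a ^ n"
  by (induction n) (auto simp: emb_1[OF \<sigma>] emb_mult[OF \<sigma>] subfield_power[OF L])

lemma emb_of_nat: "\<sigma> (of_nat n) = of_nat n"
  by (induction n) (auto simp: emb_0 emb_1[OF \<sigma>] emb_add[OF \<sigma>] subfield_of_nat[OF L] subfield_1[OF L])

lemma emb_Rats: "q \<in> \<rat> \<Longrightarrow> \<sigma> q = q"
proof -
  assume "q \<in> \<rat>"
  then obtain a b where q: "q = of_int a / of_int b" by (elim Rats_cases') auto
  have z: "of_int z \<in> L" for z using subfield_Rats[OF L] by auto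
  have z': "\<sigma> (of_int z) = of_int z" for z
  proof (cases z rule: int_cases2)
    case (nonneg n) thus ?thesis using emb_of_nat[of n] by simp
  next
    case (nonpos n) thus ?thesis using emb_of_nat[of n] emb_uminus[OF subfield_of_nat[OF L, of n]] by simp
  qed
  show ?thesis unfolding q emb_divide[OF z z] z' ..
qed

lemma emb_restrict: "F \<subseteq> L \<Longrightarrow> subfield F CC \<Longrightarrow> restrict \<sigma> F \<in> embeddings F"
  unfolding embeddings_iff
  using emb_1[OF \<sigma>] emb_add[OF \<sigma>] emb_mult[OF \<sigma>]
  by (auto simp: subfield_1 subfield_add subfield_mult subset_iff)

end

lemma emb_id: "subfield L CC \<Longrightarrow> (\<lambda>x\<in>L. x) \<in> embeddings L"
  by (auto simp: embeddings_iff subfield_1 subfield_add subfield_mult)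

lemma emb_compose:
  assumes "subfield L CC" "\<sigma> \<in> embeddings L" "\<tau> \<in> embeddings M" "\<sigma> ` L \<subseteq> M"
  shows "compose L \<tau> \<sigma> \<in> embeddings L"
  using assms emb_1[OF assms(2)] emb_1[OF assms(3)] emb_add[OF assms(2)] emb_add[OF assms(3)]
    emb_mult[OF assms(2)] emb_mult[OF assms(3)]
  by (auto simp: embeddings_iff compose_eq subfield_1 subfield_add subfield_mult image_subset_iff)

lemma emb_cnj: "subfield L CC \<Longrightarrow> \<sigma> \<in> embeddings L \<Longrightarrow> compose L cnj \<sigma> \<in> embeddings L"
  by (auto simp: embeddings_iff compose_eq subfield_1 subfield_add subfield_mult)

lemma subalgebra_Rats:
  assumes "subfield M CC"
  shows "subalgebra \<rat> M CC"
proof -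
  have "subgroup M (add_monoid CC)"
    using subring.axioms(1)[OF subfieldE(1)[OF assms]] .
  thus ?thesis
    unfolding subalgebra_def subalgebra_axioms_def
    using subfield_Rats[OF assms] by (auto intro: subfield_mult[OF assms])
qed

text \<open>Statements that hold on a subfield, such as the equality of two embeddings, only need to be
  checked on the finitely many elements of a basis.\<close>

lemma number_field_generators:
  assumes "number_field L"
  obtains B where "finite B" "B \<subseteq> L" "\<And>M. subfield M CC \<Longrightarrow> B \<subseteq> M \<Longrightarrow> L \<subseteq> M"
proof -
  obtain n where "CC.dimension n \<rat> L" using assms by (auto simp: number_field_def)
  then obtain Vs where Vs: "CC.independent \<rat> Vs" "CC.Span \<rat> Vs = L"
    using CC.exists_base[OF subfield_Rats_CC] by blast
  show thesis
  proof (rule that[of "set Vs"])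
    show "set Vs \<subseteq> L" using CC.Span_base_incl[OF subfield_Rats_CC, of Vs] Vs by simp
    fix M assume M: "subfield M CC" "set Vs \<subseteq> M"
    have "subalgebra \<rat> M CC" using M(1) by (rule subalgebra_Rats)
    thus "L \<subseteq> M" using CC.subalgebra_Span_incl[OF subfield_Rats_CC _ M(2)] Vs by simp
  qed simp
qed

lemma number_field_subset:
  assumes "number_field L" "subfield M CC" "M \<subseteq> L"
  shows "number_field M"
proof -
  have "subalgebra \<rat> M CC" using assms(2) by (rule subalgebra_Rats)
  thus ?thesis
    using assms CC.subalbegra_incl_imp_finite_dimension[OF subfield_Rats_CC] by (auto simp: number_field_def)
qed

definition poly_over :: "complex set \<Rightarrow> complex poly set" where
  "poly_over L = {p. \<forall>i. Polynomial.coeff p i \<in> L}"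

lemma poly_overD: "p \<in> poly_over L \<Longrightarrow> Polynomial.coeff p i \<in> L"
  by (simp add: poly_over_def)

lemma
  assumes L: "subfield L CC"
  shows poly_over_add: "p \<in> poly_over L \<Longrightarrow> q \<in> poly_over L \<Longrightarrow> p + q \<in> poly_over L"
    and poly_over_minus: "p \<in> poly_over L \<Longrightarrow> q \<in> poly_over L \<Longrightarrow> p - q \<in> poly_over L"
    and poly_over_mult: "p \<in> poly_over L \<Longrightarrow> q \<in> poly_over L \<Longrightarrow> p * q \<in> poly_over L"
    and poly_over_monom: "a \<in> L \<Longrightarrow> Polynomial.monom a n \<in> poly_over L"
    and poly_over_pCons: "a \<in> L \<Longrightarrow> p \<in> poly_over L \<Longrightarrow> pCons a p \<in> poly_over L"
    and poly_over_0: "0 \<in> poly_over L"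
  using subfield_0[OF L]
  by (auto simp: poly_over_def subfield_add[OF L] subfield_minus[OF L] coeff_mult coeff_pCons
      intro!: subfield_sum[OF L] subfield_mult[OF L] split: nat.split)

lemma poly_over_eval: "subfield L CC \<Longrightarrow> p \<in> poly_over L \<Longrightarrow> x \<in> L \<Longrightarrow> poly p x \<in> L"
  by (auto simp: poly_altdef poly_over_def subfield_power intro!: subfield_sum subfield_mult)

text \<open>Polynomials represented as lists have their leading coefficient first.\<close>

lemma CC_eval_eq_poly: "CC.eval p x = poly (Poly (rev p)) x"
proof (induction p)
  case (Cons a p)
  thus ?case by (simp add: Poly_append poly_monom mult.commute)
qed simp

lemma number_field_algebraic:
  assumes "number_field L" "x \<in> L"
  obtains p where "p \<in> poly_over \<rat>" "p \<noteq> 0" "poly p x = 0"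
proof -
  have "(CC.algebraic over \<rat>) x"
    using CC.finite_dimension_imp_algebraic[OF subfield_Rats_CC, of L x] assms
    by (auto simp: number_field_def subfieldE(1))
  then obtain p where p: "p \<in> carrier (\<rat>[X]\<^bsub>CC\<^esub>)" "p \<noteq> []" "CC.eval p x = 0"
    using CC.algebraicE[OF subfieldE(1)[OF subfield_Rats_CC], of x] by auto
  have p': "set p \<subseteq> \<rat>" "hd p \<noteq> 0"
    using p by (auto simp: univ_poly_def polynomial_def)
  show thesis
  proof (rule that)
    show "Poly (rev p) \<in> poly_over \<rat>"
      using p' by (auto simp: poly_over_def nth_default_def intro!: subsetD[OF p'(1)] nth_mem)
         (metis length_rev nth_mem set_rev subsetD)
    show "poly (Poly (rev p)) x = 0" using p by (simp add: CC_eval_eq_poly)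
    have "Polynomial.coeff (Poly (rev p)) (length p - 1) = hd p"
      using p(2) by (simp add: nth_default_def rev_nth hd_conv_nth)
    thus "Poly (rev p) \<noteq> 0" using p'(2) by (metis coeff_0)
  qed
qed

lemma emb_poly_root:
  assumes "subfield L CC" "\<sigma> \<in> embeddings L" "p \<in> poly_over \<rat>" "x \<in> L" "poly p x = 0"
  shows "poly p (\<sigma> x) = 0"
proof -
  have c: "Polynomial.coeff p i \<in> \<rat>" for i using assms(3) by (rule poly_overD)
  hence cL: "Polynomial.coeff p i \<in> L" for i using subfield_Rats[OF assms(1)] by blast
  have "0 = \<sigma> (poly p x)" using assms(5) emb_0[OF assms(1,2)] by simp
  also have "\<dots> = poly p (\<sigma> x)"
    using c cL assms(1,4)
    by (simp add: poly_altdef emb_sum[OF assms(1,2)] emb_mult[OF assms(2)] emb_power[OF assms(1,2)]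
        emb_Rats[OF assms(1,2)] subfield_mult subfield_power)
  finally show ?thesis by simp
qed

text \<open>An embedding is determined by its values on finitely many generators, and the value at a generator is a
  root of the rational polynomial which that generator satisfies.\<close>

lemma embeddings_finite:
  assumes "number_field L"
  shows "finite (embeddings L)"
proof -
  obtain B where B: "finite B" "B \<subseteq> L" "\<And>M. subfield M CC \<Longrightarrow> B \<subseteq> M \<Longrightarrow> L \<subseteq> M"
    using number_field_generators[OF assms] by blast
  have L: "subfield L CC" using assms by (rule number_field_subfield)
  have "\<forall>b\<in>L. \<exists>p. p \<in> poly_over \<rat> \<and> p \<noteq> 0 \<and> poly p b = 0"
    using number_field_algebraic[OF assms] by blast
  from bchoice[OF this] obtain p where "\<forall>b\<in>L. p b \<in> poly_over \<rat> \<and> p b \<noteq> 0 \<and> poly (p b) b = 0" ..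
  hence p: "\<And>b. b \<in> L \<Longrightarrow> p b \<in> poly_over \<rat>" "\<And>b. b \<in> L \<Longrightarrow> p b \<noteq> 0"
    "\<And>b. b \<in> L \<Longrightarrow> poly (p b) b = 0" by auto
  have root: "poly (p b) (\<sigma> b) = 0" if "\<sigma> \<in> embeddings L" "b \<in> L" for \<sigma> b
    by (rule emb_poly_root[OF L that(1) p(1)[OF that(2)] that(2) p(3)[OF that(2)]])
  have "(\<lambda>\<sigma>. restrict \<sigma> B) ` embeddings L \<subseteq> (\<Pi>\<^sub>E b\<in>B. {y. poly (p b) y = 0})"
    using root B(2) by (intro image_subsetI PiE_I) (auto simp: subset_iff)
  moreover have "finite \<dots>"
    using B p(2) by (intro finite_PiE poly_roots_finite) auto
  moreover have "inj_on (\<lambda>\<sigma>. restrict \<sigma> B) (embeddings L)"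
  proof (rule inj_onI)
    fix \<sigma> \<tau> assume \<sigma>: "\<sigma> \<in> embeddings L" and \<tau>: "\<tau> \<in> embeddings L" and eq: "restrict \<sigma> B = restrict \<tau> B"
    have "subfield {x\<in>L. \<sigma> x = \<tau> x} CC"
      using \<sigma> \<tau> L
      by (intro subfield_CC_I)
        (auto simp: emb_1 emb_add emb_mult emb_uminus[OF L] emb_inverse[OF L]
          subfield_1 subfield_add subfield_mult subfield_uminus subfield_inverse)
    moreover have "B \<subseteq> {x\<in>L. \<sigma> x = \<tau> x}"
    proof
      fix x assume "x \<in> B"
      thus "x \<in> {x\<in>L. \<sigma> x = \<tau> x}" using fun_cong[OF eq, of x] B(2) by auto
    qed
    ultimately have "L \<subseteq> {x\<in>L. \<sigma> x = \<tau> x}" by (rule B(3))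
    thus "\<sigma> = \<tau>" by (intro embeddings_ext[OF \<sigma> \<tau>]) auto
  qed
  ultimately show ?thesis by (meson finite_imageD finite_subset)
qed

text \<open>An injective endomorphism of a number field permutes the finitely many conjugates of any
  given element.\<close>

lemma emb_surj:
  assumes "number_field L" "\<sigma> \<in> embeddings L" "\<sigma> ` L \<subseteq> L"
  shows "\<sigma> ` L = L"
proof
  show "L \<subseteq> \<sigma> ` L"
  proof
    fix x assume x: "x \<in> L"
    have L: "subfield L CC" using assms(1) by (rule number_field_subfield)
    obtain p where p: "p \<in> poly_over \<rat>" "p \<noteq> 0" "poly p x = 0"
      using number_field_algebraic[OF assms(1) x] .
    define R where "R = {y\<in>L. poly p y = 0}"
    have "finite R" using poly_roots_finite[OF p(2)] by (simp add: R_def)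
    moreover have "\<sigma> ` R \<subseteq> R"
      using emb_poly_root[OF L assms(2) p(1)] assms(3) by (auto simp: R_def)
    moreover have "inj_on \<sigma> R" by (rule inj_on_subset[OF emb_inj[OF L assms(2)]]) (auto simp: R_def)
    ultimately have "\<sigma> ` R = R" by (rule endo_inj_surj)
    moreover have "x \<in> R" using x p by (simp add: R_def)
    ultimately show "x \<in> \<sigma> ` L" by (force simp: R_def)
  qed
qed (use assms in auto)

section \<open>Extension of embeddings\<close>

lemma poly_over_division:
  assumes L: "subfield L CC" and q: "q \<in> poly_over L" "q \<noteq> 0" and p: "p \<in> poly_over L"
  shows "\<exists>s\<in>poly_over L. \<exists>r\<in>poly_over L. p = q * s + r \<and> (r = 0 \<or> Polynomial.degree r < Polynomial.degree q)"
  using p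
proof (induction "Polynomial.degree p" arbitrary: p rule: less_induct)
  case less
  show ?case
  proof (cases "p = 0 \<or> Polynomial.degree p < Polynomial.degree q")
    case True
    thus ?thesis using less.prems poly_over_0[OF L] by (intro bexI[of _ 0] bexI[of _ p]) auto
  next
    case False
    define t where "t = Polynomial.monom (Polynomial.lead_coeff p / Polynomial.lead_coeff q)
      (Polynomial.degree p - Polynomial.degree q)"
    define p' where "p' = p - q * t"
    have t: "t \<in> poly_over L"
      unfolding t_def using less.prems q
      by (intro poly_over_monom[OF L] subfield_divide[OF L]) (auto simp: poly_overD)
    have p': "p' \<in> poly_over L"
      unfolding p'_def by (intro poly_over_minus[OF L] poly_over_mult[OF L] less.prems q t)
    have c0: "Polynomial.lead_coeff p / Polynomial.lead_coeff q \<noteq> 0" using False q by simp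
    hence t0: "t \<noteq> 0" by (simp add: t_def)
    have deg: "Polynomial.degree (q * t) = Polynomial.degree p"
      using False q t0 c0 by (simp add: Polynomial.degree_mult_eq t_def Polynomial.degree_monom_eq)
    have "Polynomial.lead_coeff (q * t) = Polynomial.lead_coeff p"
      using c0 q by (simp add: Polynomial.lead_coeff_mult t_def Polynomial.degree_monom_eq)
    hence c: "Polynomial.coeff p' (Polynomial.degree p) = 0"
      using deg by (simp add: p'_def)
    have "Polynomial.degree p' \<le> Polynomial.degree p"
      unfolding p'_def using deg by (intro Polynomial.degree_diff_le) auto
    from Polynomial.eq_zero_or_degree_less[OF this c] show ?thesis
    proof
      assume "p' = 0"
      thus ?thesis using t poly_over_0[OF L] by (intro bexI[of _ t] bexI[of _ 0]) (auto simp: p'_def)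
    next
      assume "Polynomial.degree p' < Polynomial.degree p"
      from less.hyps[OF this p'] obtain s r where sr: "s \<in> poly_over L" "r \<in> poly_over L" "p' = q * s + r"
        "r = 0 \<or> Polynomial.degree r < Polynomial.degree q" by blast
      have "p = q * (s + t) + r" using sr(3) by (simp add: p'_def algebra_simps)
      thus ?thesis using sr poly_over_add[OF L sr(1) t] by blast
    qed
  qed
qed

text \<open>A generator, not necessarily monic, of the ideal of all polynomials over \<open>L\<close> that vanish at \<open>x\<close>.\<close>

definition min_poly_over :: "complex set \<Rightarrow> complex \<Rightarrow> complex poly \<Rightarrow> bool" where
  "min_poly_over L x m \<longleftrightarrow> m \<in> poly_over L \<and> m \<noteq> 0 \<and> poly m x = 0 \<and>
     (\<forall>f\<in>poly_over L. poly f x = 0 \<longrightarrow> (\<exists>s\<in>poly_over L. f = m * s))"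

lemma min_poly_over_exists:
  assumes L: "subfield L CC" and p: "p \<in> poly_over L" "p \<noteq> 0" "poly p x = 0"
  obtains m where "min_poly_over L x m"
proof -
  define P where "P q \<longleftrightarrow> q \<in> poly_over L \<and> q \<noteq> 0 \<and> poly q x = 0" for q
  have "P p" using p by (simp add: P_def)
  from ex_has_least_nat[of P, OF this, of Polynomial.degree] obtain m where
    m: "P m" "\<And>q. P q \<Longrightarrow> Polynomial.degree m \<le> Polynomial.degree q" by blast
  have "\<exists>s\<in>poly_over L. f = m * s" if f: "f \<in> poly_over L" "poly f x = 0" for f
  proof -
    obtain s r where sr: "s \<in> poly_over L" "r \<in> poly_over L" "f = m * s + r"
      "r = 0 \<or> Polynomial.degree r < Polynomial.degree m"
      using poly_over_division[OF L, of m f] m(1) f by (auto simp: P_def)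
    have "poly r x = 0" using f(2) m(1) sr(3) by (simp add: P_def)
    hence "r = 0" using m(2)[of r] sr by (force simp: P_def)
    thus ?thesis using sr by auto
  qed
  thus thesis using m(1) that[of m] by (auto simp: min_poly_over_def P_def)
qed

lemma poly_over_smult: "subfield L CC \<Longrightarrow> c \<in> L \<Longrightarrow> p \<in> poly_over L \<Longrightarrow> Polynomial.smult c p \<in> poly_over L"
  by (simp add: poly_over_def subfield_mult)

lemma poly_over_pcompose:
  assumes "subfield L CC" "p \<in> poly_over L" "q \<in> poly_over L"
  shows "pcompose p q \<in> poly_over L"
  using assms(2)
proof (induction p)
  case 0
  thus ?case using poly_over_0[OF assms(1)] by simp
next
  case (pCons a p)
  have a: "a \<in> L" using poly_overD[OF pCons.prems, of 0] by simp
  have p: "p \<in> poly_over L"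
    unfolding poly_over_def using poly_overD[OF pCons.prems, of "Suc i" for i] by simp
  show ?case unfolding pcompose_pCons
    by (intro poly_over_add poly_over_mult poly_over_pCons poly_over_0 assms a pCons.IH p)
qed

text \<open>The inverse of an algebraic number is a polynomial in it: solve the equation for the
  lowest nonzero coefficient.\<close>

lemma inverse_eq_poly:
  assumes L: "subfield L CC" and p: "p \<in> poly_over L" "p \<noteq> 0" "poly p a = 0" and a: "a \<noteq> 0"
  shows "\<exists>q\<in>poly_over L. inverse a = poly q a"
  using p
proof (induction p)
  case (pCons c p)
  have c: "c \<in> L" using poly_overD[OF pCons.prems(1), of 0] by simp
  have p: "p \<in> poly_over L"
    unfolding poly_over_def using poly_overD[OF pCons.prems(1), of "Suc i" for i] by simp
  show ?case
  proof (cases "c = 0")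
    case True
    thus ?thesis using pCons.IH[OF p] pCons.prems a by auto
  next
    case False
    have "inverse a = poly (Polynomial.smult (- inverse c) p) a"
      using pCons.prems(3) False a by (simp add: field_simps add_eq_0_iff)
    thus ?thesis using poly_over_smult[OF L _ p] subfield_uminus[OF L subfield_inverse[OF L c]] by blast
  qed
qed simp

text \<open>The map \<open>f(x) \<mapsto> f\<^sup>\<sigma>(y)\<close> on \<open>L[x]\<close> is well defined when \<open>y\<close> is a root of the conjugate of
  the minimal polynomial of \<open>x\<close>.\<close>

lemma extend_embedding_step:
  assumes M: "number_field M" and L: "subfield L CC" "L \<subseteq> M" and \<sigma>: "\<sigma> \<in> embeddings L"
    and x: "x \<in> M" and m: "min_poly_over L x m" and y: "poly (map_poly \<sigma> m) y = 0"
  obtains L' \<tau> where "subfield L' CC" "L \<subseteq> L'" "x \<in> L'" "L' \<subseteq> M" "\<tau> \<in> embeddings L'"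
    "\<And>a. a \<in> L \<Longrightarrow> \<tau> a = \<sigma> a" "\<tau> x = y"
proof -
  note \<sigma>0 = emb_0[OF L(1) \<sigma>]
  have coeff: "Polynomial.coeff (map_poly \<sigma> f) i = \<sigma> (Polynomial.coeff f i)" for f i
    by (rule coeff_map_poly) (rule \<sigma>0)
  have map_add: "map_poly \<sigma> (f + g) = map_poly \<sigma> f + map_poly \<sigma> g"
    if "f \<in> poly_over L" "g \<in> poly_over L" for f g
    using that by (intro poly_eqI) (simp add: coeff emb_add[OF \<sigma>] poly_overD)
  have map_mult: "map_poly \<sigma> (f * g) = map_poly \<sigma> f * map_poly \<sigma> g"
    if "f \<in> poly_over L" "g \<in> poly_over L" for f g
    using that
    by (intro poly_eqI)
      (simp add: coeff coeff_mult emb_sum[OF L(1) \<sigma>] emb_mult[OF \<sigma>] subfield_mult[OF L(1)] poly_overD)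
  have m': "m \<in> poly_over L" "m \<noteq> 0" "poly m x = 0"
    and m_dvd: "\<And>f. f \<in> poly_over L \<Longrightarrow> poly f x = 0 \<Longrightarrow> \<exists>s\<in>poly_over L. f = m * s"
    using m by (auto simp: min_poly_over_def)
  have wd: "poly (map_poly \<sigma> f) y = poly (map_poly \<sigma> g) y"
    if f: "f \<in> poly_over L" and g: "g \<in> poly_over L" and eq: "poly f x = poly g x" for f g
  proof -
    have "\<exists>s\<in>poly_over L. f - g = m * s"
      by (rule m_dvd[OF poly_over_minus[OF L(1) f g]]) (simp add: eq)
    then obtain s where s: "s \<in> poly_over L" "f = g + m * s" by (auto simp: algebra_simps)
    show ?thesis
      unfolding s(2) map_add[OF g poly_over_mult[OF L(1) m'(1) s(1)]] map_mult[OF m'(1) s(1)]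
      using y by simp
  qed
  define L' where "L' = (\<lambda>f. poly f x) ` poly_over L"
  define \<tau> where "\<tau> = (\<lambda>z\<in>L'. poly (map_poly \<sigma> (SOME f. f \<in> poly_over L \<and> poly f x = z)) y)"
  have L'I: "poly f x \<in> L'" if "f \<in> poly_over L" for f using that by (simp add: L'_def)
  have \<tau>: "\<tau> (poly f x) = poly (map_poly \<sigma> f) y" if f: "f \<in> poly_over L" for f
  proof -
    define g where "g = (SOME g. g \<in> poly_over L \<and> poly g x = poly f x)"
    have "g \<in> poly_over L \<and> poly g x = poly f x"
      unfolding g_def by (rule someI[of _ f]) (simp add: f)
    hence "poly (map_poly \<sigma> g) y = poly (map_poly \<sigma> f) y" using wd f by blast
    thus ?thesis using L'I[OF f] by (simp add: \<tau>_def g_def)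
  qed
  have const: "[:a:] \<in> poly_over L" if "a \<in> L" for a
    using that by (intro poly_over_pCons poly_over_0 L)
  have var: "[:0, 1:] \<in> poly_over L"
    by (intro poly_over_pCons poly_over_0 L subfield_0 subfield_1)
  have L'M: "L' \<subseteq> M"
  proof
    fix z assume "z \<in> L'"
    then obtain f where f: "f \<in> poly_over L" "z = poly f x" by (auto simp: L'_def)
    have "f \<in> poly_over M" using f(1) L(2) by (auto simp: poly_over_def)
    from poly_over_eval[OF number_field_subfield[OF M] this x] show "z \<in> M" by (simp add: f(2))
  qed
  show thesis
  proof (rule that[of L' \<tau>])
    show "subfield L' CC"
    proof (rule subfield_CC_I)
      show "1 \<in> L'" using L'I[OF const[OF subfield_1[OF L(1)]]] by simp
      fix a assume "a \<in> L'"
      then obtain f where f: "a = poly f x" "f \<in> poly_over L" by (auto simp: L'_def)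
      have "- f \<in> poly_over L" using poly_over_minus[OF L(1) poly_over_0[OF L(1)] f(2)] by simp
      from L'I[OF this] show "- a \<in> L'" by (simp add: f)
      { fix b assume "b \<in> L'"
        then obtain g where g: "b = poly g x" "g \<in> poly_over L" by (auto simp: L'_def)
        show "a + b \<in> L'" using L'I[OF poly_over_add[OF L(1) f(2) g(2)]] by (simp add: f g)
        show "a * b \<in> L'" using L'I[OF poly_over_mult[OF L(1) f(2) g(2)]] by (simp add: f g) }
      assume "a \<noteq> 0"
      have "a \<in> M" using \<open>a \<in> L'\<close> L'M by blast
      then obtain p where p: "p \<in> poly_over \<rat>" "p \<noteq> 0" "poly p a = 0"
        using number_field_algebraic[OF M] by blast
      have "p \<in> poly_over L" using p(1) subfield_Rats[OF L(1)] by (auto simp: poly_over_def)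
      then obtain q where q: "q \<in> poly_over L" "inverse a = poly q a"
        using inverse_eq_poly[OF L(1) _ p(2,3) \<open>a \<noteq> 0\<close>] by blast
      show "inverse a \<in> L'"
        using L'I[OF poly_over_pcompose[OF L(1) q(1) f(2)]] q(2) by (simp add: poly_pcompose f(1))
    qed
    show "L \<subseteq> L'" using L'I[OF const] by auto
    show "x \<in> L'" using L'I[OF var] by simp
    show "L' \<subseteq> M" by (rule L'M)
    show *: "\<tau> a = \<sigma> a" if "a \<in> L" for a
      using \<tau>[OF const[OF that]] \<sigma>0 by (simp add: map_poly_pCons)
    show "\<tau> x = y" using \<tau>[OF var] \<sigma>0 emb_1[OF \<sigma>] by (simp add: map_poly_pCons)
    show "\<tau> \<in> embeddings L'"
      unfolding embeddings_iff
    proof (intro conjI ballI)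
      show "\<tau> \<in> extensional L'" by (simp add: \<tau>_def)
      show "\<tau> 1 = 1" using *[OF subfield_1[OF L(1)]] emb_1[OF \<sigma>] by simp
      fix a b assume "a \<in> L'" "b \<in> L'"
      then obtain f g where f: "a = poly f x" "f \<in> poly_over L" and g: "b = poly g x" "g \<in> poly_over L"
        by (auto simp: L'_def)
      show "\<tau> (a + b) = \<tau> a + \<tau> b"
        using \<tau>[OF poly_over_add[OF L(1) f(2) g(2)]] by (simp add: f g \<tau> map_add)
      show "\<tau> (a * b) = \<tau> a * \<tau> b"
        using \<tau>[OF poly_over_mult[OF L(1) f(2) g(2)]] by (simp add: f g \<tau> map_mult)
    qed
  qed
qed

lemma min_poly_over_number_field:
  assumes "number_field M" "subfield L CC" "x \<in> M"
  obtains m where "min_poly_over L x m"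
proof -
  obtain p where p: "p \<in> poly_over \<rat>" "p \<noteq> 0" "poly p x = 0"
    using number_field_algebraic[OF assms(1,3)] .
  have "p \<in> poly_over L" using p(1) subfield_Rats[OF assms(2)] by (auto simp: poly_over_def)
  thus thesis using min_poly_over_exists[OF assms(2) _ p(2,3)] that by blast
qed

lemma min_poly_over_degree:
  assumes "min_poly_over L x m"
  shows "Polynomial.degree m \<noteq> 0"
proof
  assume "Polynomial.degree m = 0"
  then obtain c where "m = [:c:]" by (meson degree_eq_zeroE)
  thus False using assms by (auto simp: min_poly_over_def)
qed

text \<open>Generators of \<open>M\<close> are adjoined one at a time; the conjugate of the minimal polynomial has a root
  because the complex numbers are algebraically closed.\<close>

theorem extend_embedding:
  assumes M: "number_field M" and L: "subfield L CC" "L \<subseteq> M" and \<sigma>: "\<sigma> \<in> embeddings L"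
  obtains \<tau> where "\<tau> \<in> embeddings M" "\<And>a. a \<in> L \<Longrightarrow> \<tau> a = \<sigma> a"
proof -
  obtain B where B: "finite B" "B \<subseteq> M" "\<And>N. subfield N CC \<Longrightarrow> B \<subseteq> N \<Longrightarrow> M \<subseteq> N"
    using number_field_generators[OF M] by blast
  have "\<exists>L' \<tau>. subfield L' CC \<and> L \<subseteq> L' \<and> B \<subseteq> L' \<and> L' \<subseteq> M \<and> \<tau> \<in> embeddings L' \<and> (\<forall>a\<in>L. \<tau> a = \<sigma> a)"
    using B(1,2)
  proof (induction B rule: finite_induct)
    case empty
    thus ?case using L \<sigma> by blast
  next
    case (insert x B)
    then obtain L' \<tau> where *: "subfield L' CC" "L \<subseteq> L'" "B \<subseteq> L'" "L' \<subseteq> M" "\<tau> \<in> embeddings L'" "\<forall>a\<in>L. \<tau> a = \<sigma> a"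
      by auto
    have x: "x \<in> M" using insert.prems by simp
    obtain m where m: "min_poly_over L' x m" using min_poly_over_number_field[OF M *(1) x] .
    have m': "m \<in> poly_over L'" "m \<noteq> 0" using m by (auto simp: min_poly_over_def)
    have "Polynomial.degree (map_poly \<tau> m) = Polynomial.degree m"
    proof (rule map_poly_degree_eq)
      show "\<tau> (Polynomial.lead_coeff m) \<noteq> 0"
        using emb_eq_0_iff[OF *(1,5) poly_overD[OF m'(1)]] m'(2) by simp
    qed
    hence "\<not> constant (poly (map_poly \<tau> m))"
      using min_poly_over_degree[OF m] by (simp add: constant_degree)
    then obtain y where y: "poly (map_poly \<tau> m) y = 0"
      using fundamental_theorem_of_algebra by blast
    obtain L'' \<tau>' where **: "subfield L'' CC" "L' \<subseteq> L''" "x \<in> L''" "L'' \<subseteq> M" "\<tau>' \<in> embeddings L''"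
      "\<And>a. a \<in> L' \<Longrightarrow> \<tau>' a = \<tau> a" "\<tau>' x = y"
      using extend_embedding_step[OF M *(1,4,5) x m y] by blast
    have "\<forall>a\<in>L. \<tau>' a = \<sigma> a" using *(2,6) **(6) by auto
    moreover have "L \<subseteq> L''" "insert x B \<subseteq> L''" using * ** by auto
    ultimately show ?case using **(1,4,5) by blast
  qed
  then obtain L' \<tau> where *: "subfield L' CC" "L \<subseteq> L'" "B \<subseteq> L'" "L' \<subseteq> M" "\<tau> \<in> embeddings L'" "\<forall>a\<in>L. \<tau> a = \<sigma> a"
    by blast
  have "L' = M" using B(3)[OF *(1,3)] *(4) by blast
  thus thesis using that[of \<tau>] * by blast
qed

text \<open>If every embedding over \<open>L\<close> fixes \<open>x\<close>, then \<open>x\<close> is the only root of its minimal polynomial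
  \<open>c(T - x)\<^sup>n\<close>, and in characteristic zero its second coefficient \<open>- cnx\<close> already gives \<open>x\<close>.\<close>

theorem fixed_by_embeddings_imp_mem:
  assumes M: "number_field M" and L: "subfield L CC" "L \<subseteq> M" and x: "x \<in> M"
    and fix_x: "\<And>\<tau>. \<tau> \<in> embeddings M \<Longrightarrow> (\<And>a. a \<in> L \<Longrightarrow> \<tau> a = a) \<Longrightarrow> \<tau> x = x"
  shows "x \<in> L"
proof -
  obtain m where m: "min_poly_over L x m" using min_poly_over_number_field[OF M L(1) x] .
  have m': "m \<in> poly_over L" "m \<noteq> 0" "poly m x = 0" using m by (auto simp: min_poly_over_def)
  have root: "y = x" if y: "poly m y = 0" for y
  proof -
    have "map_poly (\<lambda>a\<in>L. a) m = m"
      by (rule poly_eqI) (simp add: coeff_map_poly subfield_0[OF L(1)] poly_overD[OF m'(1)])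
    hence y': "poly (map_poly (\<lambda>a\<in>L. a) m) y = 0" using y by simp
    obtain L' \<tau> where *: "subfield L' CC" "L \<subseteq> L'" "x \<in> L'" "L' \<subseteq> M" "\<tau> \<in> embeddings L'"
      "\<And>a. a \<in> L \<Longrightarrow> \<tau> a = (\<lambda>a\<in>L. a) a" "\<tau> x = y"
      using extend_embedding_step[OF M L emb_id[OF L(1)] x m y'] by blast
    obtain \<rho> where \<rho>: "\<rho> \<in> embeddings M" "\<And>a. a \<in> L' \<Longrightarrow> \<rho> a = \<tau> a"
      using extend_embedding[OF M *(1,4,5)] by blast
    have "\<rho> x = x" using * \<rho> by (intro fix_x) auto
    thus ?thesis using * \<rho> by simp
  qed
  have "{z. poly m z = 0} = {x}" using root m'(3) by blast
  hence m_eq: "m = Polynomial.smult (Polynomial.lead_coeff m) ([:- x, 1:] ^ Polynomial.order x m)"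
    using complex_poly_decompose[of m] by (simp only:) simp
  define n where "n = Polynomial.order x m"
  have n: "n \<noteq> 0" using m' by (simp add: n_def Polynomial.order_root)
  have c: "Polynomial.lead_coeff m \<noteq> 0" using m' by simp
  have "Polynomial.coeff m (n - 1) = Polynomial.lead_coeff m * (of_nat n * (- x))"
  proof -
    have "Polynomial.coeff m (n - 1) =
        Polynomial.coeff (Polynomial.smult (Polynomial.lead_coeff m) ([:- x, 1:] ^ n)) (n - 1)"
      unfolding n_def using m_eq by metis
    also have "\<dots> = Polynomial.lead_coeff m * (of_nat n * (- x))"
      using n binomial_symmetric[of 1 n] by (simp add: coeff_linear_poly_power)
    finally show ?thesis .
  qed
  hence "x = - Polynomial.coeff m (n - 1) / (Polynomial.lead_coeff m * of_nat n)"
    using n c by (simp add: field_simps)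
  also have "\<dots> \<in> L"
    using poly_overD[OF m'(1)] L
    by (intro subfield_divide subfield_uminus subfield_mult subfield_of_nat) auto
  finally show ?thesis .
qed

section \<open>Galois fields and Galois closures\<close>

lemma galois_number_field: "galois_over_rat L \<Longrightarrow> number_field L"
  and galois_subfield: "galois_over_rat L \<Longrightarrow> subfield L CC"
  by (auto simp: galois_over_rat_def number_field_def)

lemma galois_emb_mem: "galois_over_rat L \<Longrightarrow> \<sigma> \<in> embeddings L \<Longrightarrow> x \<in> L \<Longrightarrow> \<sigma> x \<in> L"
  by (auto simp: galois_over_rat_def)

text \<open>An embedding of the intersection extends to every member of the family, and each member is preserved by
  the extension.\<close>

lemma galois_Inter:
  assumes "\<L> \<noteq> {}" "\<And>L. L \<in> \<L> \<Longrightarrow> galois_over_rat L"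
  shows "galois_over_rat (\<Inter>\<L>)"
proof -
  have sub: "subfield (\<Inter>\<L>) CC"
    using galois_subfield[OF assms(2)]
    by (intro subfield_CC_I)
      (auto intro: subfield_1 subfield_add subfield_mult subfield_uminus subfield_inverse)
  obtain L where L: "L \<in> \<L>" using assms(1) by blast
  have nf: "number_field (\<Inter>\<L>)"
    by (rule number_field_subset[OF galois_number_field[OF assms(2)[OF L]] sub]) (use L in auto)
  have "\<sigma> x \<in> M" if \<sigma>: "\<sigma> \<in> embeddings (\<Inter>\<L>)" and x: "x \<in> \<Inter>\<L>" and M: "M \<in> \<L>" for \<sigma> x M
  proof -
    obtain \<tau> where \<tau>: "\<tau> \<in> embeddings M" "\<And>a. a \<in> \<Inter>\<L> \<Longrightarrow> \<tau> a = \<sigma> a"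
      using extend_embedding[OF galois_number_field[OF assms(2)[OF M]] sub _ \<sigma>] M by blast
    have "\<tau> x \<in> M" using galois_emb_mem[OF assms(2)[OF M] \<tau>(1)] x M by blast
    thus ?thesis using \<tau>(2)[OF x] by simp
  qed
  thus ?thesis using nf by (auto simp: galois_over_rat_def)
qed

text \<open>The field generated by all conjugates of a finite generating set: an embedding of it permutes these
  conjugates.\<close>

lemma galois_overfield_exists:
  assumes K: "number_field K"
  obtains M where "K \<subseteq> M" "galois_over_rat M"
proof -
  note Ks = number_field_subfield[OF K]
  obtain B where B: "finite B" "B \<subseteq> K" "\<And>N. subfield N CC \<Longrightarrow> B \<subseteq> N \<Longrightarrow> K \<subseteq> N"
    using number_field_generators[OF K] by blast
  define C where "C = (\<Union>\<sigma>\<in>embeddings K. \<sigma> ` B)"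
  have "finite C" using embeddings_finite[OF K] B(1) by (simp add: C_def)
  then obtain xs where xs: "set xs = C" using finite_list by blast
  have alg: "(CC.algebraic over \<rat>) x" if x: "x \<in> set xs" for x
  proof -
    obtain \<sigma> b where \<sigma>: "\<sigma> \<in> embeddings K" "b \<in> K" "x = \<sigma> b" using x B(2) unfolding xs C_def by blast
    obtain p where p: "p \<in> carrier (\<rat>[X]\<^bsub>CC\<^esub>)" "p \<noteq> []" "CC.eval p b = 0"
      using CC.algebraicE[OF subfieldE(1)[OF subfield_Rats_CC], of b]
        CC.finite_dimension_imp_algebraic[OF subfield_Rats_CC subfieldE(1)[OF Ks] _ \<sigma>(2)] K
      by (auto simp: number_field_def)
    have "set p \<subseteq> \<rat>" using p by (auto simp: univ_poly_def polynomial_def)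
    hence "Poly (rev p) \<in> poly_over \<rat>"
      by (auto simp: poly_over_def nth_default_def) (metis length_rev nth_mem set_rev subsetD)
    from emb_poly_root[OF Ks \<sigma>(1) this \<sigma>(2)] p(3) have "CC.eval p x = 0"
      by (simp add: CC_eval_eq_poly \<sigma>(3))
    thus ?thesis using CC.algebraicI[OF p(1,2)] by simp
  qed
  define M where "M = CC.finite_extension \<rat> xs"
  have M: "subfield M CC"
    unfolding M_def by (rule CC.finite_extension_is_subfield[OF subfield_Rats_CC _ alg]) auto
  have Mnf: "number_field M"
    using M CC.finite_extension_finite_dimension(1)[OF subfield_Rats_CC _ alg]
    by (simp add: number_field_def M_def)
  have CM: "C \<subseteq> M"
    unfolding M_def using CC.finite_extension_mem[OF subfieldE(1)[OF subfield_Rats_CC], of xs] xs by simp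
  have Mmin: "M \<subseteq> N" if "subfield N CC" "C \<subseteq> N" for N
    unfolding M_def using that xs subfield_Rats[OF that(1)]
    by (intro CC.finite_extension_subring_incl) (auto simp: subfieldE(1))
  have img: "\<rho> x \<in> M" if \<rho>: "\<rho> \<in> embeddings K" and x: "x \<in> K" for \<rho> x
  proof -
    have "subfield {x\<in>K. \<rho> x \<in> M} CC"
      using Ks \<rho> M
      by (intro subfield_CC_I)
        (auto simp: emb_1 emb_add emb_mult emb_uminus[OF Ks] emb_inverse[OF Ks]
          subfield_1 subfield_add subfield_mult subfield_uminus subfield_inverse)
    moreover have "B \<subseteq> {x\<in>K. \<rho> x \<in> M}" using B(2) CM \<rho> by (auto simp: C_def)
    ultimately show ?thesis using B(3) x by blast
  qed
  have KM: "K \<subseteq> M" using img[OF emb_id[OF Ks]] by auto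
  have "\<sigma> ` M \<subseteq> M" if \<sigma>: "\<sigma> \<in> embeddings M" for \<sigma>
  proof -
    have "subfield {x\<in>M. \<sigma> x \<in> M} CC"
      using \<sigma> M
      by (intro subfield_CC_I)
        (auto simp: emb_1 emb_add emb_mult emb_uminus[OF M] emb_inverse[OF M]
          subfield_1 subfield_add subfield_mult subfield_uminus subfield_inverse)
    moreover have "C \<subseteq> {x\<in>M. \<sigma> x \<in> M}"
    proof
      fix c assume c: "c \<in> C"
      then obtain \<rho> b where \<rho>: "\<rho> \<in> embeddings K" "b \<in> B" "c = \<rho> b" by (auto simp: C_def)
      have "compose K \<sigma> \<rho> \<in> embeddings K"
        using emb_compose[OF Ks \<rho>(1) \<sigma>] img[OF \<rho>(1)] by blast
      hence "compose K \<sigma> \<rho> b \<in> C" using \<rho>(2) by (auto simp: C_def)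
      hence "\<sigma> c \<in> C" using \<rho> B(2) by (auto simp: compose_eq)
      thus "c \<in> {x\<in>M. \<sigma> x \<in> M}" using c CM by auto
    qed
    ultimately show ?thesis using Mmin by blast
  qed
  thus thesis using that[OF KM] Mnf by (auto simp: galois_over_rat_def)
qed

theorem galois_closure_galois:
  assumes "number_field K"
  shows "galois_over_rat (galois_closure K)"
  unfolding galois_closure_def using galois_overfield_exists[OF assms] by (intro galois_Inter) blast+

lemma galois_closure_superset: "K \<subseteq> galois_closure K"
  by (auto simp: galois_closure_def)

lemma galois_closure_minimal: "K \<subseteq> L \<Longrightarrow> galois_over_rat L \<Longrightarrow> galois_closure K \<subseteq> L"
  by (auto simp: galois_closure_def)

lemma carrier_gal_group: 
  assumes "galois_over_rat L"
  shows "carrier (gal_group L) = embeddings L"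
proof -
  have "\<sigma> ` L = L" if "\<sigma> \<in> embeddings L" for \<sigma>
    using assms that emb_surj[OF galois_number_field[OF assms] that] by (simp add: galois_over_rat_def)
  thus ?thesis by (auto simp: gal_group_def)
qed

lemma gal_group_mult: "\<sigma> \<otimes>\<^bsub>gal_group L\<^esub> \<tau> = compose L \<sigma> \<tau>"
  and gal_group_one: "\<one>\<^bsub>gal_group L\<^esub> = (\<lambda>x\<in>L. x)"
  by (simp_all add: gal_group_def)

lemma gal_group_group:
  assumes L: "galois_over_rat L"
  shows "group (gal_group L)"
proof (rule groupI)
  note Ls = galois_subfield[OF L]
  note [simp] = carrier_gal_group[OF L] gal_group_mult gal_group_one
  fix \<sigma> assume "\<sigma> \<in> carrier (gal_group L)"
  hence \<sigma>: "\<sigma> \<in> embeddings L" by simp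
  have ext: "\<sigma> \<in> extensional L" using \<sigma> by (simp add: embeddings_iff)
  show "\<one>\<^bsub>gal_group L\<^esub> \<otimes>\<^bsub>gal_group L\<^esub> \<sigma> = \<sigma>"
    using ext galois_emb_mem[OF L \<sigma>] by (auto simp: compose_def restrict_def extensional_def fun_eq_iff)
  { fix \<tau> assume "\<tau> \<in> carrier (gal_group L)"
    hence \<tau>: "\<tau> \<in> embeddings L" by simp
    show "\<sigma> \<otimes>\<^bsub>gal_group L\<^esub> \<tau> \<in> carrier (gal_group L)"
      using emb_compose[OF Ls \<tau> \<sigma>] galois_emb_mem[OF L \<tau>] by auto
    fix \<rho> assume "\<rho> \<in> carrier (gal_group L)"
    thus "\<sigma> \<otimes>\<^bsub>gal_group L\<^esub> \<tau> \<otimes>\<^bsub>gal_group L\<^esub> \<rho> = \<sigma> \<otimes>\<^bsub>gal_group L\<^esub> (\<tau> \<otimes>\<^bsub>gal_group L\<^esub> \<rho>)"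
      using galois_emb_mem[OF L] by (auto simp: compose_def fun_eq_iff) }
  define \<tau> where "\<tau> = (\<lambda>x\<in>L. inv_into L \<sigma> x)"
  have surj: "\<sigma> ` L = L"
    using emb_surj[OF galois_number_field[OF L] \<sigma>] L \<sigma> by (auto simp: galois_over_rat_def)
  have \<tau>\<sigma>: "\<tau> (\<sigma> x) = x" if "x \<in> L" for x
    using that emb_inj[OF Ls \<sigma>] surj by (auto simp: \<tau>_def)
  have "\<tau> \<in> embeddings L"
    unfolding embeddings_iff
  proof (intro conjI ballI)
    show "\<tau> \<in> extensional L" by (simp add: \<tau>_def)
    show "\<tau> 1 = 1" using \<tau>\<sigma>[OF subfield_1[OF Ls]] emb_1[OF \<sigma>] by simp
    fix a b assume "a \<in> L" "b \<in> L"
    hence "a \<in> \<sigma> ` L" "b \<in> \<sigma> ` L" unfolding surj .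
    then obtain x y where x: "x \<in> L" "a = \<sigma> x" and y: "y \<in> L" "b = \<sigma> y" by (elim imageE)
    show "\<tau> (a + b) = \<tau> a + \<tau> b"
      using \<tau>\<sigma>[OF subfield_add[OF Ls x(1) y(1)]] by (simp add: x y \<tau>\<sigma> emb_add[OF \<sigma>])
    show "\<tau> (a * b) = \<tau> a * \<tau> b"
      using \<tau>\<sigma>[OF subfield_mult[OF Ls x(1) y(1)]] by (simp add: x y \<tau>\<sigma> emb_mult[OF \<sigma>])
  qed
  moreover have "compose L \<tau> \<sigma> = (\<lambda>x\<in>L. x)" using \<tau>\<sigma> by (auto simp: compose_def restrict_def)
  ultimately show "\<exists>\<tau>\<in>carrier (gal_group L). \<tau> \<otimes>\<^bsub>gal_group L\<^esub> \<sigma> = \<one>\<^bsub>gal_group L\<^esub>" by auto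
qed (use emb_id[OF galois_subfield[OF L]] in \<open>simp add: carrier_gal_group[OF L] gal_group_one\<close>)

section \<open>Separating embeddings by finite families\<close>

text \<open>The functions \<open>\<sigma> \<mapsto> \<Sum>\<^sub>j y\<^sub>j \<sigma>(x\<^sub>j)\<close> with \<open>x\<^sub>j, y\<^sub>j \<in> F\<close> are closed under products and contain
  \<open>\<sigma> \<mapsto> (\<sigma>(t) - \<tau>(t)) / (\<sigma>\<^sub>0(t) - \<tau>(t))\<close>, which is \<open>1\<close> at \<open>\<sigma>\<^sub>0\<close> and \<open>0\<close> at \<open>\<tau>\<close>. The product over all
  \<open>\<tau> \<noteq> \<sigma>\<^sub>0\<close> is the characteristic function of \<open>\<sigma>\<^sub>0\<close>. The resulting tensor \<open>\<Sum>\<^sub>j y\<^sub>j \<otimes> x\<^sub>j\<close> replaces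
  dual bases, primitive elements and determinants in everything that follows.\<close>

theorem separating_family:
  assumes F: "subfield F CC" and S: "finite S" "S \<subseteq> embeddings F" "\<And>\<sigma>. \<sigma> \<in> S \<Longrightarrow> \<sigma> ` F \<subseteq> F"
    and \<sigma>0: "\<sigma>\<^sub>0 \<in> S"
  obtains n :: nat and x y where "\<And>j. j < n \<Longrightarrow> x j \<in> F" "\<And>j. j < n \<Longrightarrow> y j \<in> F"
    "\<And>\<sigma>. \<sigma> \<in> S \<Longrightarrow> (\<Sum>j<n. y j * \<sigma> (x j)) = (if \<sigma> = \<sigma>\<^sub>0 then 1 else 0)"
proof -
  define ev :: "(complex \<times> complex) list \<Rightarrow> (complex \<Rightarrow> complex) \<Rightarrow> complex"
    where "ev ps \<sigma> = (\<Sum>(a, b)\<leftarrow>ps. b * \<sigma> a)" for ps \<sigma>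
  define D where "D = {g. \<exists>ps. set ps \<subseteq> F \<times> F \<and> (\<forall>\<sigma>\<in>S. g \<sigma> = ev ps \<sigma>)}"
  have mult: "\<exists>rs. set rs \<subseteq> F \<times> F \<and> (\<forall>\<sigma>\<in>S. ev ps \<sigma> * ev qs \<sigma> = ev rs \<sigma>)"
    if "set ps \<subseteq> F \<times> F" "set qs \<subseteq> F \<times> F" for ps qs
    using that(1)
  proof (induction ps)
    case Nil
    thus ?case by (intro exI[of _ "[]"]) (simp add: ev_def)
  next
    case (Cons p ps)
    obtain a b where p: "p = (a, b)" "a \<in> F" "b \<in> F" using Cons.prems by (cases p) auto
    obtain rs where rs: "set rs \<subseteq> F \<times> F" "\<forall>\<sigma>\<in>S. ev ps \<sigma> * ev qs \<sigma> = ev rs \<sigma>"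
      using Cons by auto
    define ts where "ts = map (\<lambda>(a', b'). (a * a', b * b')) qs"
    have ts: "set ts \<subseteq> F \<times> F"
      using that(2) p by (auto simp: ts_def subfield_mult[OF F])
    have "b * \<sigma> a * ev qs \<sigma> = ev ts \<sigma>" if "\<sigma> \<in> S" for \<sigma>
    proof -
      have "\<sigma> (a * a') = \<sigma> a * \<sigma> a'" if "(a', b') \<in> set qs" for a' b'
        using that \<open>set qs \<subseteq> F \<times> F\<close> p(2) \<open>\<sigma> \<in> S\<close> S(2) by (intro emb_mult) auto
      thus ?thesis
        unfolding ev_def ts_def map_map o_def sum_list_const_mult[symmetric]
        by (intro arg_cong[of _ _ sum_list] map_cong) (auto simp: mult_ac)
    qed
    hence "\<forall>\<sigma>\<in>S. ev (p # ps) \<sigma> * ev qs \<sigma> = ev (ts @ rs) \<sigma>"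
      using rs(2) by (auto simp: ev_def p algebra_simps)
    thus ?case using rs(1) ts by (intro exI[of _ "ts @ rs"]) auto
  qed
  have D_mult: "(\<lambda>\<sigma>. g \<sigma> * g' \<sigma>) \<in> D" if "g \<in> D" "g' \<in> D" for g g'
  proof -
    obtain ps qs where "set ps \<subseteq> F \<times> F" "set qs \<subseteq> F \<times> F" "\<forall>\<sigma>\<in>S. g \<sigma> = ev ps \<sigma>" "\<forall>\<sigma>\<in>S. g' \<sigma> = ev qs \<sigma>"
      using \<open>g \<in> D\<close> \<open>g' \<in> D\<close> by (auto simp: D_def)
    thus ?thesis using mult[of ps qs] unfolding D_def by auto
  qed
  have one: "\<sigma> 1 = 1" if "\<sigma> \<in> S" for \<sigma> using that S(2) emb_1 by blast
  have D_one: "(\<lambda>\<sigma>. 1) \<in> D"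
    unfolding D_def using subfield_1[OF F] one by (auto intro!: exI[of _ "[(1, 1)]"] simp: ev_def)
  have sep: "\<exists>g\<in>D. g \<sigma>\<^sub>0 = 1 \<and> g \<tau> = 0" if \<tau>: "\<tau> \<in> S" "\<tau> \<noteq> \<sigma>\<^sub>0" for \<tau>
  proof -
    obtain t where t: "t \<in> F" "\<sigma>\<^sub>0 t \<noteq> \<tau> t"
      using \<tau> \<sigma>0 S(2) embeddings_ext[of \<sigma>\<^sub>0 F \<tau>] by blast
    define c where "c = inverse (\<sigma>\<^sub>0 t - \<tau> t)"
    have tF: "\<sigma>\<^sub>0 t \<in> F" "\<tau> t \<in> F" using S(3) \<sigma>0 \<tau> t by auto
    have c: "c \<in> F" unfolding c_def by (intro subfield_inverse subfield_minus F tF)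
    have mem: "set [(t, c), (1, - (c * \<tau> t))] \<subseteq> F \<times> F"
      using t c tF by (auto intro!: subfield_1 subfield_uminus subfield_mult F)
    \<comment> \<open>The constant \<open>\<tau>(t)\<close> is a multiple of the function \<open>\<sigma> \<mapsto> \<sigma>(1)\<close>.\<close>
    have "\<sigma> \<in> S \<Longrightarrow> c * (\<sigma> t - \<tau> t) = ev [(t, c), (1, - (c * \<tau> t))] \<sigma>" for \<sigma>
      by (simp add: ev_def one algebra_simps)
    with mem have "(\<lambda>\<sigma>. c * (\<sigma> t - \<tau> t)) \<in> D"
      unfolding D_def by blast
    moreover have "c * (\<sigma>\<^sub>0 t - \<tau> t) = 1" "c * (\<tau> t - \<tau> t) = 0" using t(2) by (auto simp: c_def)
    ultimately show ?thesis by (intro bexI[of _ "\<lambda>\<sigma>. c * (\<sigma> t - \<tau> t)"] conjI)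
  qed
  have "\<exists>g\<in>D. g \<sigma>\<^sub>0 = 1 \<and> (\<forall>\<tau>\<in>T. g \<tau> = 0)" if "finite T" "T \<subseteq> S - {\<sigma>\<^sub>0}" for T
    using that
  proof (induction T rule: finite_induct)
    case empty
    show ?case using D_one by auto
  next
    case (insert \<tau> T)
    then obtain g where g: "g \<in> D" "g \<sigma>\<^sub>0 = 1" "\<forall>\<tau>\<in>T. g \<tau> = 0" by auto
    obtain g' where g': "g' \<in> D" "g' \<sigma>\<^sub>0 = 1" "g' \<tau> = 0" using sep[of \<tau>] insert.prems by auto
    show ?case using D_mult[OF g(1) g'(1)] g g' by (intro bexI[of _ "\<lambda>\<sigma>. g \<sigma> * g' \<sigma>"]) auto
  qed
  from this[of "S - {\<sigma>\<^sub>0}"] obtain g where g: "g \<in> D" "g \<sigma>\<^sub>0 = 1" "\<forall>\<tau>\<in>S - {\<sigma>\<^sub>0}. g \<tau> = 0"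
    using S(1) by auto
  from g(1) obtain ps where ps: "set ps \<subseteq> F \<times> F" "\<forall>\<sigma>\<in>S. g \<sigma> = ev ps \<sigma>" by (auto simp: D_def)
  have nth: "ps ! j \<in> F \<times> F" if "j < length ps" for j using that ps(1) by auto
  show thesis
  proof (rule that[of "length ps" "\<lambda>j. fst (ps ! j)" "\<lambda>j. snd (ps ! j)"])
    fix \<sigma> assume \<sigma>: "\<sigma> \<in> S"
    have "(\<Sum>j<length ps. snd (ps ! j) * \<sigma> (fst (ps ! j))) = ev ps \<sigma>"
      by (simp add: ev_def sum_list_sum_nth case_prod_beta atLeast0LessThan)
    thus "(\<Sum>j<length ps. snd (ps ! j) * \<sigma> (fst (ps ! j))) = (if \<sigma> = \<sigma>\<^sub>0 then 1 else 0)"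
      using \<sigma> ps(2) g by auto
  qed (use nth in \<open>auto simp: mem_Times_iff\<close>)
qed

section \<open>Averaging over a Galois group\<close>

lemma sum_group_translate:
  assumes "group G" "subgroup H G" "finite H" "h \<in> H"
  shows "(\<Sum>k\<in>H. f (h \<otimes>\<^bsub>G\<^esub> k)) = (\<Sum>k\<in>H. f k)"
proof -
  interpret H: group "G\<lparr>carrier := H\<rparr>" using subgroup.subgroup_is_group[OF assms(2,1)] .
  have "(\<lambda>k. h \<otimes>\<^bsub>G\<^esub> k) ` H = H"
    using H.surj_const_mult[of h] assms(4) by simp
  moreover from this have "inj_on (\<lambda>k. h \<otimes>\<^bsub>G\<^esub> k) H"
    using assms(3) by (intro eq_card_imp_inj_on) auto
  ultimately have "bij_betw (\<lambda>k. h \<otimes>\<^bsub>G\<^esub> k) H H" by (simp add: bij_betw_def)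
  thus ?thesis by (rule sum.reindex_bij_betw)
qed

text \<open>With a family separating the identity, \<open>\<Sum>\<^sub>j y\<^sub>j \<Sum>\<^sub>h h(x\<^sub>j)\<close> counts how often \<open>h = id\<close>, which is once; the automorphism fixes the traces
  \<open>\<Sum>\<^sub>h h(x\<^sub>j)\<close>, so the identity is also of the form \<open>\<tau>h\<close>.\<close>

theorem fixes_fixed_field_imp_mem:
  assumes L: "galois_over_rat L" and H: "subgroup H (gal_group L)" and \<tau>: "\<tau> \<in> carrier (gal_group L)"
    and fixed: "\<And>x. x \<in> L \<Longrightarrow> (\<And>h. h \<in> H \<Longrightarrow> h x = x) \<Longrightarrow> \<tau> x = x"
  shows "\<tau> \<in> H"
proof -
  let ?G = "gal_group L"
  note Ls = galois_subfield[OF L] and G_eq = carrier_gal_group[OF L]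
  interpret G: group ?G by (rule gal_group_group[OF L])
  have fin: "finite (carrier ?G)" using embeddings_finite[OF galois_number_field[OF L]] by (simp add: G_eq)
  have HG: "H \<subseteq> carrier ?G" using H by (rule subgroup.subset)
  have finH: "finite H" using finite_subset[OF HG fin] .
  have closed: "h x \<in> L" if "h \<in> carrier ?G" "x \<in> L" for h x
    using that galois_emb_mem[OF L] by (simp add: G_eq)
  have app: "(\<sigma> \<otimes>\<^bsub>?G\<^esub> h) x = \<sigma> (h x)" if "x \<in> L" for \<sigma> h x
    using that by (simp add: gal_group_mult compose_eq)
  have S: "carrier ?G \<subseteq> embeddings L" "\<And>\<sigma>. \<sigma> \<in> carrier ?G \<Longrightarrow> \<sigma> ` L \<subseteq> L"
    using closed by (auto simp: G_eq)
  obtain n and x y :: "nat \<Rightarrow> complex" where xy: "\<And>j. j < n \<Longrightarrow> x j \<in> L" "\<And>j. j < n \<Longrightarrow> y j \<in> L"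
    "\<And>\<sigma>. \<sigma> \<in> carrier ?G \<Longrightarrow> (\<Sum>j<n. y j * \<sigma> (x j)) = (if \<sigma> = \<one>\<^bsub>?G\<^esub> then 1 else 0)"
    using separating_family[OF Ls fin S G.one_closed] by blast
  have tr: "\<tau> (\<Sum>h\<in>H. h (x j)) = (\<Sum>h\<in>H. h (x j))" if j: "j < n" for j
  proof (rule fixed)
    show "(\<Sum>h\<in>H. h (x j)) \<in> L" using HG closed xy(1)[OF j] by (intro subfield_sum[OF Ls]) auto
    fix k assume k: "k \<in> H"
    have "k (\<Sum>h\<in>H. h (x j)) = (\<Sum>h\<in>H. k (h (x j)))"
      using k HG closed xy(1)[OF j] by (intro emb_sum[OF Ls]) (auto simp: G_eq)
    also have "\<dots> = (\<Sum>h\<in>H. (k \<otimes>\<^bsub>?G\<^esub> h) (x j))" using xy(1)[OF j] by (simp add: app)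
    also have "\<dots> = (\<Sum>h\<in>H. h (x j))"
      by (rule sum_group_translate[OF G.is_group H finH k])
    finally show "k (\<Sum>h\<in>H. h (x j)) = (\<Sum>h\<in>H. h (x j))" .
  qed
  have "1 = (\<Sum>h\<in>H. if h = \<one>\<^bsub>?G\<^esub> then 1 else 0 :: complex)"
    using finH subgroup.one_closed[OF H] by simp
  also have "\<dots> = (\<Sum>h\<in>H. \<Sum>j<n. y j * h (x j))" using HG xy(3) by (intro sum.cong) auto
  also have "\<dots> = (\<Sum>j<n. y j * (\<Sum>h\<in>H. h (x j)))"
    by (subst sum.swap) (simp add: sum_distrib_left)
  also have "\<dots> = (\<Sum>j<n. y j * \<tau> (\<Sum>h\<in>H. h (x j)))" using tr by simp
  also have "\<dots> = (\<Sum>j<n. y j * (\<Sum>h\<in>H. \<tau> (h (x j))))"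
    using HG closed xy(1) \<tau> by (intro sum.cong refl arg_cong2[of _ _ _ _ "(*)"] emb_sum[OF Ls]) (auto simp: G_eq)
  also have "\<dots> = (\<Sum>h\<in>H. \<Sum>j<n. y j * (\<tau> \<otimes>\<^bsub>?G\<^esub> h) (x j))"
    by (subst sum.swap) (simp add: sum_distrib_left app xy(1))
  also have "\<dots> = (\<Sum>h\<in>H. if \<tau> \<otimes>\<^bsub>?G\<^esub> h = \<one>\<^bsub>?G\<^esub> then 1 else 0)"
    using HG \<tau> xy(3) by (intro sum.cong) auto
  finally have *: "1 = (\<Sum>h\<in>H. if \<tau> \<otimes>\<^bsub>?G\<^esub> h = \<one>\<^bsub>?G\<^esub> then 1 else 0 :: complex)" .
  have "\<exists>h\<in>H. \<tau> \<otimes>\<^bsub>?G\<^esub> h = \<one>\<^bsub>?G\<^esub>"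
  proof (rule ccontr)
    assume "\<not> ?thesis"
    hence "(\<Sum>h\<in>H. if \<tau> \<otimes>\<^bsub>?G\<^esub> h = \<one>\<^bsub>?G\<^esub> then 1 else 0 :: complex) = 0"
      by (intro sum.neutral) auto
    with * show False by simp
  qed
  then obtain h where h: "h \<in> H" "\<tau> \<otimes>\<^bsub>?G\<^esub> h = \<one>\<^bsub>?G\<^esub>" ..
  have hG: "h \<in> carrier ?G" using h(1) HG by (rule rev_subsetD)
  have "\<tau> = inv\<^bsub>?G\<^esub> h" by (rule G.inv_equality[OF h(2) hG \<tau>, symmetric])
  thus ?thesis using subgroup.m_inv_closed[OF H h(1)] by simp
qed

section \<open>Monoid algebras and their quotients\<close>

text \<open>The linear extension of \<open>\<kappa>\<close> to finitely supported functions, regarded as formal combinations of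
  points.\<close>

definition lin :: "('m \<Rightarrow> complex) \<Rightarrow> ('m \<Rightarrow> complex) \<Rightarrow> complex" where
  "lin \<kappa> f = (\<Sum>x | f x \<noteq> 0. f x * \<kappa> x)"

lemma lin_superset: "finite A \<Longrightarrow> {x. f x \<noteq> 0} \<subseteq> A \<Longrightarrow> lin \<kappa> f = (\<Sum>x\<in>A. f x * \<kappa> x)"
  unfolding lin_def by (rule sum.mono_neutral_left) auto

lemma lin_add:
  assumes "finite {x. f x \<noteq> 0}" "finite {x. g x \<noteq> 0}"
  shows "lin \<kappa> (\<lambda>x. f x + g x) = lin \<kappa> f + lin \<kappa> g"
proof -
  let ?A = "{x. f x \<noteq> 0} \<union> {x. g x \<noteq> 0}"
  have A: "finite ?A" using assms by simp
  have "lin \<kappa> (\<lambda>x. f x + g x) = (\<Sum>x\<in>?A. (f x + g x) * \<kappa> x)" by (rule lin_superset[OF A]) auto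
  moreover have "lin \<kappa> f = (\<Sum>x\<in>?A. f x * \<kappa> x)" by (rule lin_superset[OF A]) auto
  moreover have "lin \<kappa> g = (\<Sum>x\<in>?A. g x * \<kappa> x)" by (rule lin_superset[OF A]) auto
  ultimately show ?thesis by (simp add: sum.distrib algebra_simps)
qed

lemma lin_scale: "lin \<kappa> (\<lambda>x. c * f x) = c * lin \<kappa> f"
  by (cases "c = 0") (simp_all add: lin_def sum_distrib_left mult_ac)

lemma lin_uminus: "lin \<kappa> (\<lambda>x. - f x) = - lin \<kappa> f"
  using lin_scale[of \<kappa> "-1" f] by simp

lemma lin_diff:
  assumes "finite {x. f x \<noteq> 0}" "finite {x. g x \<noteq> 0}"
  shows "lin \<kappa> (f - g) = lin \<kappa> f - lin \<kappa> g"
  using lin_add[of f "\<lambda>x. - g x" \<kappa>] assms by (simp add: lin_uminus fun_diff_def)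

lemma lin_0 [simp]: "lin \<kappa> (\<lambda>x. 0) = 0"
  by (simp add: lin_def)

lemma single_supp: "{x. single m c x \<noteq> 0} \<subseteq> {m}" "finite {x. single m c x \<noteq> 0}"
  by (auto simp: single_def)

lemma lin_single [simp]: "lin \<kappa> (single m c) = c * \<kappa> m"
proof -
  have "lin \<kappa> (single m c) = (\<Sum>x\<in>{m}. single m c x * \<kappa> x)"
    by (rule lin_superset) (auto simp: single_def)
  thus ?thesis by (simp add: single_def)
qed

lemma lin_cong: "(\<And>x. f x \<noteq> 0 \<Longrightarrow> \<kappa> x = \<kappa>' x) \<Longrightarrow> lin \<kappa> f = lin \<kappa>' f"
  by (simp add: lin_def)

lemma lin_swap: "lin (\<lambda>x. lin (\<lambda>y. \<beta> x y) g) f = lin (\<lambda>y. lin (\<lambda>x. \<beta> x y) f) g"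
  unfolding lin_def sum_distrib_left by (subst sum.swap) (simp add: mult_ac)

lemma lin_mult_left: "lin (\<lambda>x. c * \<kappa> x) f = c * lin \<kappa> f"
  by (simp add: lin_def sum_distrib_left mult_ac)

lemma lin_sum_left: "lin (\<lambda>x. \<Sum>i\<in>I. \<kappa> i x) f = (\<Sum>i\<in>I. lin (\<kappa> i) f)"
  unfolding lin_def sum_distrib_left by (rule sum.swap)

text \<open>The carrier is a parameter, so that subalgebras of the algebra of all functions are covered; it has to be
  closed under the operations for this to be an algebra.\<close>

definition function_algebra :: "'x set \<Rightarrow> ('x \<Rightarrow> complex) set \<Rightarrow> (complex, 'x \<Rightarrow> complex) module" where
  "function_algebra P E =
     \<lparr>carrier = E, mult = (\<lambda>f g. \<lambda>p\<in>P. f p * g p), one = (\<lambda>p\<in>P. 1), ring.zero = (\<lambda>p\<in>P. 0),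
      add = (\<lambda>f g. \<lambda>p\<in>P. f p + g p), smult = (\<lambda>c f. \<lambda>p\<in>P. c * f p)\<rparr>"

lemma function_algebra_simps [simp]:
  "carrier (function_algebra P E) = E"
  "f \<otimes>\<^bsub>function_algebra P E\<^esub> g = (\<lambda>p\<in>P. f p * g p)"
  "f \<oplus>\<^bsub>function_algebra P E\<^esub> g = (\<lambda>p\<in>P. f p + g p)"
  "\<one>\<^bsub>function_algebra P E\<^esub> = (\<lambda>p\<in>P. 1)"
  "c \<odot>\<^bsub>function_algebra P E\<^esub> f = (\<lambda>p\<in>P. c * f p)"
  by (simp_all add: function_algebra_def)

text \<open>The choice of a representative is the one that is made for forms on a quotient, so that a form and its expression
  by values refer to the same element.\<close>

definition quotient_eval :: "'x set \<Rightarrow> ('x \<Rightarrow> 'm \<Rightarrow> complex) \<Rightarrow> ('m \<Rightarrow> complex) set \<Rightarrow> 'x \<Rightarrow> complex" where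
  "quotient_eval P \<kappa> Y = (\<lambda>p\<in>P. lin (\<kappa> p) (SOME f. f \<in> Y))"

locale monoid_alg = M: comm_monoid M for M :: "('m, 'z) monoid_scheme" (structure) +
  fixes k :: "complex set"
  assumes k: "subfield k CC"
begin

abbreviation "R \<equiv> monoid_algebra k M"

lemma carrier_iff: "f \<in> carrier R \<longleftrightarrow> (\<forall>x. f x \<in> k) \<and> finite {x. f x \<noteq> 0} \<and> (\<forall>x. f x \<noteq> 0 \<longrightarrow> x \<in> carrier M)"
  by (auto simp: monoid_algebra_def)

lemma carrierD:
  assumes "f \<in> carrier R"
  shows "f x \<in> k" "finite {x. f x \<noteq> 0}" "f x \<noteq> 0 \<Longrightarrow> x \<in> carrier M"
  using assms by (auto simp: carrier_iff)

lemma R_add [simp]: "f \<oplus>\<^bsub>R\<^esub> g = (\<lambda>x. f x + g x)"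
  and R_zero [simp]: "\<zero>\<^bsub>R\<^esub> = (\<lambda>x. 0)"
  and R_one [simp]: "\<one>\<^bsub>R\<^esub> = single \<one> 1"
  by (simp_all add: monoid_algebra_def)

lemma single_carrier: "m \<in> carrier M \<Longrightarrow> c \<in> k \<Longrightarrow> single m c \<in> carrier R"
  using subfield_0[OF k] by (auto simp: carrier_iff single_def)

lemma add_carrier: "f \<in> carrier R \<Longrightarrow> g \<in> carrier R \<Longrightarrow> (\<lambda>x. f x + g x) \<in> carrier R"
  unfolding carrier_iff
proof (elim conjE, intro conjI allI impI)
  assume "finite {x. f x \<noteq> 0}" "finite {x. g x \<noteq> 0}"
  thus "finite {x. f x + g x \<noteq> 0}"
    by (rule finite_subset[rotated, OF finite_UnI]) auto
  fix x assume "\<forall>x. f x \<noteq> 0 \<longrightarrow> x \<in> carrier M" "\<forall>x. g x \<noteq> 0 \<longrightarrow> x \<in> carrier M" "f x + g x \<noteq> 0"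
  thus "x \<in> carrier M" by (cases "f x = 0") auto
qed (use subfield_add[OF k] in auto)

lemma uminus_carrier: "f \<in> carrier R \<Longrightarrow> (\<lambda>x. - f x) \<in> carrier R"
  unfolding carrier_iff using subfield_uminus[OF k] by auto

lemma diff_carrier: "f \<in> carrier R \<Longrightarrow> g \<in> carrier R \<Longrightarrow> f - g \<in> carrier R"
  using add_carrier[OF _ uminus_carrier, of f g] by (simp add: fun_diff_def)

text \<open>A value of the convolution is a linear extension in each argument. In this form associativity and
  commutativity reduce to the rules for \<open>lin\<close> and the laws of the monoid.\<close>

lemma R_mult: "(f \<otimes>\<^bsub>R\<^esub> g) z = lin (\<lambda>x. lin (\<lambda>y. if x \<otimes> y = z then 1 else 0) g) f"
  if "f \<in> carrier R" "g \<in> carrier R"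
proof -
  let ?A = "{x. f x \<noteq> 0}" and ?B = "{y. g y \<noteq> 0}"
  have fin: "finite ?A" "finite ?B" using that by (auto simp: carrierD)
  have "(f \<otimes>\<^bsub>R\<^esub> g) z = (\<Sum>(x, y) | f x \<noteq> 0 \<and> g y \<noteq> 0 \<and> x \<otimes> y = z. f x * g y)"
    by (simp add: monoid_algebra_def)
  also have "{(x, y). f x \<noteq> 0 \<and> g y \<noteq> 0 \<and> x \<otimes> y = z} = {p \<in> ?A \<times> ?B. fst p \<otimes> snd p = z}" by auto
  also have "(\<Sum>(x, y)\<in>\<dots>. f x * g y) = (\<Sum>p\<in>?A \<times> ?B. if fst p \<otimes> snd p = z then (\<lambda>(x, y). f x * g y) p else 0)"
    by (rule sum.inter_filter) (rule finite_cartesian_product[OF fin])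
  also have "\<dots> = (\<Sum>(x, y)\<in>?A \<times> ?B. if x \<otimes> y = z then f x * g y else 0)"
    by (rule sum.cong) (simp_all add: case_prod_beta)
  also have "\<dots> = (\<Sum>x\<in>?A. \<Sum>y\<in>?B. if x \<otimes> y = z then f x * g y else 0)"
    by (rule sum.cartesian_product[symmetric])
  also have "\<dots> = lin (\<lambda>x. lin (\<lambda>y. if x \<otimes> y = z then 1 else 0) g) f"
    unfolding lin_def sum_distrib_left by (intro sum.cong) auto
  finally show ?thesis .
qed

lemma mult_supp:
  assumes "f \<in> carrier R" "g \<in> carrier R"
  shows "{z. (f \<otimes>\<^bsub>R\<^esub> g) z \<noteq> 0} \<subseteq> (\<lambda>(x, y). x \<otimes> y) ` ({x. f x \<noteq> 0} \<times> {y. g y \<noteq> 0})"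
proof (rule subsetI, rule ccontr)
  fix z assume z: "z \<in> {z. (f \<otimes>\<^bsub>R\<^esub> g) z \<noteq> 0}"
    "z \<notin> (\<lambda>(x, y). x \<otimes> y) ` ({x. f x \<noteq> 0} \<times> {y. g y \<noteq> 0})"
  have "(f \<otimes>\<^bsub>R\<^esub> g) z = 0"
    unfolding R_mult[OF assms] lin_def using z(2) by (intro sum.neutral ballI) (auto intro!: sum.neutral)
  thus False using z(1) by simp
qed

lemma mult_carrier:
  assumes f: "f \<in> carrier R" and g: "g \<in> carrier R"
  shows "f \<otimes>\<^bsub>R\<^esub> g \<in> carrier R"
  unfolding carrier_iff
proof (intro conjI allI impI)
  note fin = carrierD(2)[OF f] carrierD(2)[OF g]
  fix z
  show "(f \<otimes>\<^bsub>R\<^esub> g) z \<in> k"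
    unfolding R_mult[OF f g] lin_def
    by (intro subfield_sum[OF k] subfield_mult[OF k])
      (auto simp: carrierD(1)[OF f] carrierD(1)[OF g] subfield_0[OF k] subfield_1[OF k])
  show "finite {z. (f \<otimes>\<^bsub>R\<^esub> g) z \<noteq> 0}" by (rule finite_subset[OF mult_supp[OF f g]]) (use fin in simp)
  show "z \<in> carrier M" if "(f \<otimes>\<^bsub>R\<^esub> g) z \<noteq> 0"
    using mult_supp[OF f g] that carrierD(3)[OF f] carrierD(3)[OF g] by force
qed

text \<open>Every associativity or multiplicativity statement about the convolution follows from this
  formula for the linear extension of a function on the monoid.\<close>

lemma lin_mult:
  assumes f: "f \<in> carrier R" and g: "g \<in> carrier R"
  shows "lin \<kappa> (f \<otimes>\<^bsub>R\<^esub> g) = lin (\<lambda>x. lin (\<lambda>y. \<kappa> (x \<otimes> y)) g) f"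
proof -
  let ?A = "{x. f x \<noteq> 0}" and ?B = "{y. g y \<noteq> 0}"
  define C where "C = (\<lambda>(x, y). x \<otimes> y) ` (?A \<times> ?B)"
  have fin: "finite ?A" "finite ?B" "finite C" using f g by (auto simp: carrierD C_def)
  have "lin \<kappa> (f \<otimes>\<^bsub>R\<^esub> g) = (\<Sum>z\<in>C. (f \<otimes>\<^bsub>R\<^esub> g) z * \<kappa> z)"
    using mult_supp[OF f g] by (intro lin_superset fin) (simp add: C_def)
  also have "\<dots> = (\<Sum>z\<in>C. \<Sum>x\<in>?A. \<Sum>y\<in>?B. if x \<otimes> y = z then f x * (g y * \<kappa> z) else 0)"
    unfolding R_mult[OF f g] lin_def sum_distrib_left sum_distrib_right by (intro sum.cong) auto
  also have "\<dots> = (\<Sum>x\<in>?A. \<Sum>z\<in>C. \<Sum>y\<in>?B. if x \<otimes> y = z then f x * (g y * \<kappa> z) else 0)"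
    by (rule sum.swap)
  also have "\<dots> = (\<Sum>x\<in>?A. \<Sum>y\<in>?B. \<Sum>z\<in>C. if x \<otimes> y = z then f x * (g y * \<kappa> z) else 0)"
    by (rule sum.cong[OF refl]) (rule sum.swap)
  also have "\<dots> = (\<Sum>x\<in>?A. \<Sum>y\<in>?B. f x * (g y * \<kappa> (x \<otimes> y)))"
    using fin by (intro sum.cong refl) (auto simp: C_def)
  finally show ?thesis unfolding lin_def sum_distrib_left .
qed

lemma lin_mult_character:
  assumes f: "f \<in> carrier R" and g: "g \<in> carrier R"
    and \<kappa>: "\<And>x y. x \<in> carrier M \<Longrightarrow> y \<in> carrier M \<Longrightarrow> \<kappa> (x \<otimes> y) = \<kappa> x * \<kappa> y"
  shows "lin \<kappa> (f \<otimes>\<^bsub>R\<^esub> g) = lin \<kappa> f * lin \<kappa> g"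
proof -
  have "lin \<kappa> (f \<otimes>\<^bsub>R\<^esub> g) = lin (\<lambda>x. lin (\<lambda>y. \<kappa> x * \<kappa> y) g) f"
    unfolding lin_mult[OF f g] using carrierD(3)[OF f] carrierD(3)[OF g] \<kappa>
    by (intro lin_cong) auto
  also have "\<dots> = lin (\<lambda>x. lin \<kappa> g * \<kappa> x) f" by (simp add: lin_mult_left mult.commute)
  also have "\<dots> = lin \<kappa> f * lin \<kappa> g" unfolding lin_mult_left by (rule mult.commute)
  finally show ?thesis .
qed

lemma fun_eq_lin: "f z = lin (\<lambda>x. if x = z then 1 else 0) f" if "f \<in> carrier R"
proof -
  have "lin (\<lambda>x. if x = z then 1 else 0) f = (\<Sum>x\<in>insert z {x. f x \<noteq> 0}. f x * (if x = z then 1 else 0))"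
    using that by (intro lin_superset) (auto simp: carrierD)
  also have "\<dots> = (\<Sum>x\<in>insert z {x. f x \<noteq> 0}. if x = z then f x else 0)" by (rule sum.cong) auto
  also have "\<dots> = f z" using carrierD(2)[OF that] by simp
  finally show ?thesis by simp
qed

lemma single_mult:
  assumes "f \<in> carrier R" "c \<in> k"
  shows "single \<one> c \<otimes>\<^bsub>R\<^esub> f = (\<lambda>x. c * f x)"
proof
  fix z
  have "(single \<one> c \<otimes>\<^bsub>R\<^esub> f) z = c * lin (\<lambda>y. if \<one> \<otimes> y = z then 1 else 0) f"
    by (simp add: R_mult[OF single_carrier[OF M.one_closed assms(2)] assms(1)])
  also have "lin (\<lambda>y. if \<one> \<otimes> y = z then 1 else 0) f = lin (\<lambda>y. if y = z then 1 else 0) f"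
    using carrierD(3)[OF assms(1)] by (intro lin_cong) auto
  finally show "(single \<one> c \<otimes>\<^bsub>R\<^esub> f) z = c * f z" by (simp add: fun_eq_lin[OF assms(1), symmetric])
qed

lemma cring_R: "cring R"
proof (rule cringI)
  show "abelian_group R"
  proof (rule abelian_groupI)
    fix f assume "f \<in> carrier R"
    thus "\<exists>y\<in>carrier R. y \<oplus>\<^bsub>R\<^esub> f = \<zero>\<^bsub>R\<^esub>"
      by (intro bexI[of _ "\<lambda>x. - f x"]) (auto simp: uminus_carrier)
  qed (auto simp: add_carrier add_ac, simp add: carrier_iff subfield_0[OF k])
  have comm: "f \<otimes>\<^bsub>R\<^esub> g = g \<otimes>\<^bsub>R\<^esub> f" if f: "f \<in> carrier R" and g: "g \<in> carrier R" for f g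
  proof
    fix z
    have "(f \<otimes>\<^bsub>R\<^esub> g) z = lin (\<lambda>x. lin (\<lambda>y. if y \<otimes> x = z then 1 else 0) g) f"
      unfolding R_mult[OF f g] using carrierD(3)[OF f] carrierD(3)[OF g]
      by (intro lin_cong) (simp add: M.m_comm)
    also have "\<dots> = (g \<otimes>\<^bsub>R\<^esub> f) z" unfolding R_mult[OF g f] by (rule lin_swap)
    finally show "(f \<otimes>\<^bsub>R\<^esub> g) z = (g \<otimes>\<^bsub>R\<^esub> f) z" .
  qed
  show "comm_monoid R"
  proof (rule comm_monoidI)
    fix f g h assume f: "f \<in> carrier R" and g: "g \<in> carrier R" and h: "h \<in> carrier R"
    show "(f \<otimes>\<^bsub>R\<^esub> g) \<otimes>\<^bsub>R\<^esub> h = f \<otimes>\<^bsub>R\<^esub> (g \<otimes>\<^bsub>R\<^esub> h)"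
    proof
      fix z
      have "((f \<otimes>\<^bsub>R\<^esub> g) \<otimes>\<^bsub>R\<^esub> h) z =
          lin (\<lambda>x. lin (\<lambda>y. lin (\<lambda>w. if (x \<otimes> y) \<otimes> w = z then 1 else 0) h) g) f"
        unfolding R_mult[OF mult_carrier[OF f g] h] lin_mult[OF f g] ..
      also have "\<dots> = lin (\<lambda>x. lin (\<lambda>y. lin (\<lambda>w. if x \<otimes> (y \<otimes> w) = z then 1 else 0) h) g) f"
        using carrierD(3)[OF f] carrierD(3)[OF g] carrierD(3)[OF h]
        by (intro lin_cong) (simp add: M.m_assoc)
      also have "\<dots> = (f \<otimes>\<^bsub>R\<^esub> (g \<otimes>\<^bsub>R\<^esub> h)) z"
        unfolding R_mult[OF f mult_carrier[OF g h]] lin_mult[OF g h] ..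
      finally show "((f \<otimes>\<^bsub>R\<^esub> g) \<otimes>\<^bsub>R\<^esub> h) z = (f \<otimes>\<^bsub>R\<^esub> (g \<otimes>\<^bsub>R\<^esub> h)) z" .
    qed
  qed (use single_mult[OF _ subfield_1[OF k]] in
      \<open>simp_all add: mult_carrier comm single_carrier subfield_1[OF k]\<close>)
  fix f g h assume f: "f \<in> carrier R" and g: "g \<in> carrier R" and h: "h \<in> carrier R"
  have fg: "(\<lambda>x. f x + g x) \<in> carrier R" using f g by (rule add_carrier)
  show "(f \<oplus>\<^bsub>R\<^esub> g) \<otimes>\<^bsub>R\<^esub> h = f \<otimes>\<^bsub>R\<^esub> h \<oplus>\<^bsub>R\<^esub> g \<otimes>\<^bsub>R\<^esub> h"
    by (simp add: fun_eq_iff R_mult[OF fg h] R_mult[OF f h] R_mult[OF g h]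
        lin_add[OF carrierD(2)[OF f] carrierD(2)[OF g]])
qed

sublocale R: cring R by (rule cring_R)

lemma R_minus: "f \<in> carrier R \<Longrightarrow> \<ominus>\<^bsub>R\<^esub> f = (\<lambda>x. - f x)"
  by (rule sym, rule R.sum_zero_eq_neg) (auto simp: uminus_carrier)

lemma R_diff: "f \<in> carrier R \<Longrightarrow> g \<in> carrier R \<Longrightarrow> f \<ominus>\<^bsub>R\<^esub> g = f - g"
  by (simp add: a_minus_def R_minus fun_diff_def)

context
  fixes J assumes J: "ideal J R"
begin

lemma ideal_add: "f \<in> J \<Longrightarrow> g \<in> J \<Longrightarrow> (\<lambda>x. f x + g x) \<in> J"
  using additive_subgroup.a_closed[OF ideal.axioms(1)[OF J], of f g] by simp

lemma ideal_scale: "f \<in> J \<Longrightarrow> c \<in> k \<Longrightarrow> (\<lambda>x. c * f x) \<in> J"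
  using ideal.I_l_closed[OF J, of f "single \<one> c"] additive_subgroup.a_Hcarr[OF ideal.axioms(1)[OF J], of f]
  by (simp add: single_mult single_carrier)

lemma ideal_diff: "f \<in> J \<Longrightarrow> g \<in> J \<Longrightarrow> f - g \<in> J"
  using ideal_add[of f "\<lambda>x. -1 * g x"] ideal_scale[of g "-1"] subfield_uminus[OF k subfield_1[OF k]]
  by (simp add: fun_diff_def)

lemma ideal_0: "(\<lambda>x. 0) \<in> J"
  using additive_subgroup.zero_closed[OF ideal.axioms(1)[OF J]] by simp

lemma ideal_sum: "(\<And>i. i \<in> I \<Longrightarrow> f i \<in> J) \<Longrightarrow> (\<lambda>x. \<Sum>i\<in>I. f i x) \<in> J"
  by (induction I rule: infinite_finite_induct) (auto simp: ideal_0 ideal_add)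

end

end

lemma (in monoid_alg) lin_carrier_add:
  "f \<in> carrier R \<Longrightarrow> g \<in> carrier R \<Longrightarrow> lin \<psi> (\<lambda>x. f x + g x) = lin \<psi> f + lin \<psi> g"
  by (intro lin_add) (auto simp: carrierD)

lemma (in monoid_alg) zero_carrier: "(\<lambda>x. 0) \<in> carrier R"
  using R.zero_closed by simp

lemma (in monoid_alg) sum_carrier:
  "(\<And>i. i \<in> I \<Longrightarrow> f i \<in> carrier R) \<Longrightarrow> (\<lambda>x. \<Sum>i\<in>I. f i x) \<in> carrier R"
  by (induction I rule: infinite_finite_induct) (auto simp: zero_carrier add_carrier)

lemma (in monoid_alg) lin_carrier_sum:
  "(\<And>i. i \<in> I \<Longrightarrow> f i \<in> carrier R) \<Longrightarrow> lin \<psi> (\<lambda>x. \<Sum>i\<in>I. f i x) = (\<Sum>i\<in>I. lin \<psi> (f i))"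
  by (induction I rule: infinite_finite_induct) (auto simp: lin_carrier_add sum_carrier)

lemma (in monoid_alg) carrier_induct [consumes 1, case_names single add]:
  assumes f: "f \<in> carrier R" and single: "\<And>m c. m \<in> carrier M \<Longrightarrow> c \<in> k \<Longrightarrow> D (single m c)"
    and add: "\<And>f g. f \<in> carrier R \<Longrightarrow> D f \<Longrightarrow> g \<in> carrier R \<Longrightarrow> D g \<Longrightarrow> D (\<lambda>x. f x + g x)"
  shows "D f"
proof -
  have s: "single m (f m) \<in> carrier R" if "m \<in> {x. f x \<noteq> 0}" for m
    using that carrierD[OF f] by (intro single_carrier) auto
  have "D (\<lambda>x. \<Sum>m\<in>T. single m (f m) x)" if "finite T" "T \<subseteq> {x. f x \<noteq> 0}" for T
    using that
  proof (induction T rule: finite_induct)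
    case empty
    have "single \<one> 0 = (\<lambda>x. 0)" by (simp add: single_def fun_eq_iff)
    thus ?case using single[OF M.one_closed subfield_0[OF k]] by simp
  next
    case (insert m T)
    have "D (\<lambda>x. single m (f m) x + (\<Sum>m\<in>T. single m (f m) x))"
    proof (rule add)
      show "D (single m (f m))" using insert.prems carrierD[OF f] by (intro single) auto
      show "single m (f m) \<in> carrier R" using insert.prems by (intro s) auto
      show "(\<lambda>x. \<Sum>m\<in>T. single m (f m) x) \<in> carrier R" using insert.prems by (intro sum_carrier s) auto
      show "D (\<lambda>x. \<Sum>m\<in>T. single m (f m) x)" using insert by simp
    qed
    thus ?case using insert.hyps by simp
  qed
  from this[OF carrierD(2)[OF f] subset_refl] have "D (\<lambda>x. \<Sum>m | f m \<noteq> 0. single m (f m) x)" .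
  also have "(\<lambda>x. \<Sum>m | f m \<noteq> 0. single m (f m) x) = f"
  proof
    fix x
    have "(\<Sum>m | f m \<noteq> 0. single m (f m) x) = (\<Sum>m | f m \<noteq> 0. if m = x then f x else 0)"
      by (intro sum.cong) (auto simp: single_def)
    also have "\<dots> = f x" using carrierD(2)[OF f] by simp
    finally show "(\<Sum>m | f m \<noteq> 0. single m (f m) x) = f x" .
  qed
  finally show ?thesis .
qed

lemma (in monoid_alg) kernel_ideal:
  assumes \<kappa>_mult: "\<And>p x y. p \<in> P \<Longrightarrow> x \<in> carrier M \<Longrightarrow> y \<in> carrier M \<Longrightarrow> \<kappa> p (x \<otimes> y) = \<kappa> p x * \<kappa> p y"
  shows "ideal {f \<in> carrier R. \<forall>p\<in>P. lin (\<kappa> p) f = 0} R" (is "ideal ?N R")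
proof (rule idealI[OF R.ring_axioms])
  show "subgroup ?N (add_monoid R)"
  proof (rule R.add.subgroupI)
    have "\<zero>\<^bsub>R\<^esub> \<in> ?N" using R.zero_closed by simp
    thus "?N \<noteq> {}" by blast
    fix f assume "f \<in> ?N"
    thus "\<ominus>\<^bsub>R\<^esub> f \<in> ?N" by (auto simp: R_minus uminus_carrier lin_uminus)
  qed (auto simp: add_carrier lin_carrier_add)
qed (auto simp: mult_carrier lin_mult_character \<kappa>_mult)

lemma (in monoid_alg) lin_genideal:
  assumes "\<And>p x y. p \<in> P \<Longrightarrow> x \<in> carrier M \<Longrightarrow> y \<in> carrier M \<Longrightarrow> \<kappa> p (x \<otimes> y) = \<kappa> p x * \<kappa> p y"
    and "S \<subseteq> carrier R" and "\<And>s p. s \<in> S \<Longrightarrow> p \<in> P \<Longrightarrow> lin (\<kappa> p) s = 0"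
    and "f \<in> Idl\<^bsub>R\<^esub> S" "p \<in> P"
  shows "lin (\<kappa> p) f = 0"
proof -
  have "Idl\<^bsub>R\<^esub> S \<subseteq> {f \<in> carrier R. \<forall>p\<in>P. lin (\<kappa> p) f = 0}"
    by (rule R.genideal_minimal[OF kernel_ideal[OF assms(1)]]) (use assms(2,3) in auto)
  thus ?thesis using assms(4,5) by blast
qed

text \<open>The first isomorphism theorem for the simultaneous evaluation at a family of characters. That the kernel
  is not larger than the ideal generated by the relations is expressed by all ideals containing the relations,
  because it is verified by calculations with congruences modulo such an ideal.\<close>

theorem (in monoid_alg) quotient_eval_iso:
  assumes \<kappa>_mult: "\<And>p x y. p \<in> P \<Longrightarrow> x \<in> carrier M \<Longrightarrow> y \<in> carrier M \<Longrightarrow> \<kappa> p (x \<otimes> y) = \<kappa> p x * \<kappa> p y"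
    and \<kappa>_one: "\<And>p. p \<in> P \<Longrightarrow> \<kappa> p \<one> = 1"
    and S: "S \<subseteq> carrier R" and S0: "\<And>s p. s \<in> S \<Longrightarrow> p \<in> P \<Longrightarrow> lin (\<kappa> p) s = 0"
    and ker: "\<And>f J. f \<in> carrier R \<Longrightarrow> ideal J R \<Longrightarrow> S \<subseteq> J \<Longrightarrow> (\<And>p. p \<in> P \<Longrightarrow> lin (\<kappa> p) f = 0) \<Longrightarrow> f \<in> J"
    and u: "\<And>c. c \<in> F \<Longrightarrow> u c \<in> carrier R" "\<And>c p. c \<in> F \<Longrightarrow> p \<in> P \<Longrightarrow> lin (\<kappa> p) (u c) = c"
  shows "quotient_eval P \<kappa> \<in> algebra_iso F (quotient_algebra R S u)
           (function_algebra P ((\<lambda>f. \<lambda>p\<in>P. lin (\<kappa> p) f) ` carrier R))"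
    and "Y \<in> carrier (quotient_algebra R S u) \<Longrightarrow> (SOME f. f \<in> Y) \<in> carrier R"
proof -
  define J where "J = Idl\<^bsub>R\<^esub> S"
  define ev where "ev f = (\<lambda>p\<in>P. lin (\<kappa> p) f)" for f
  have J: "ideal J R" unfolding J_def by (rule R.genideal_ideal[OF S])
  interpret J: ideal J R by (rule J)
  define N where "N = {f \<in> carrier R. \<forall>p\<in>P. lin (\<kappa> p) f = 0}"
  have N: "ideal N R" unfolding N_def by (rule kernel_ideal) (rule \<kappa>_mult)
  have J_eq: "J = N"
  proof
    show "J \<subseteq> N" unfolding J_def
      by (rule R.genideal_minimal[OF N]) (use S S0 in \<open>auto simp: N_def\<close>)
    show "N \<subseteq> J"
      using ker[OF _ J] R.genideal_self[OF S] by (auto simp: N_def J_def)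
  qed
  let ?Q = "quotient_algebra R S u"
  have Q: "carrier ?Q = a_rcosets\<^bsub>R\<^esub> J" "\<one>\<^bsub>?Q\<^esub> = J +>\<^bsub>R\<^esub> \<one>\<^bsub>R\<^esub>"
    "\<And>Y Z. Y \<otimes>\<^bsub>?Q\<^esub> Z = rcoset_mult R J Y Z" "\<And>Y Z. Y \<oplus>\<^bsub>?Q\<^esub> Z = Y <+>\<^bsub>R\<^esub> Z"
    "\<And>c Y. c \<odot>\<^bsub>?Q\<^esub> Y = rcoset_mult R J (J +>\<^bsub>R\<^esub> u c) Y"
    by (simp_all add: quotient_algebra_def Let_def FactRing_def J_def)
  have Q_cases: "\<exists>f\<in>carrier R. Y = J +>\<^bsub>R\<^esub> f" if "Y \<in> carrier ?Q" for Y
    using that by (auto simp: Q A_RCOSETS_def' a_r_coset_def)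
  have some: "(SOME g. g \<in> J +>\<^bsub>R\<^esub> f) \<in> carrier R \<and> ev (SOME g. g \<in> J +>\<^bsub>R\<^esub> f) = ev f"
    if f: "f \<in> carrier R" for f
  proof -
    have "(SOME g. g \<in> J +>\<^bsub>R\<^esub> f) \<in> J +>\<^bsub>R\<^esub> f"
      by (rule someI[where P = "\<lambda>g. g \<in> J +>\<^bsub>R\<^esub> f"]) (rule J.a_rcos_self[OF f])
    moreover have "g \<in> carrier R \<and> ev g = ev f" if g: "g \<in> J +>\<^bsub>R\<^esub> f" for g
    proof -
      obtain j where j: "j \<in> J" "g = (\<lambda>x. j x + f x)"
        using g by (auto simp: a_r_coset_def')
      have jN: "j \<in> N" using j(1) unfolding J_eq .
      have jR: "j \<in> carrier R" using jN unfolding N_def by simp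
      have j0: "lin (\<kappa> p) j = 0" if "p \<in> P" for p using jN that unfolding N_def by simp
      have "ev g = ev f" unfolding ev_def j(2) using lin_carrier_add[OF jR f] j0 by (simp cong: restrict_cong)
      thus ?thesis using add_carrier[OF jR f] by (simp add: j(2))
    qed
    ultimately show ?thesis by blast
  qed
  have eval: "quotient_eval P \<kappa> (J +>\<^bsub>R\<^esub> f) = ev f" if "f \<in> carrier R" for f
    using some[OF that] by (simp add: quotient_eval_def ev_def)
  show "(SOME f. f \<in> Y) \<in> carrier R" if "Y \<in> carrier ?Q"
    using Q_cases[OF that] some by auto
  have mem: "J +>\<^bsub>R\<^esub> f \<in> carrier ?Q" if "f \<in> carrier R" for f
    using that by (simp add: Q R.a_rcosetsI[OF J.a_subset])
  have eqI: "J +>\<^bsub>R\<^esub> f = J +>\<^bsub>R\<^esub> g" if "f \<in> carrier R" "g \<in> carrier R" "ev f = ev g" for f g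
  proof -
    have "lin (\<kappa> p) f = lin (\<kappa> p) g" if "p \<in> P" for p
      using fun_cong[OF \<open>ev f = ev g\<close>, of p] that by (simp add: ev_def)
    hence "f - g \<in> N"
      unfolding N_def using diff_carrier[OF that(1,2)] lin_diff[OF carrierD(2)[OF that(1)] carrierD(2)[OF that(2)]]
      by simp
    hence "f - g \<in> J" unfolding J_eq .
    thus ?thesis using R.quotient_eq_iff_same_a_r_cos[OF J that(1,2)] unfolding R_diff[OF that(1,2)] by simp
  qed
  have img: "quotient_eval P \<kappa> ` carrier ?Q = ev ` carrier R"
  proof
    show "quotient_eval P \<kappa> ` carrier ?Q \<subseteq> ev ` carrier R"
      proof
      fix z assume "z \<in> quotient_eval P \<kappa> ` carrier ?Q"
      then obtain Y where Y: "Y \<in> carrier ?Q" "z = quotient_eval P \<kappa> Y" by (elim imageE)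
      obtain f where f: "f \<in> carrier R" "Y = J +>\<^bsub>R\<^esub> f" using Q_cases[OF Y(1)] by blast
      show "z \<in> ev ` carrier R" unfolding Y(2) f(2) eval[OF f(1)] using f(1) by (rule imageI)
    qed
    show "ev ` carrier R \<subseteq> quotient_eval P \<kappa> ` carrier ?Q"
      proof
      fix z assume "z \<in> ev ` carrier R"
      then obtain f where f: "f \<in> carrier R" "z = ev f" by (elim imageE)
      show "z \<in> quotient_eval P \<kappa> ` carrier ?Q"
        unfolding f(2) eval[OF f(1), symmetric] by (rule imageI) (rule mem[OF f(1)])
    qed
  qed
  have inj: "inj_on (quotient_eval P \<kappa>) (carrier ?Q)"
  proof (rule inj_onI)
    fix Y Z assume "Y \<in> carrier ?Q" "Z \<in> carrier ?Q" and eq: "quotient_eval P \<kappa> Y = quotient_eval P \<kappa> Z"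
    then obtain f g where f: "f \<in> carrier R" "Y = J +>\<^bsub>R\<^esub> f" and g: "g \<in> carrier R" "Z = J +>\<^bsub>R\<^esub> g"
      using Q_cases by blast
    show "Y = Z" using eqI[OF f(1) g(1)] eq by (simp add: f(2) g(2) eval f(1) g(1))
  qed
  show "quotient_eval P \<kappa> \<in> algebra_iso F ?Q (function_algebra P ((\<lambda>f. \<lambda>p\<in>P. lin (\<kappa> p) f) ` carrier R))"
    unfolding algebra_iso_def ring_iso_def mem_Collect_eq
  proof (intro conjI ballI ring_hom_memI)
    have img': "quotient_eval P \<kappa> ` carrier ?Q = (\<lambda>f. \<lambda>p\<in>P. lin (\<kappa> p) f) ` carrier R"
      unfolding img ev_def ..
    thus "bij_betw (quotient_eval P \<kappa>) (carrier ?Q)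
        (carrier (function_algebra P ((\<lambda>f. \<lambda>p\<in>P. lin (\<kappa> p) f) ` carrier R)))"
      using inj by (simp add: bij_betw_def)
    show "quotient_eval P \<kappa> \<one>\<^bsub>?Q\<^esub> = \<one>\<^bsub>function_algebra P ((\<lambda>f. \<lambda>p\<in>P. lin (\<kappa> p) f) ` carrier R)\<^esub>"
      unfolding Q eval[OF R.one_closed] by (auto simp: ev_def \<kappa>_one)
    fix Y assume Y: "Y \<in> carrier ?Q"
    show "quotient_eval P \<kappa> Y \<in> carrier (function_algebra P ((\<lambda>f. \<lambda>p\<in>P. lin (\<kappa> p) f) ` carrier R))"
      using img' Y by auto
    obtain f where f: "f \<in> carrier R" "Y = J +>\<^bsub>R\<^esub> f" using Q_cases[OF Y] by blast
    show "quotient_eval P \<kappa> (c \<odot>\<^bsub>?Q\<^esub> Y) = c \<odot>\<^bsub>function_algebra P ((\<lambda>f. \<lambda>p\<in>P. lin (\<kappa> p) f) ` carrier R)\<^esub> quotient_eval P \<kappa> Y"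
      if c: "c \<in> F" for c
      unfolding Q f(2) J.rcoset_mult_add[OF u(1)[OF c] f(1)] eval[OF f(1)] eval[OF mult_carrier[OF u(1)[OF c] f(1)]]
      using u(1)[OF c] f(1)
      by (auto simp: ev_def lin_mult_character \<kappa>_mult u(2)[OF c])
    fix Z assume "Z \<in> carrier ?Q"
    then obtain g where g: "g \<in> carrier R" "Z = J +>\<^bsub>R\<^esub> g" using Q_cases by blast
    show "quotient_eval P \<kappa> (Y \<otimes>\<^bsub>?Q\<^esub> Z) =
        quotient_eval P \<kappa> Y \<otimes>\<^bsub>function_algebra P ((\<lambda>f. \<lambda>p\<in>P. lin (\<kappa> p) f) ` carrier R)\<^esub> quotient_eval P \<kappa> Z"
      unfolding Q f(2) g(2) J.rcoset_mult_add[OF f(1) g(1)] eval[OF f(1)] eval[OF g(1)] eval[OF mult_carrier[OF f(1) g(1)]]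
      using f(1) g(1) by (auto simp: ev_def lin_mult_character \<kappa>_mult)
    show "quotient_eval P \<kappa> (Y \<oplus>\<^bsub>?Q\<^esub> Z) =
        quotient_eval P \<kappa> Y \<oplus>\<^bsub>function_algebra P ((\<lambda>f. \<lambda>p\<in>P. lin (\<kappa> p) f) ` carrier R)\<^esub> quotient_eval P \<kappa> Z"
      unfolding Q f(2) g(2) J.a_rcos_sum[OF f(1) g(1)] eval[OF f(1)] eval[OF g(1)] eval[OF R.add.m_closed[OF f(1) g(1)]]
      using f(1) g(1) by (auto simp: ev_def lin_carrier_add)
  qed
qed

lemma cnj_lin: "(\<And>x. f x \<in> \<real>) \<Longrightarrow> cnj (lin \<kappa> f) = lin (\<lambda>x. cnj (\<kappa> x)) f"
  by (simp add: lin_def Reals_cnj_iff)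

text \<open>A form whose values on generators are sums of products \<open>\<kappa>(x) \<cdot> cnj (\<kappa>(y))\<close> is a sum of squared absolute
  values. The coefficients have to be real, as conjugation is moved from the values of a character to the value
  at a combination.\<close>

lemma (in monoid_alg) induced_form_eq_sum:
  assumes k: "k \<subseteq> \<real>" and Y: "(SOME f. f \<in> Y) \<in> carrier R"
    and \<beta>: "\<And>x y. x \<in> carrier M \<Longrightarrow> y \<in> carrier M \<Longrightarrow> \<beta> x y = c * (\<Sum>p\<in>P. \<kappa> p x * cnj (\<kappa> p y))"
  shows "induced_form \<beta> Y = c * (\<Sum>p\<in>P. quotient_eval P \<kappa> Y p * cnj (quotient_eval P \<kappa> Y p))"
proof -
  define f where "f = (SOME f. f \<in> Y)"
  have f: "f \<in> carrier R" using Y by (simp add: f_def)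
  have real: "f x \<in> \<real>" for x using carrierD(1)[OF f] k by blast
  have "induced_form \<beta> Y = lin (\<lambda>x. lin (\<beta> x) f) f"
    unfolding induced_form_def Let_def f_def[symmetric] lin_def sum_distrib_left by (simp add: mult_ac)
  also have "\<dots> = lin (\<lambda>x. lin (\<lambda>y. c * (\<Sum>p\<in>P. \<kappa> p x * cnj (\<kappa> p y))) f) f"
    using carrierD(3)[OF f] \<beta> by (intro lin_cong) auto
  also have "\<dots> = lin (\<lambda>x. c * (\<Sum>p\<in>P. lin (\<lambda>y. cnj (\<kappa> p y)) f * \<kappa> p x)) f"
    by (simp add: lin_mult_left lin_sum_left mult.commute)
  also have "\<dots> = c * (\<Sum>p\<in>P. lin (\<lambda>y. cnj (\<kappa> p y)) f * lin (\<kappa> p) f)"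
    by (simp only: lin_mult_left lin_sum_left)
  also have "\<dots> = c * (\<Sum>p\<in>P. quotient_eval P \<kappa> Y p * cnj (quotient_eval P \<kappa> Y p))"
    by (simp add: quotient_eval_def f_def[symmetric] cnj_lin[OF real] mult.commute)
  finally show ?thesis .
qed

section \<open>Tensor products of imaginary quadratic extensions\<close>

lemma field_algebra_simps [simp]:
  "carrier (field_algebra L) = L" "x \<otimes>\<^bsub>field_algebra L\<^esub> y = x * y" "\<one>\<^bsub>field_algebra L\<^esub> = 1"
  "x \<oplus>\<^bsub>field_algebra L\<^esub> y = x + y" "c \<odot>\<^bsub>field_algebra L\<^esub> x = c * x" "\<zero>\<^bsub>field_algebra L\<^esub> = 0"
  by (simp_all add: field_algebra_def)

lemma prod_field_simps [simp]:
  "carrier (prod_algebra I (\<lambda>i. field_algebra (L i))) = (\<Pi>\<^sub>E i\<in>I. L i)"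
  "x \<otimes>\<^bsub>prod_algebra I (\<lambda>i. field_algebra (L i))\<^esub> y = (\<lambda>i\<in>I. x i * y i)"
  "\<one>\<^bsub>prod_algebra I (\<lambda>i. field_algebra (L i))\<^esub> = (\<lambda>i\<in>I. 1)"
  "x \<oplus>\<^bsub>prod_algebra I (\<lambda>i. field_algebra (L i))\<^esub> y = (\<lambda>i\<in>I. x i + y i)"
  "a \<odot>\<^bsub>prod_algebra I (\<lambda>i. field_algebra (L i))\<^esub> x = (\<lambda>i\<in>I. a * x i)"
  by (simp_all add: prod_algebra_def)

lemma prod_field_comm_monoid:
  assumes "\<And>i. i \<in> I \<Longrightarrow> subfield (L i) CC"
  shows "comm_monoid (prod_algebra I (\<lambda>i. field_algebra (L i)))"
proof (rule comm_monoidI)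
  fix x y z assume x: "x \<in> carrier (prod_algebra I (\<lambda>i. field_algebra (L i)))"
    and y: "y \<in> carrier (prod_algebra I (\<lambda>i. field_algebra (L i)))"
  show "x \<otimes>\<^bsub>prod_algebra I (\<lambda>i. field_algebra (L i))\<^esub> y \<in> carrier (prod_algebra I (\<lambda>i. field_algebra (L i)))"
    using x y assms by (auto simp: PiE_iff intro!: subfield_mult)
  show "\<one>\<^bsub>prod_algebra I (\<lambda>i. field_algebra (L i))\<^esub> \<otimes>\<^bsub>prod_algebra I (\<lambda>i. field_algebra (L i))\<^esub> x = x"
    using x by (auto simp: PiE_iff fun_eq_iff extensional_def)
qed (use assms in \<open>auto simp: subfield_1 fun_eq_iff\<close>)

lemma csqrt_neg:
  fixes F :: "complex set" and a :: complex
  assumes "F \<subseteq> \<real>" "a \<in> F" "0 < Re a"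
  shows "csqrt (- a) * csqrt (- a) = - a" "cnj (csqrt (- a)) = - csqrt (- a)" "csqrt (- a) \<noteq> 0"
proof -
  show sq: "csqrt (- a) * csqrt (- a) = - a" by (metis power2_csqrt power2_eq_square)
  show "csqrt (- a) \<noteq> 0" using sq assms(3) by auto
  have "- a = of_real (- Re a)" using assms by (auto simp: complex_is_Real_iff complex_eq_iff)
  hence "csqrt (- a) = \<i> * of_real (sqrt (Re a))"
    using assms(3) by (metis csqrt_of_real_nonpos Re_complex_of_real abs_minus_cancel abs_of_pos
        Im_complex_of_real neg_less_0_iff_less order_less_imp_le)
  thus "cnj (csqrt (- a)) = - csqrt (- a)" by simp
qed

lemma adjoin_csqrt:
  assumes F: "subfield F CC" "F \<subseteq> \<real>" and a: "a \<in> F" "0 < Re a"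
  defines "s \<equiv> csqrt (- a)"
  shows "adjoin F s = {u + v * s |u v. u \<in> F \<and> v \<in> F}" and "subfield (adjoin F s) CC"
proof -
  have s2: "s * s = - a" and cnj_s: "cnj s = - s" and "s \<noteq> 0"
    using csqrt_neg[OF F(2) a] by (simp_all add: s_def)
  have Fcnj: "cnj x = x" if "x \<in> F" for x using F(2) that by (auto simp: Reals_cnj_iff)
  note cl = subfield_0[OF F(1)] subfield_1[OF F(1)] subfield_add[OF F(1)] subfield_mult[OF F(1)]
    subfield_uminus[OF F(1)] subfield_inverse[OF F(1)] subfield_minus[OF F(1)]
  define E where "E = {u + v * s |u v. u \<in> F \<and> v \<in> F}"
  have EI: "u + v * s \<in> E" if "u \<in> F" "v \<in> F" for u v using that E_def by auto
  have E: "subfield E CC"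
  proof (rule subfield_CC_I)
    show "1 \<in> E" using EI[of 1 0] cl by simp
    fix x assume "x \<in> E"
    then obtain u v where x: "x = u + v * s" "u \<in> F" "v \<in> F" using E_def by auto
    have "- x = - u + (- v) * s" by (simp add: x)
    thus "- x \<in> E" using EI[of "- u" "- v"] x cl by simp
    { fix y assume "y \<in> E"
      then obtain u' v' where y: "y = u' + v' * s" "u' \<in> F" "v' \<in> F" using E_def by auto
      have eq: "x + y = (u + u') + (v + v') * s" by (simp add: x y algebra_simps)
      show "x + y \<in> E" unfolding eq using x y cl by (intro EI) auto
      have "x * y = u * u' + v * v' * (s * s) + (u * v' + v * u') * s"
        by (simp add: x y algebra_simps)
      also have "\<dots> = (u * u' - v * v' * a) + (u * v' + v * u') * s" by (simp add: s2)
      finally show "x * y \<in> E"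
        using EI[of "u * u' - v * v' * a" "u * v' + v * u'"] x y cl a by simp }
    assume x0: "x \<noteq> 0"
    have "x * cnj x = u * u - v * v * (s * s)" using x by (simp add: cnj_s Fcnj algebra_simps)
    hence n: "x * cnj x = u * u + a * (v * v)" by (simp add: s2)
    define m where "m = inverse (u * u + a * (v * v))"
    have m: "m \<in> F" unfolding m_def using x a cl by simp
    have "inverse x = cnj x * m" unfolding m_def n[symmetric] using x0 by simp
    also have "\<dots> = u * m + (- (v * m)) * s" using x by (simp add: cnj_s Fcnj algebra_simps)
    finally show "inverse x \<in> E" using EI[of "u * m" "- (v * m)"] x m cl by simp
  qed
  have "adjoin F s = E"
  proof
    have "x \<in> E" if "x \<in> generate_field CC (insert s F)" for x
      using that
    proof induction
      case one show ?case using subfield_1[OF E] by simp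
    next
      case (incl h) thus ?case using EI[of 0 1] EI[of h 0] cl by auto
    qed (auto simp: CC_inv subfield_uminus[OF E] subfield_inverse[OF E] subfield_add[OF E] subfield_mult[OF E])
    thus "adjoin F s \<subseteq> E" unfolding adjoin_def by auto
  next
    show "E \<subseteq> adjoin F s"
    proof
      fix x assume "x \<in> E"
      then obtain u v where x: "x = u + v * s" "u \<in> F" "v \<in> F" using E_def by auto
      have "u \<oplus>\<^bsub>CC\<^esub> v \<otimes>\<^bsub>CC\<^esub> s \<in> generate_field CC (insert s F)"
        using x by (intro generate_field.eng_add generate_field.eng_mult generate_field.incl) auto
      thus "x \<in> adjoin F s" using x by (simp add: adjoin_def)
    qed
  qed
  thus "adjoin F s = {u + v * s |u v. u \<in> F \<and> v \<in> F}" "subfield (adjoin F s) CC"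
    using E by (simp_all add: E_def)
qed

lemma sum_Pow_prod:
  fixes a b :: "'i \<Rightarrow> 'a::comm_semiring_1"
  assumes "finite I"
  shows "(\<Sum>A\<in>Pow I. \<Prod>i\<in>I. if i \<in> A then a i else b i) = (\<Prod>i\<in>I. a i + b i)"
proof -
  have "(\<Prod>i\<in>I. if i \<in> A then a i else b i) = (\<Prod>i\<in>A. a i) * (\<Prod>i\<in>I - A. b i)" if "A \<in> Pow I" for A
    using that assms by (subst prod.If_cases) (auto simp: Int_absorb1 Diff_eq)
  thus ?thesis unfolding prod_add[OF assms] by (intro sum.cong) auto
qed

text \<open>The set \<open>P\<close> indexes the simultaneous choices of signs of the square roots; the sign of the
  \<open>i\<close>-th root is changed if \<open>i \<in> s p\<close>.\<close>

locale multiquadratic =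
  fixes F :: "complex set" and I :: "'i set" and a :: "'i \<Rightarrow> complex" and P :: "'p set" and s :: "'p \<Rightarrow> 'i set"
  assumes F: "subfield F CC" "F \<subseteq> \<real>" and I: "finite I"
    and a: "\<And>i. i \<in> I \<Longrightarrow> a i \<in> F" "\<And>i. i \<in> I \<Longrightarrow> 0 < Re (a i)" and s: "bij_betw s P (Pow I)"
begin

definition r :: "'i \<Rightarrow> complex" where "r i = csqrt (- a i)"

definition L :: "'i \<Rightarrow> complex set" where "L i = adjoin F (r i)"

definition conj_at :: "'p \<Rightarrow> 'i \<Rightarrow> complex \<Rightarrow> complex" where
  "conj_at p i z = (if i \<in> s p then cnj z else z)"

text \<open>The homomorphism on pure tensors given by the sign change \<open>p\<close>.\<close>

definition \<kappa> :: "'p \<Rightarrow> ('i \<Rightarrow> complex) \<Rightarrow> complex" where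
  "\<kappa> p x = (\<Prod>i\<in>I. conj_at p i (x i))"

text \<open>The square root of \<open>-a\<^sub>i\<close> selected by \<open>p\<close>.\<close>

definition \<rho> :: "'p \<Rightarrow> 'i \<Rightarrow> complex" where "\<rho> p i = conj_at p i (r i)"

text \<open>The \<open>B\<close>-th element of the standard basis of the tensor product, as a function on \<open>P\<close>.\<close>

definition v :: "'i set \<Rightarrow> 'p \<Rightarrow> complex" where "v B p = (\<Prod>i\<in>B. \<rho> p i)"

definition E :: "('p \<Rightarrow> complex) set" where
  "E = {\<lambda>p\<in>P. \<Sum>B\<in>Pow I. x B * v B p |x. \<forall>B. x B \<in> F}"

abbreviation "M \<equiv> prod_algebra I (\<lambda>i. field_algebra (L i))"

definition m :: "'i set \<Rightarrow> 'i \<Rightarrow> complex" where "m B = (\<lambda>i\<in>I. if i \<in> B then r i else 1)"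

lemma r: "i \<in> I \<Longrightarrow> r i * r i = - a i" "i \<in> I \<Longrightarrow> cnj (r i) = - r i" "i \<in> I \<Longrightarrow> r i \<noteq> 0"
  using csqrt_neg[OF F(2) a] by (simp_all add: r_def)

lemma L: "i \<in> I \<Longrightarrow> L i = {u + w * r i |u w. u \<in> F \<and> w \<in> F}" "i \<in> I \<Longrightarrow> subfield (L i) CC"
  using adjoin_csqrt[OF F a] by (simp_all add: L_def r_def)

lemma finite_P: "finite P"
  using bij_betw_finite[OF s] I by simp

lemma F_cnj: "x \<in> F \<Longrightarrow> cnj x = x"
  using F(2) by (auto simp: Reals_cnj_iff)

lemma L_cases:
  assumes "i \<in> I" "z \<in> L i"
  obtains u w where "z = u + w * r i" "u \<in> F" "w \<in> F"
  using assms L(1) by blast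

lemma L_mem: "i \<in> I \<Longrightarrow> u \<in> F \<Longrightarrow> w \<in> F \<Longrightarrow> u + w * r i \<in> L i"
  using L(1) by blast

lemma F_sub_L: "i \<in> I \<Longrightarrow> u \<in> F \<Longrightarrow> u \<in> L i"
  using L_mem[of i u 0] subfield_0[OF F(1)] by simp

lemma r_in_L: "i \<in> I \<Longrightarrow> r i \<in> L i"
  using L_mem[of i 0 1] subfield_0[OF F(1)] subfield_1[OF F(1)] by simp

sublocale monoid_alg M F
  by (intro monoid_alg.intro monoid_alg_axioms.intro prod_field_comm_monoid L F)

lemma conj_at_simps:
  "conj_at p i (x + y) = conj_at p i x + conj_at p i y" "conj_at p i (x * y) = conj_at p i x * conj_at p i y"
  "u \<in> F \<Longrightarrow> conj_at p i u = u" "conj_at p i 1 = 1"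
  by (auto simp: conj_at_def F_cnj)

lemma rho: "i \<in> I \<Longrightarrow> \<rho> p i = (if i \<in> s p then - r i else r i)"
  by (simp add: \<rho>_def conj_at_def r)

lemma rho_sq: "i \<in> I \<Longrightarrow> \<rho> p i * \<rho> p i = - a i" "i \<in> I \<Longrightarrow> cnj (\<rho> p i) = - \<rho> p i" "i \<in> I \<Longrightarrow> \<rho> p i \<noteq> 0"
  by (auto simp: rho r)

lemma rho_separates:
  assumes "p \<in> P" "q \<in> P" "\<And>i. i \<in> I \<Longrightarrow> \<rho> p i = \<rho> q i"
  shows "p = q"
proof -
  have sub: "s p \<subseteq> I" "s q \<subseteq> I" using s assms(1,2) by (auto simp: bij_betw_def)
  have "i \<in> s p \<longleftrightarrow> i \<in> s q" if "i \<in> I" for i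
    using assms(3)[OF that] r(3)[OF that] that by (auto simp: rho split: if_splits)
  hence "s p = s q" using sub by blast
  thus ?thesis using s assms(1,2) by (auto simp: bij_betw_def inj_on_def)
qed

lemma rho_exists:
  assumes "\<And>i. i \<in> I \<Longrightarrow> t i * t i = - a i"
  obtains p where "p \<in> P" "\<And>i. i \<in> I \<Longrightarrow> \<rho> p i = t i"
proof -
  define A where "A = {i\<in>I. t i = - r i}"
  have "A \<in> s ` P" using s by (auto simp: bij_betw_def A_def)
  then obtain p where p: "p \<in> P" "s p = A" by blast
  have "\<rho> p i = t i" if "i \<in> I" for i
  proof -
    have "t i * t i = r i * r i" using assms[OF that] r(1)[OF that] by simp
    hence "t i = r i \<or> t i = - r i" by (simp add: square_eq_iff)
    thus ?thesis unfolding rho[OF \<open>i \<in> I\<close>] p(2) A_def using \<open>i \<in> I\<close> by (elim disjE) simp_all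
  qed
  thus thesis using that[of p] p(1) by simp
qed

lemma kappa_update:
  assumes "i \<in> I"
  shows "\<kappa> p (x(i := z)) = conj_at p i z * (\<Prod>j\<in>I - {i}. conj_at p j (x j))"
  unfolding \<kappa>_def prod.remove[OF I assms] by (auto intro!: arg_cong2[of _ _ _ _ "(*)"] prod.cong)

lemma m_carrier: "m B \<in> carrier M"
  using r_in_L F_sub_L[OF _ subfield_1[OF F(1)]] by (auto simp: m_def)

lemma kappa_m: "B \<subseteq> I \<Longrightarrow> \<kappa> p (m B) = v B p"
  unfolding \<kappa>_def v_def m_def
  using I by (intro prod.mono_neutral_cong_right) (auto simp: \<rho>_def conj_at_simps)

lemma update_carrier: "x \<in> carrier M \<Longrightarrow> i \<in> I \<Longrightarrow> z \<in> L i \<Longrightarrow> x(i := z) \<in> carrier M"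
  by (auto simp: PiE_iff extensional_def)

text \<open>Expanding the tensor factors one after the other in the basis \<open>1, \<surd>-a\<^sub>i\<close>, every element of
  the monoid algebra is congruent to a combination of the \<open>m B\<close>.\<close>

lemma spanning:
  assumes J: "ideal J R" "tensor_relations F I (\<lambda>i. field_algebra (L i)) \<subseteq> J" and f: "f \<in> carrier R"
  obtains x where "\<And>B. x B \<in> F" "f - (\<lambda>z. \<Sum>B\<in>Pow I. single (m B) (x B) z) \<in> J"
proof -
  define comb where "comb x = (\<lambda>z. \<Sum>B\<in>Pow I. single (m B) (x B) z)" for x
  define D where "D = {f. \<exists>x. (\<forall>B. x B \<in> F) \<and> f - comb x \<in> J}"
  have comb_add: "comb x z + comb y z = comb (\<lambda>B. x B + y B) z" for x y z
    unfolding comb_def sum.distrib[symmetric] by (intro sum.cong) (auto simp: single_def)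
  have comb_scale: "c * comb x z = comb (\<lambda>B. c * x B) z" for c x z
    unfolding comb_def sum_distrib_left by (intro sum.cong) (auto simp: single_def)
  have D_add: "(\<lambda>z. f z + g z) \<in> D" if "f \<in> D" "g \<in> D" for f g
  proof -
    obtain x y where x: "\<forall>B. x B \<in> F" "f - comb x \<in> J" and y: "\<forall>B. y B \<in> F" "g - comb y \<in> J"
      using \<open>f \<in> D\<close> \<open>g \<in> D\<close> by (auto simp: D_def)
    have "(\<lambda>z. (f - comb x) z + (g - comb y) z) = (\<lambda>z. f z + g z) - comb (\<lambda>B. x B + y B)"
      by (simp add: fun_eq_iff comb_add[symmetric])
    hence "(\<lambda>z. f z + g z) - comb (\<lambda>B. x B + y B) \<in> J" using ideal_add[OF J(1) x(2) y(2)] by simp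
    thus ?thesis unfolding D_def using x(1) y(1) subfield_add[OF F(1)]
      by (intro CollectI exI[of _ "\<lambda>B. x B + y B"]) auto
  qed
  have D_scale: "(\<lambda>z. c * f z) \<in> D" if "f \<in> D" "c \<in> F" for f c
  proof -
    obtain x where x: "\<forall>B. x B \<in> F" "f - comb x \<in> J" using \<open>f \<in> D\<close> by (auto simp: D_def)
    have "(\<lambda>z. c * (f - comb x) z) = (\<lambda>z. c * f z) - comb (\<lambda>B. c * x B)"
      by (simp add: fun_eq_iff comb_scale[symmetric] algebra_simps)
    hence "(\<lambda>z. c * f z) - comb (\<lambda>B. c * x B) \<in> J" using ideal_scale[OF J(1) x(2) that(2)] by simp
    thus ?thesis unfolding D_def using x(1) that(2) subfield_mult[OF F(1)]
      by (intro CollectI exI[of _ "\<lambda>B. c * x B"]) auto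
  qed
  have D_cong: "f \<in> D" if "f - g \<in> J" "g \<in> D" for f g
  proof -
    obtain x where x: "\<forall>B. x B \<in> F" "g - comb x \<in> J" using \<open>g \<in> D\<close> by (auto simp: D_def)
    have "(\<lambda>z. (f - g) z + (g - comb x) z) = f - comb x" by (simp add: fun_eq_iff)
    thus ?thesis unfolding D_def using ideal_add[OF J(1) that(1) x(2)] x(1) by auto
  qed
  have D_base: "single (m B) 1 \<in> D" if "B \<subseteq> I" for B
  proof -
    have "comb (\<lambda>B'. if B' = B then 1 else 0) z = single (m B) 1 z" for z
    proof -
      have "comb (\<lambda>B'. if B' = B then 1 else 0) z = (\<Sum>B'\<in>Pow I. if B' = B then single (m B) 1 z else 0)"
        unfolding comb_def by (intro sum.cong) (auto simp: single_def)
      also have "\<dots> = single (m B) 1 z" using I that by simp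
      finally show ?thesis .
    qed
    hence "single (m B) 1 - comb (\<lambda>B'. if B' = B then 1 else 0) = (\<lambda>x. 0)" by (simp add: fun_eq_iff)
    thus ?thesis unfolding D_def
      using ideal_0[OF J(1)] subfield_0[OF F(1)] subfield_1[OF F(1)]
      by (intro CollectI exI[of _ "\<lambda>B'. if B' = B then 1 else 0"]) auto
  qed
  have rel_add: "single (x(i := y + z)) 1 - single (x(i := y)) 1 - single (x(i := z)) 1 \<in> J"
    if "x \<in> carrier M" "i \<in> I" "y \<in> L i" "z \<in> L i" for x i y z
  proof -
    have "single (x(i := y + z)) 1 - single (x(i := y)) 1 - single (x(i := z)) 1
      \<in> tensor_relations F I (\<lambda>i. field_algebra (L i))"
      unfolding tensor_relations_def using that by (intro UnI1 CollectI exI[of _ x] exI[of _ i] exI[of _ y] exI[of _ z]) auto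
    thus ?thesis using J(2) by blast
  qed
  have rel_scale: "single (x(i := u * y)) 1 - single (x(i := y)) u \<in> J"
    if "x \<in> carrier M" "i \<in> I" "y \<in> L i" "u \<in> F" for x i y u
  proof -
    have "single (x(i := u * y)) 1 - single (x(i := y)) u \<in> tensor_relations F I (\<lambda>i. field_algebra (L i))"
      unfolding tensor_relations_def using that by (intro UnI2 CollectI exI[of _ x] exI[of _ i] exI[of _ y] exI[of _ u]) auto
    thus ?thesis using J(2) by blast
  qed
  have scaled: "single (x(i := u * y)) 1 \<in> D"
    if "x \<in> carrier M" "i \<in> I" "y \<in> L i" "u \<in> F" "single (x(i := y)) 1 \<in> D" for x i y u
  proof (rule D_cong[OF rel_scale[OF that(1-4)]])
    have "single (x(i := y)) u = (\<lambda>z. u * single (x(i := y)) 1 z)" by (auto simp: single_def)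
    thus "single (x(i := y)) u \<in> D" using D_scale[OF that(5,4)] by simp
  qed
  \<comment> \<open>The factors with index in \<open>T\<close> have not been expanded yet.\<close>
  have "single x 1 \<in> D" if "x \<in> carrier M" "\<And>i. i \<in> I - T \<Longrightarrow> x i = 1 \<or> x i = r i" "finite T" "T \<subseteq> I" for T x
    using that(3,4,1,2)
  proof (induction T arbitrary: x rule: finite_induct)
    case empty
    have "x = m {i\<in>I. x i = r i}"
      using empty.prems by (auto simp: m_def fun_eq_iff PiE_iff extensional_def)
    thus ?case using D_base[of "{i\<in>I. x i = r i}"] by auto
  next
    case (insert i T)
    have i: "i \<in> I" using insert.prems by simp
    obtain u w where uw: "x i = u + w * r i" "u \<in> F" "w \<in> F"
      using L_cases[OF i, of "x i"] insert.prems(2) i by auto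
    have IH: "single (x(i := z)) 1 \<in> D" if "z = 1 \<or> z = r i" for z
      using insert.prems insert.hyps that r_in_L[OF i] F_sub_L[OF i subfield_1[OF F(1)]] i
      by (intro insert.IH update_carrier) auto
    note x = insert.prems(2)
    have "single (x(i := u * 1)) 1 \<in> D"
      by (intro scaled x i uw IH F_sub_L subfield_1 F) simp
    hence u: "single (x(i := u)) 1 \<in> D" by simp
    have w: "single (x(i := w * r i)) 1 \<in> D"
      by (intro scaled x i uw IH r_in_L) simp
    have wL: "w * r i \<in> L i" using L_mem[OF i subfield_0[OF F(1)] uw(3)] by simp
    have eq: "single (x(i := u + w * r i)) 1 - single (x(i := u)) 1 - single (x(i := w * r i)) 1
        = single x 1 - (\<lambda>z. single (x(i := u)) 1 z + single (x(i := w * r i)) 1 z)"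
      unfolding uw(1)[symmetric] fun_upd_triv by (simp add: fun_eq_iff)
    have "single x 1 - (\<lambda>z. single (x(i := u)) 1 z + single (x(i := w * r i)) 1 z) \<in> J"
      using rel_add[OF x i F_sub_L[OF i uw(2)] wL] unfolding eq .
    thus ?case by (rule D_cong[OF _ D_add[OF u w]])
  qed
  from this[of _ I] have D_single: "single x 1 \<in> D" if "x \<in> carrier M" for x
    using I that by auto
  have "f \<in> D"
  proof (rule carrier_induct[where D = "\<lambda>f. f \<in> D", OF f])
    fix x and c :: complex assume x: "x \<in> carrier M" and c: "c \<in> F"
    have "single x c = (\<lambda>z. c * single x 1 z)" by (auto simp: single_def)
    thus "single x c \<in> D" using D_scale[OF D_single[OF x] c] by simp
  qed (rule D_add)
  thus thesis using that by (auto simp: D_def comb_def)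
qed

lemma reindex_P: "(\<Sum>p\<in>P. g (s p)) = (\<Sum>A\<in>Pow I. g A)"
  by (rule sum.reindex_bij_betw[OF s])

text \<open>Up to constants the \<open>v B\<close> are the characters of the group of sign changes.\<close>

lemma orthogonality:
  assumes B: "B \<subseteq> I" "B' \<subseteq> I"
  shows "(\<Sum>p\<in>P. v B p * cnj (v B' p)) = (if B = B' then 2 ^ card I * (\<Prod>i\<in>B. a i) else 0)"
proof -
  define w where "w \<epsilon> i = (if i \<in> B then \<epsilon> * r i else 1) * cnj (if i \<in> B' then \<epsilon> * r i else 1)" for \<epsilon> i
  have ext: "v B'' p = (\<Prod>i\<in>I. if i \<in> B'' then \<rho> p i else 1)" if "B'' \<subseteq> I" for B'' p
    unfolding v_def using I that by (intro prod.mono_neutral_cong_left) auto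
  have "v B p * cnj (v B' p) = (\<Prod>i\<in>I. if i \<in> s p then w (-1) i else w 1 i)" for p
    unfolding ext[OF B(1)] ext[OF B(2)] cnj_prod prod.distrib[symmetric]
    by (intro prod.cong) (auto simp: w_def rho)
  hence "(\<Sum>p\<in>P. v B p * cnj (v B' p)) = (\<Sum>A\<in>Pow I. \<Prod>i\<in>I. if i \<in> A then w (-1) i else w 1 i)"
    using reindex_P[of "\<lambda>A. \<Prod>i\<in>I. if i \<in> A then w (-1) i else w 1 i"] by simp
  also have "\<dots> = (\<Prod>i\<in>I. w (-1) i + w 1 i)" by (rule sum_Pow_prod[OF I])
  also have "\<dots> = (if B = B' then 2 ^ card I * (\<Prod>i\<in>B. a i) else 0)"
  proof (cases "B = B'")
    case True
    have "(\<Prod>i\<in>I. w (-1) i + w 1 i) = (\<Prod>i\<in>I. 2 * (if i \<in> B then a i else 1))"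
      by (intro prod.cong) (auto simp: w_def True[symmetric] r)
    also have "\<dots> = 2 ^ card I * (\<Prod>i\<in>I. if i \<in> B then a i else 1)" by (simp add: prod.distrib)
    also have "(\<Prod>i\<in>I. if i \<in> B then a i else 1) = (\<Prod>i\<in>B. a i)"
      using I B(1) by (intro prod.mono_neutral_cong_right) auto
    finally show ?thesis using True by simp
  next
    case False
    then obtain i where i: "i \<in> I" "i \<in> B \<longleftrightarrow> i \<notin> B'" using B by blast
    hence "w (-1) i + w 1 i = 0" by (auto simp: w_def r)
    hence "(\<Prod>i\<in>I. w (-1) i + w 1 i) = 0" by (intro prod_zero[OF I] bexI[OF _ i(1)])
    thus ?thesis using False by simp
  qed
  finally show ?thesis .
qed

lemma a_prod_nz: "B \<subseteq> I \<Longrightarrow> (\<Prod>i\<in>B. a i) \<noteq> 0"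
proof -
  assume B: "B \<subseteq> I"
  have "a i \<noteq> 0" if "i \<in> I" for i using a(2)[OF that] by auto
  thus ?thesis using B finite_subset[OF B I] by auto
qed

lemma coefficient:
  assumes "\<And>p. p \<in> P \<Longrightarrow> g p = (\<Sum>B\<in>Pow I. x B * v B p)" "B \<subseteq> I"
  shows "x B = (\<Sum>p\<in>P. g p * cnj (v B p)) / (2 ^ card I * (\<Prod>i\<in>B. a i))"
proof -
  have "(\<Sum>p\<in>P. g p * cnj (v B p)) = (\<Sum>p\<in>P. \<Sum>B'\<in>Pow I. x B' * (v B' p * cnj (v B p)))"
    by (intro sum.cong refl) (simp only: assms(1) sum_distrib_right mult.assoc)
  also have "\<dots> = (\<Sum>B'\<in>Pow I. x B' * (\<Sum>p\<in>P. v B' p * cnj (v B p)))"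
    by (subst sum.swap) (simp add: sum_distrib_left)
  also have "\<dots> = (\<Sum>B'\<in>Pow I. if B' = B then x B * (2 ^ card I * (\<Prod>i\<in>B. a i)) else 0)"
    using assms(2) by (intro sum.cong) (auto simp: orthogonality)
  also have "\<dots> = x B * (2 ^ card I * (\<Prod>i\<in>B. a i))" using I assms(2) by simp
  finally show ?thesis using a_prod_nz[OF assms(2)] by simp
qed

text \<open>Fourier inversion on the group of sign changes.\<close>

lemma inversion:
  assumes g: "g \<in> extensional P"
    and mem: "\<And>B. B \<subseteq> I \<Longrightarrow> (\<Sum>p\<in>P. g p * cnj (v B p)) \<in> F"
  shows "g \<in> E"
proof -
  define x where "x B = (if B \<subseteq> I then (\<Sum>p\<in>P. g p * cnj (v B p)) / (2 ^ card I * (\<Prod>i\<in>B. a i)) else 0)" for B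
  have two: "2 \<in> F" using subfield_of_nat[OF F(1), of 2] by simp
  have x: "x B \<in> F" for B
    unfolding x_def using mem a
    by (auto intro!: subfield_divide subfield_mult subfield_power subfield_prod F two subfield_0)
  \<comment> \<open>Summing over \<open>B\<close> gives a product of factors that vanish wherever \<open>p\<close> and \<open>q\<close> differ in sign.\<close>
  have dual: "(\<Sum>B\<in>Pow I. cnj (v B q) * v B p / (\<Prod>i\<in>B. a i)) = (if q = p then 2 ^ card I else 0)"
    if q: "q \<in> P" and p: "p \<in> P" for p q
  proof -
    have "cnj (v B q) * v B p / (\<Prod>i\<in>B. a i) = (\<Prod>i\<in>B. cnj (\<rho> q i) * \<rho> p i / a i)" for B
      by (simp add: v_def prod_dividef prod.distrib)
    hence "(\<Sum>B\<in>Pow I. cnj (v B q) * v B p / (\<Prod>i\<in>B. a i)) =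
        (\<Sum>B\<in>Pow I. (\<Prod>i\<in>B. cnj (\<rho> q i) * \<rho> p i / a i) * (\<Prod>i\<in>I - B. 1))" by simp
    also have "\<dots> = (\<Prod>i\<in>I. cnj (\<rho> q i) * \<rho> p i / a i + 1)" by (rule prod_add[OF I, symmetric])
    also have "\<dots> = (if q = p then 2 ^ card I else 0)"
    proof (cases "q = p")
      case True
      have "a i \<noteq> 0" if "i \<in> I" for i using a(2)[OF that] by auto
      hence "(\<Prod>i\<in>I. cnj (\<rho> q i) * \<rho> p i / a i + 1) = (\<Prod>i\<in>I. 2)"
        by (intro prod.cong) (auto simp: True rho_sq)
      thus ?thesis using True by simp
    next
      case False
      then obtain i where i: "i \<in> I" "\<rho> q i \<noteq> \<rho> p i" using rho_separates[OF q p] by blast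
      have a0: "a i \<noteq> 0" using a(2)[OF i(1)] by auto
      have neg: "\<rho> q i = - \<rho> p i" using i(2) unfolding rho[OF i(1)] by (simp split: if_splits)
      have "cnj (\<rho> q i) * \<rho> p i = - a i"
        using rho_sq(1)[OF i(1), of p] rho_sq(2)[OF i(1), of p] by (simp add: neg)
      hence "cnj (\<rho> q i) * \<rho> p i / a i + 1 = 0" using a0 by simp
      hence "(\<Prod>i\<in>I. cnj (\<rho> q i) * \<rho> p i / a i + 1) = 0" by (intro prod_zero[OF I] bexI[OF _ i(1)])
      thus ?thesis using False by simp
    qed
    finally show ?thesis .
  qed
  have "(\<Sum>B\<in>Pow I. x B * v B p) = g p" if p: "p \<in> P" for p
  proof -
    have "(\<Sum>B\<in>Pow I. x B * v B p) = (\<Sum>B\<in>Pow I. \<Sum>q\<in>P. g q * (cnj (v B q) * v B p / (\<Prod>i\<in>B. a i)) / 2 ^ card I)"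
      by (intro sum.cong) (auto simp: x_def sum_divide_distrib sum_distrib_right sum_distrib_left mult_ac)
    also have "\<dots> = (\<Sum>q\<in>P. g q * (\<Sum>B\<in>Pow I. cnj (v B q) * v B p / (\<Prod>i\<in>B. a i)) / 2 ^ card I)"
      by (subst sum.swap) (simp add: sum_distrib_left sum_divide_distrib)
    also have "\<dots> = (\<Sum>q\<in>P. if q = p then g p else 0)"
      using p by (intro sum.cong) (auto simp: dual)
    also have "\<dots> = g p" using p finite_P by simp
    finally show ?thesis .
  qed
  hence "g = (\<lambda>p\<in>P. \<Sum>B\<in>Pow I. x B * v B p)"
    using g by (intro extensionalityI[of _ P]) auto
  thus ?thesis unfolding E_def using x by blast
qed

lemma kappa_mult: "x \<in> carrier M \<Longrightarrow> y \<in> carrier M \<Longrightarrow> \<kappa> p (x \<otimes>\<^bsub>M\<^esub> y) = \<kappa> p x * \<kappa> p y"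
  by (simp add: \<kappa>_def conj_at_simps prod.distrib)

lemma relations_carrier: "tensor_relations F I (\<lambda>i. field_algebra (L i)) \<subseteq> carrier R"
proof -
  note closed = subfield_add[OF L(2)] subfield_mult[OF L(2)] subfield_1[OF F(1)]
  have "single (x(i := y + z)) 1 - single (x(i := y)) 1 - single (x(i := z)) 1 \<in> carrier R"
    if "x \<in> carrier M" "i \<in> I" "y \<in> L i" "z \<in> L i" for x i y z
    using that by (intro diff_carrier single_carrier update_carrier closed)
  moreover have "single (x(i := u * y)) 1 - single (x(i := y)) u \<in> carrier R"
    if "x \<in> carrier M" "i \<in> I" "y \<in> L i" "u \<in> F" for x i y u
  proof -
    have "u * y \<in> L i" by (rule subfield_mult[OF L(2)[OF that(2)] F_sub_L[OF that(2,4)] that(3)])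
    thus ?thesis using that by (intro diff_carrier single_carrier update_carrier subfield_1 F)
  qed
  ultimately show ?thesis unfolding tensor_relations_def by auto
qed

lemma relations_vanish:
  assumes "t \<in> tensor_relations F I (\<lambda>i. field_algebra (L i))"
  shows "lin (\<kappa> p) t = 0"
proof -
  have "lin (\<kappa> p) (single (x(i := y + z)) 1 - single (x(i := y)) 1 - single (x(i := z)) 1) = 0"
    if "i \<in> I" for x i y z
  proof -
    let ?f = "single (x(i := y + z)) 1 - single (x(i := y)) (1::complex)"
    have "finite {z. ?f z \<noteq> 0}"
      by (rule finite_subset[of _ "{x(i := y + z), x(i := y)}"]) (auto simp: single_def)
    thus ?thesis
      by (simp only: lin_diff single_supp lin_single kappa_update[OF that] conj_at_simps) (simp add: algebra_simps)
  qed
  moreover have "lin (\<kappa> p) (single (x(i := u * y)) 1 - single (x(i := y)) u) = 0" if "i \<in> I" "u \<in> F" for x i y u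
    using that by (simp add: lin_diff single_supp kappa_update conj_at_simps algebra_simps)
  ultimately show ?thesis using assms unfolding tensor_relations_def by auto
qed

abbreviation "V \<equiv> tensor_algebra F I (\<lambda>i. field_algebra (L i))"

lemma lin_combination:
  assumes "\<And>B. x B \<in> F"
  shows "(\<lambda>z. \<Sum>B\<in>Pow I. single (m B) (x B) z) \<in> carrier R"
    and "lin (\<kappa> p) (\<lambda>z. \<Sum>B\<in>Pow I. single (m B) (x B) z) = (\<Sum>B\<in>Pow I. x B * v B p)"
proof -
  have *: "single (m B) (x B) \<in> carrier R" for B by (rule single_carrier[OF m_carrier assms])
  show "(\<lambda>z. \<Sum>B\<in>Pow I. single (m B) (x B) z) \<in> carrier R" by (rule sum_carrier) (rule *)
  show "lin (\<kappa> p) (\<lambda>z. \<Sum>B\<in>Pow I. single (m B) (x B) z) = (\<Sum>B\<in>Pow I. x B * v B p)"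
    unfolding lin_carrier_sum[OF *] by (intro sum.cong) (auto simp: kappa_m)
qed

text \<open>The coefficients of the combination are determined by the values of the characters, so that the
  characters together are injective on the quotient.\<close>

lemma normal_form:
  assumes f: "f \<in> carrier R"
  obtains x where "\<And>B. x B \<in> F"
    "f - (\<lambda>z. \<Sum>B\<in>Pow I. single (m B) (x B) z) \<in> Idl\<^bsub>R\<^esub> (tensor_relations F I (\<lambda>i. field_algebra (L i)))"
    "\<And>p. p \<in> P \<Longrightarrow> lin (\<kappa> p) f = (\<Sum>B\<in>Pow I. x B * v B p)"
proof -
  let ?S = "tensor_relations F I (\<lambda>i. field_algebra (L i))"
  obtain x where x: "\<And>B. x B \<in> F" "f - (\<lambda>z. \<Sum>B\<in>Pow I. single (m B) (x B) z) \<in> Idl\<^bsub>R\<^esub> ?S"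
    using spanning[OF R.genideal_ideal[OF relations_carrier] R.genideal_self[OF relations_carrier] f] by blast
  note comb = lin_combination[OF x(1)]
  have "lin (\<kappa> p) f = (\<Sum>B\<in>Pow I. x B * v B p)" if "p \<in> P" for p
  proof -
    have "lin (\<kappa> p) (f - (\<lambda>z. \<Sum>B\<in>Pow I. single (m B) (x B) z)) = 0"
      by (rule lin_genideal[where P = P and \<kappa> = \<kappa>, OF kappa_mult relations_carrier relations_vanish x(2) that])
    thus ?thesis
      using comb(2)[of p] by (simp add: lin_diff[OF carrierD(2)[OF f] carrierD(2)[OF comb(1)]])
  qed
  thus thesis using that x by blast
qed

lemma V_iso: "quotient_eval P \<kappa> \<in> algebra_iso F V (function_algebra P E)"
  and V_representative: "Y \<in> carrier V \<Longrightarrow> (SOME f. f \<in> Y) \<in> carrier R"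
proof -
  let ?S = "tensor_relations F I (\<lambda>i. field_algebra (L i))"
  have image: "(\<lambda>f. \<lambda>p\<in>P. lin (\<kappa> p) f) ` carrier R = E"
  proof
    show "(\<lambda>f. \<lambda>p\<in>P. lin (\<kappa> p) f) ` carrier R \<subseteq> E"
    proof (rule image_subsetI)
      fix f assume "f \<in> carrier R"
      then obtain x where "\<And>B. x B \<in> F" "\<And>p. p \<in> P \<Longrightarrow> lin (\<kappa> p) f = (\<Sum>B\<in>Pow I. x B * v B p)"
        using normal_form by blast
      thus "(\<lambda>p\<in>P. lin (\<kappa> p) f) \<in> E"
        unfolding E_def by (intro CollectI exI[of _ x]) (simp cong: restrict_cong)
    qed
    show "E \<subseteq> (\<lambda>f. \<lambda>p\<in>P. lin (\<kappa> p) f) ` carrier R"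
    proof
      fix g assume "g \<in> E"
      then obtain x where x: "\<And>B. x B \<in> F" "g = (\<lambda>p\<in>P. \<Sum>B\<in>Pow I. x B * v B p)" by (auto simp: E_def)
      show "g \<in> (\<lambda>f. \<lambda>p\<in>P. lin (\<kappa> p) f) ` carrier R"
        unfolding x(2) lin_combination(2)[OF x(1), symmetric]
        by (rule imageI) (rule lin_combination(1)[OF x(1)])
    qed
  qed
  have ker: "f \<in> J" if f: "f \<in> carrier R" and J: "ideal J R" "?S \<subseteq> J" and 0: "\<And>p. p \<in> P \<Longrightarrow> lin (\<kappa> p) f = 0" for f J
  proof -
    obtain x where "\<And>B. x B \<in> F" and x: "f - (\<lambda>z. \<Sum>B\<in>Pow I. single (m B) (x B) z) \<in> Idl\<^bsub>R\<^esub> ?S"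
      "\<And>p. p \<in> P \<Longrightarrow> lin (\<kappa> p) f = (\<Sum>B\<in>Pow I. x B * v B p)"
      by (rule normal_form[OF f], rule that)
    have x0: "x B = 0" if "B \<subseteq> I" for B
      using coefficient[of "\<lambda>p. lin (\<kappa> p) f", OF x(2) that] 0 by simp
    have "(\<lambda>z. \<Sum>B\<in>Pow I. single (m B) (x B) z) = (\<lambda>z. 0)"
      by (intro ext sum.neutral) (auto simp: single_def x0)
    hence "f - (\<lambda>z. \<Sum>B\<in>Pow I. single (m B) (x B) z) = f" by (simp add: fun_eq_iff)
    thus ?thesis using x(1) R.genideal_minimal[OF J] by auto
  qed
  have one: "\<one>\<^bsub>M\<^esub> \<in> carrier M" by (rule M.one_closed)
  have kappa_one: "\<kappa> p \<one>\<^bsub>M\<^esub> = 1" for p by (simp add: \<kappa>_def conj_at_simps)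
  note main = quotient_eval_iso[where P = P and \<kappa> = \<kappa> and S = ?S and F = F and u = "\<lambda>c. single \<one>\<^bsub>M\<^esub> c",
      OF kappa_mult kappa_one relations_carrier relations_vanish ker single_carrier[OF one]]
  show "quotient_eval P \<kappa> \<in> algebra_iso F V (function_algebra P E)"
    unfolding tensor_algebra_def image[symmetric] by (rule main(1)) (simp_all add: kappa_one kappa_one[unfolded prod_field_simps])
  show "(SOME f. f \<in> Y) \<in> carrier R" if "Y \<in> carrier V"
    by (rule main(2)) (use that in \<open>simp_all add: tensor_algebra_def kappa_one kappa_one[unfolded prod_field_simps]\<close>)
qed

lemma norm_L:
  assumes i: "i \<in> I" and z: "z \<in> L i"
  shows "field_norm F (L i) z = z * cnj z"
proof -
  obtain u w where uw: "z = u + w * r i" "u \<in> F" "w \<in> F" using L_cases[OF i z] .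
  have "field_norm F (L i) z = u\<^sup>2 + a i * w\<^sup>2"
    unfolding uw(1) L_def r_def by (rule field_norm_quadratic[OF F a[OF i] uw(2,3)])
  also have "\<dots> = u * u - w * w * (r i * r i)" by (simp add: r(1)[OF i] power2_eq_square)
  also have "\<dots> = z * cnj z" by (simp add: uw F_cnj r(2)[OF i] algebra_simps)
  finally show ?thesis .
qed

text \<open>The bilinear form of the norm is half the sum of \<open>x \<cdot> cnj y\<close> and its conjugate, so that the
  tensor product of these forms is \<open>2\<^sup>-\<^sup>N\<close> times the sum over all sign changes.\<close>

lemma V_form:
  assumes Y: "Y \<in> carrier V"
  shows "tensor_form I (\<lambda>i. field_algebra (L i)) (\<lambda>i. field_norm F (L i)) Y =
    (\<Sum>p\<in>P. quotient_eval P \<kappa> Y p * cnj (quotient_eval P \<kappa> Y p)) / 2 ^ card I"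
proof -
  have bil: "bilin (field_algebra (L i)) (field_norm F (L i)) x y = (cnj x * y + x * cnj y) / 2"
    if "i \<in> I" "x \<in> L i" "y \<in> L i" for i x y
    using that by (simp add: bilin_def norm_L subfield_add[OF L(2)] algebra_simps)
  have "(\<Prod>i\<in>I. bilin (field_algebra (L i)) (field_norm F (L i)) (x i) (y i)) =
      1 / 2 ^ card I * (\<Sum>p\<in>P. \<kappa> p x * cnj (\<kappa> p y))"
    if x: "x \<in> carrier M" and y: "y \<in> carrier M" for x y
  proof -
    have "(\<Prod>i\<in>I. bilin (field_algebra (L i)) (field_norm F (L i)) (x i) (y i)) =
        (\<Prod>i\<in>I. (cnj (x i) * y i + x i * cnj (y i)) / 2)"
      using x y by (intro prod.cong refl bil) auto
    also have "\<dots> = 1 / 2 ^ card I * (\<Prod>i\<in>I. cnj (x i) * y i + x i * cnj (y i))"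
      by (simp add: prod_dividef)
    also have "(\<Prod>i\<in>I. cnj (x i) * y i + x i * cnj (y i)) =
        (\<Sum>A\<in>Pow I. \<Prod>i\<in>I. if i \<in> A then cnj (x i) * y i else x i * cnj (y i))"
      by (rule sum_Pow_prod[OF I, symmetric])
    also have "\<dots> = (\<Sum>p\<in>P. \<Prod>i\<in>I. if i \<in> s p then cnj (x i) * y i else x i * cnj (y i))"
      by (rule reindex_P[symmetric])
    also have "\<dots> = (\<Sum>p\<in>P. \<kappa> p x * cnj (\<kappa> p y))"
      unfolding \<kappa>_def cnj_prod prod.distrib[symmetric]
      by (intro sum.cong prod.cong) (auto simp: conj_at_def)
    finally show ?thesis .
  qed
  hence "tensor_form I (\<lambda>i. field_algebra (L i)) (\<lambda>i. field_norm F (L i)) Y =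
    1 / 2 ^ card I * (\<Sum>p\<in>P. quotient_eval P \<kappa> Y p * cnj (quotient_eval P \<kappa> Y p))"
    unfolding tensor_form_def by (intro induced_form_eq_sum F V_representative Y)
  thus ?thesis by simp
qed

lemma E_combination:
  "(\<And>B. x B \<in> F) \<Longrightarrow> (\<lambda>p\<in>P. \<Sum>B\<in>Pow I. x B * v B p) \<in> E"
  by (auto simp: E_def)

lemma v_in_E:
  assumes "B \<subseteq> I"
  shows "(\<lambda>p\<in>P. v B p) \<in> E"
proof -
  have "(\<Sum>B'\<in>Pow I. (if B' = B then 1 else 0) * v B' p) = v B p" for p
  proof -
    have "(\<Sum>B'\<in>Pow I. (if B' = B then 1 else 0) * v B' p) = (\<Sum>B'\<in>Pow I. if B' = B then v B p else 0)"
      by (intro sum.cong) auto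
    thus ?thesis using I assms by simp
  qed
  thus ?thesis
    using E_combination[of "\<lambda>B'. if B' = B then 1 else 0"] subfield_0[OF F(1)] subfield_1[OF F(1)] by simp
qed

text \<open>A homomorphism of \<open>F\<close>-algebras from \<open>E\<close> to the complex numbers sends the \<open>i\<close>-th
  square root to one of the two square roots of \<open>-a\<^sub>i\<close>, hence is the evaluation at a sign change.\<close>

lemma hom_is_evaluation:
  assumes add: "\<And>f f'. f \<in> E \<Longrightarrow> f' \<in> E \<Longrightarrow> g (\<lambda>p\<in>P. f p + f' p) = g f + g f'"
    and mult: "\<And>f f'. f \<in> E \<Longrightarrow> f' \<in> E \<Longrightarrow> g (\<lambda>p\<in>P. f p * f' p) = g f * g f'"
    and scale: "\<And>c f. c \<in> F \<Longrightarrow> f \<in> E \<Longrightarrow> g (\<lambda>p\<in>P. c * f p) = c * g f"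
    and one: "g (\<lambda>p\<in>P. 1) = 1"
  obtains p where "p \<in> P" "\<And>f. f \<in> E \<Longrightarrow> g f = f p"
proof -
  have one_E: "(\<lambda>p\<in>P. 1) \<in> E" using v_in_E[of "{}"] by (simp add: v_def)
  have "g (\<lambda>p\<in>P. v {i} p) * g (\<lambda>p\<in>P. v {i} p) = - a i" if i: "i \<in> I" for i
  proof -
    have ei: "(\<lambda>p\<in>P. v {i} p) \<in> E" using i by (intro v_in_E) auto
    have "g (\<lambda>p\<in>P. v {i} p) * g (\<lambda>p\<in>P. v {i} p) = g (\<lambda>p\<in>P. (\<lambda>p\<in>P. v {i} p) p * (\<lambda>p\<in>P. v {i} p) p)"
      by (rule mult[OF ei ei, symmetric])
    also have "(\<lambda>p\<in>P. (\<lambda>p\<in>P. v {i} p) p * (\<lambda>p\<in>P. v {i} p) p) = (\<lambda>p\<in>P. - a i * (\<lambda>p\<in>P. 1) p)"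
      by (auto simp: v_def rho_sq(1)[OF i])
    also have "g \<dots> = - a i * g (\<lambda>p\<in>P. 1)"
      by (rule scale[OF subfield_uminus[OF F(1) a(1)[OF i]] one_E])
    finally show ?thesis unfolding one mult_1_right .
  qed
  from rho_exists[of "\<lambda>i. g (\<lambda>p\<in>P. v {i} p)", OF this] obtain p where
    p: "p \<in> P" "\<And>i. i \<in> I \<Longrightarrow> \<rho> p i = g (\<lambda>p\<in>P. v {i} p)" by blast
  have gv: "g (\<lambda>p\<in>P. v B p) = v B p" if "B \<subseteq> I" for B
    using finite_subset[OF that I] that
  proof (induction B rule: finite_induct)
    case empty
    have "(\<lambda>p\<in>P. v {} p) = (\<lambda>p\<in>P. 1)" by (auto simp: v_def)
    thus ?case using one by (simp only: v_def prod.empty)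
  next
    case (insert i B)
    have "(\<lambda>p\<in>P. v (insert i B) p) = (\<lambda>p\<in>P. (\<lambda>p\<in>P. v {i} p) p * (\<lambda>p\<in>P. v B p) p)"
      using insert.hyps by (auto simp: v_def)
    hence "g (\<lambda>p\<in>P. v (insert i B) p) = g (\<lambda>p\<in>P. v {i} p) * g (\<lambda>p\<in>P. v B p)"
      using insert.prems by (simp only:) (intro mult v_in_E, auto)
    also have "\<dots> = \<rho> p i * v B p"
    proof (rule arg_cong2[of _ _ _ _ "(*)"])
      show "g (\<lambda>p\<in>P. v {i} p) = \<rho> p i" by (rule p(2)[symmetric]) (use insert.prems in blast)
      show "g (\<lambda>p\<in>P. v B p) = v B p" by (rule insert.IH) (use insert.prems in blast)
    qed
    also have "\<dots> = v (insert i B) p" using insert.hyps by (simp add: v_def)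
    finally show ?case .
  qed
  have "g f = f p" if "f \<in> E" for f
  proof -
    obtain x where x: "\<And>B. x B \<in> F" "f = (\<lambda>p\<in>P. \<Sum>B\<in>Pow I. x B * v B p)"
      using \<open>f \<in> E\<close> by (auto simp: E_def)
    have partial: "(\<lambda>p\<in>P. \<Sum>B\<in>T. x B * v B p) \<in> E" if "T \<subseteq> Pow I" for T
    proof -
      have "(\<Sum>B\<in>Pow I. (if B \<in> T then x B else 0) * v B p) = (\<Sum>B\<in>T. x B * v B p)" for p
        using I that by (intro sum.mono_neutral_cong_right) auto
      thus ?thesis
        using E_combination[of "\<lambda>B. if B \<in> T then x B else 0"] x(1) subfield_0[OF F(1)] by simp
    qed
    have "g (\<lambda>p\<in>P. \<Sum>B\<in>T. x B * v B p) = (\<Sum>B\<in>T. x B * v B p)" if "finite T" "T \<subseteq> Pow I" for T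
      using that
    proof (induction T rule: finite_induct)
      case empty
      have eq: "(\<lambda>p\<in>P. \<Sum>B\<in>{}. x B * v B p) = (\<lambda>p\<in>P. 0 * (\<lambda>p\<in>P. 1) p)" by auto
      show ?case unfolding eq scale[OF subfield_0[OF F(1)] one_E] by simp
    next
      case (insert B T)
      have B: "B \<subseteq> I" and T: "T \<subseteq> Pow I" using insert.prems by auto
      have 1: "(\<lambda>p\<in>P. x B * (\<lambda>p\<in>P. v B p) p) \<in> E"
        using partial[of "{B}"] B by (auto cong: restrict_cong)
      have "(\<lambda>p\<in>P. \<Sum>B\<in>insert B T. x B * v B p) =
          (\<lambda>p\<in>P. (\<lambda>p\<in>P. x B * (\<lambda>p\<in>P. v B p) p) p + (\<lambda>p\<in>P. \<Sum>B\<in>T. x B * v B p) p)"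
        using insert.hyps by auto
      hence "g (\<lambda>p\<in>P. \<Sum>B\<in>insert B T. x B * v B p) =
          g (\<lambda>p\<in>P. x B * (\<lambda>p\<in>P. v B p) p) + g (\<lambda>p\<in>P. \<Sum>B\<in>T. x B * v B p)"
        by (simp only:) (rule add[OF 1 partial[OF T]])
      also have "\<dots> = x B * v B p + (\<Sum>B\<in>T. x B * v B p)"
        unfolding scale[OF x(1)[of B] v_in_E[OF B]] insert.IH[OF T] gv[OF B] ..
      also have "\<dots> = (\<Sum>B\<in>insert B T. x B * v B p)" using insert.hyps by simp
      finally show ?case .
    qed
    from this[of "Pow I"] have "g (\<lambda>p\<in>P. \<Sum>B\<in>Pow I. x B * v B p) = (\<Sum>B\<in>Pow I. x B * v B p)"
      using I by blast
    thus ?thesis using p(1) by (simp only: x(2) restrict_apply if_True)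
  qed
  thus thesis using that p(1) by blast
qed

text \<open>Hence an automorphism of \<open>E\<close> permutes the points of \<open>P\<close>; it is injective on points because
  the square roots already separate them.\<close>

theorem automorphism_preserves_norm:
  assumes \<alpha>: "\<alpha> \<in> algebra_iso F (function_algebra P E) (function_algebra P E)" and f: "f \<in> E"
  shows "(\<Sum>p\<in>P. \<alpha> f p * cnj (\<alpha> f p)) = (\<Sum>p\<in>P. f p * cnj (f p))"
proof -
  have hom: "\<And>f f'. f \<in> E \<Longrightarrow> f' \<in> E \<Longrightarrow> \<alpha> (\<lambda>p\<in>P. f p + f' p) = (\<lambda>p\<in>P. \<alpha> f p + \<alpha> f' p)"
    "\<And>f f'. f \<in> E \<Longrightarrow> f' \<in> E \<Longrightarrow> \<alpha> (\<lambda>p\<in>P. f p * f' p) = (\<lambda>p\<in>P. \<alpha> f p * \<alpha> f' p)"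
    "\<And>c f. c \<in> F \<Longrightarrow> f \<in> E \<Longrightarrow> \<alpha> (\<lambda>p\<in>P. c * f p) = (\<lambda>p\<in>P. c * \<alpha> f p)"
    "\<alpha> (\<lambda>p\<in>P. 1) = (\<lambda>p\<in>P. 1)"
    and bij: "bij_betw \<alpha> E E"
    using \<alpha> by (auto simp: algebra_iso_def ring_iso_def ring_hom_def)
  have "\<exists>q. q \<in> P \<and> (\<forall>f\<in>E. \<alpha> f p = f q)" if p: "p \<in> P" for p
  proof -
    obtain q where "q \<in> P" "\<And>f. f \<in> E \<Longrightarrow> \<alpha> f p = f q"
      by (rule hom_is_evaluation[of "\<lambda>f. \<alpha> f p"]) (use p in \<open>auto simp: hom\<close>)
    thus ?thesis by blast
  qed
  hence "\<forall>p\<in>P. \<exists>q. q \<in> P \<and> (\<forall>f\<in>E. \<alpha> f p = f q)" by blast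
  from bchoice[OF this] obtain \<pi> where \<pi>: "\<forall>p\<in>P. \<pi> p \<in> P \<and> (\<forall>f\<in>E. \<alpha> f p = f (\<pi> p))" ..
  have "inj_on \<pi> P"
  proof (rule inj_onI)
    fix p q assume p: "p \<in> P" and q: "q \<in> P" and eq: "\<pi> p = \<pi> q"
    have "\<rho> p i = \<rho> q i" if i: "i \<in> I" for i
    proof -
      have "(\<lambda>p\<in>P. v {i} p) \<in> \<alpha> ` E" using bij v_in_E[of "{i}"] i by (simp add: bij_betw_def)
      then obtain f where f: "f \<in> E" "(\<lambda>p\<in>P. v {i} p) = \<alpha> f" by (elim imageE)
      have "\<alpha> f p = \<alpha> f q" using \<pi> p q f(1) eq by simp
      thus ?thesis using p q unfolding f(2)[symmetric] by (simp add: v_def)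
    qed
    thus "p = q" by (rule rho_separates[OF p q])
  qed
  moreover from this have "\<pi> ` P = P" using \<pi> by (intro endo_inj_surj[OF finite_P]) auto
  ultimately have "bij_betw \<pi> P P" by (simp add: bij_betw_def)
  from sum.reindex_bij_betw[OF this, of "\<lambda>p. f p * cnj (f p)"] show ?thesis using \<pi> f by simp
qed

end

section \<open>Galois sets and the algebras of their orbits\<close>

lemma galois_inverse:
  assumes L: "galois_over_rat L" and \<sigma>: "\<sigma> \<in> embeddings L"
  obtains \<sigma>' where "\<sigma>' \<in> embeddings L" "compose L \<sigma>' \<sigma> = (\<lambda>x\<in>L. x)" "compose L \<sigma> \<sigma>' = (\<lambda>x\<in>L. x)"
proof -
  interpret G: group "gal_group L" by (rule gal_group_group[OF L])
  have "\<sigma> \<in> carrier (gal_group L)" using \<sigma> carrier_gal_group[OF L] by simp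
  from G.inv_closed[OF this] G.l_inv[OF this] G.r_inv[OF this] show thesis
    using that[of "inv\<^bsub>gal_group L\<^esub> \<sigma>"] carrier_gal_group[OF L]
    by (simp add: gal_group_mult gal_group_one)
qed

lemma sum_embeddings_translate:
  assumes L: "galois_over_rat L" and \<rho>: "\<rho> \<in> embeddings L"
  shows "(\<Sum>\<sigma>\<in>embeddings L. f (compose L \<rho> \<sigma>)) = (\<Sum>\<sigma>\<in>embeddings L. f \<sigma>)"
proof -
  have fin: "finite (carrier (gal_group L))"
    using embeddings_finite[OF galois_number_field[OF L]] by (simp add: carrier_gal_group[OF L])
  have "\<rho> \<in> carrier (gal_group L)" using \<rho> by (simp add: carrier_gal_group[OF L])
  from sum_group_translate[OF gal_group_group[OF L] group.subgroup_self[OF gal_group_group[OF L]] fin this, of f]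
  show ?thesis by (simp add: carrier_gal_group[OF L] gal_group_mult)
qed

lemma galois_trace_Rats:
  assumes L: "galois_over_rat L" and z: "z \<in> L"
  shows "(\<Sum>\<sigma>\<in>embeddings L. \<sigma> z) \<in> \<rat>"
proof (rule fixed_by_embeddings_imp_mem[OF galois_number_field[OF L] subfield_Rats_CC subfield_Rats[OF galois_subfield[OF L]]])
  note Ls = galois_subfield[OF L]
  have mem: "\<sigma> z \<in> L" if "\<sigma> \<in> embeddings L" for \<sigma> by (rule galois_emb_mem[OF L that z])
  show "(\<Sum>\<sigma>\<in>embeddings L. \<sigma> z) \<in> L" by (rule subfield_sum[OF Ls mem])
  fix \<tau> assume \<tau>: "\<tau> \<in> embeddings L"
  have "\<tau> (\<Sum>\<sigma>\<in>embeddings L. \<sigma> z) = (\<Sum>\<sigma>\<in>embeddings L. \<tau> (\<sigma> z))" by (rule emb_sum[OF Ls \<tau> mem])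
  also have "\<dots> = (\<Sum>\<sigma>\<in>embeddings L. (compose L \<tau> \<sigma>) z)" using z by (simp add: compose_eq)
  also have "\<dots> = (\<Sum>\<sigma>\<in>embeddings L. \<sigma> z)" by (rule sum_embeddings_translate[OF L \<tau>])
  finally show "\<tau> (\<Sum>\<sigma>\<in>embeddings L. \<sigma> z) = (\<Sum>\<sigma>\<in>embeddings L. \<sigma> z)" .
qed

text \<open>A finite set with an action of the automorphism group of \<open>L\<close>, together with a system \<open>\<Lambda>\<close> of
  representatives of its orbits. The algebra that Galois theory attaches to this set is the product of
  the fixed fields of the stabilizers of the representatives; its base change to \<open>F\<close> is studied below.\<close>

locale galois_set =
  fixes L F :: "complex set" and P :: "'p set" and act :: "(complex \<Rightarrow> complex) \<Rightarrow> 'p \<Rightarrow> 'p"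
    and \<Lambda> :: "'p set"
  assumes L: "galois_over_rat L" and F: "galois_over_rat F" and FL: "F \<subseteq> L"
    and act_closed: "\<And>\<sigma> p. \<sigma> \<in> embeddings L \<Longrightarrow> p \<in> P \<Longrightarrow> act \<sigma> p \<in> P"
    and act_id: "\<And>p. p \<in> P \<Longrightarrow> act (\<lambda>x\<in>L. x) p = p"
    and act_compose: "\<And>\<sigma> \<tau> p. \<sigma> \<in> embeddings L \<Longrightarrow> \<tau> \<in> embeddings L \<Longrightarrow> p \<in> P \<Longrightarrow>
      act (compose L \<sigma> \<tau>) p = act \<sigma> (act \<tau> p)"
    and finite_P: "finite P" and \<Lambda>: "\<Lambda> \<subseteq> P"
    and reps: "\<And>p. p \<in> P \<Longrightarrow> \<exists>!q. q \<in> \<Lambda> \<and> (\<exists>\<tau>\<in>embeddings L. p = act \<tau> q)"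
begin

abbreviation "G \<equiv> embeddings L"

definition fixed :: "'p \<Rightarrow> complex set" where
  "fixed q = {x \<in> L. \<forall>\<sigma>\<in>G. act \<sigma> q = q \<longrightarrow> \<sigma> x = x}"

abbreviation "A \<equiv> prod_algebra \<Lambda> (\<lambda>q. field_algebra (fixed q))"

text \<open>The equivariant function on all points that extends a family indexed by the representatives.\<close>

definition val :: "('p \<Rightarrow> complex) \<Rightarrow> 'p \<Rightarrow> complex" where
  "val b p = (SOME z. \<exists>q\<in>\<Lambda>. \<exists>\<tau>\<in>G. p = act \<tau> q \<and> z = \<tau> (b q))"

definition \<kappa> :: "'p \<Rightarrow> complex \<times> ('p \<Rightarrow> complex) \<Rightarrow> complex" where
  "\<kappa> p zb = fst zb * val (snd zb) p"

text \<open>The functions that are equivariant under the automorphisms fixing \<open>F\<close> only; the functions \<open>val b\<close> are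
  equivariant under all automorphisms.\<close>

definition E :: "('p \<Rightarrow> complex) set" where
  "E = {f \<in> extensional P. (\<forall>p\<in>P. f p \<in> L) \<and>
     (\<forall>\<sigma>\<in>G. (\<forall>x\<in>F. \<sigma> x = x) \<longrightarrow> (\<forall>p\<in>P. f (act \<sigma> p) = \<sigma> (f p)))}"

lemma Ls: "subfield L CC" and Fs: "subfield F CC"
  using L F by (auto intro: galois_subfield)

lemma G_finite: "finite G"
  by (rule embeddings_finite[OF galois_number_field[OF L]])

lemma G_mem: "\<sigma> \<in> G \<Longrightarrow> x \<in> L \<Longrightarrow> \<sigma> x \<in> L"
  by (rule galois_emb_mem[OF L])

lemma G_compose: "\<sigma> \<in> G \<Longrightarrow> \<tau> \<in> G \<Longrightarrow> compose L \<sigma> \<tau> \<in> G"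
  using emb_compose[OF Ls, of \<tau> \<sigma> L] G_mem by blast

lemma fixed_subfield: "subfield (fixed q) CC"
  unfolding fixed_def
  by (rule subfield_CC_I)
    (auto simp: emb_1 emb_add emb_mult emb_uminus[OF Ls] emb_inverse[OF Ls] subfield_1[OF Ls]
      subfield_add[OF Ls] subfield_mult[OF Ls] subfield_uminus[OF Ls] subfield_inverse[OF Ls])

lemma fixed_L: "x \<in> fixed q \<Longrightarrow> x \<in> L"
  by (simp add: fixed_def)

lemma A_mem: "b \<in> carrier A \<Longrightarrow> q \<in> \<Lambda> \<Longrightarrow> b q \<in> fixed q"
  by auto

lemma act_inverse:
  assumes "\<sigma> \<in> G" "\<sigma>' \<in> G" "compose L \<sigma>' \<sigma> = (\<lambda>x\<in>L. x)" "p \<in> P"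
  shows "act \<sigma>' (act \<sigma> p) = p"
  using act_compose[OF assms(2,1,4)] act_id[OF assms(4)] assms(3) by simp

lemma inverse_apply: "compose L \<sigma>' \<sigma> = (\<lambda>x\<in>L. x) \<Longrightarrow> x \<in> L \<Longrightarrow> \<sigma>' (\<sigma> x) = x"
  by (metis compose_eq restrict_apply')

lemma point_cases:
  assumes "p \<in> P"
  obtains q \<tau> where "q \<in> \<Lambda>" "\<tau> \<in> G" "p = act \<tau> q"
  using reps[OF assms] by blast

text \<open>If \<open>act \<tau> q = act \<tau>' q\<close>, then \<open>\<tau>\<close> and \<open>\<tau>'\<close> differ by an element of the stabilizer, so they
  agree on its fixed field.\<close>

lemma agree_on_fixed:
  assumes q: "q \<in> P" and \<tau>: "\<tau> \<in> G" "\<tau>' \<in> G" and eq: "act \<tau> q = act \<tau>' q" and x: "x \<in> fixed q"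
  shows "\<tau> x = \<tau>' x"
proof -
  obtain \<rho> where \<rho>: "\<rho> \<in> G" "compose L \<rho> \<tau>' = (\<lambda>x\<in>L. x)" "compose L \<tau>' \<rho> = (\<lambda>x\<in>L. x)"
    by (rule galois_inverse[OF L \<tau>(2)])
  have xL: "x \<in> L" using x by (rule fixed_L)
  have "act (compose L \<rho> \<tau>) q = q"
    using act_compose[OF \<rho>(1) \<tau>(1) q] eq act_inverse[OF \<tau>(2) \<rho>(1,2) q] by simp
  hence "(compose L \<rho> \<tau>) x = x" using x G_compose[OF \<rho>(1) \<tau>(1)] by (simp add: fixed_def)
  hence "\<rho> (\<tau> x) = x" using xL by (simp add: compose_eq)
  moreover have "\<tau>' (\<rho> (\<tau> x)) = \<tau> x" by (rule inverse_apply[OF \<rho>(3) G_mem[OF \<tau>(1) xL]])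
  ultimately show ?thesis by simp
qed

lemma val_act:
  assumes b: "b \<in> carrier A" and q: "q \<in> \<Lambda>" and \<tau>: "\<tau> \<in> G"
  shows "val b (act \<tau> q) = \<tau> (b q)"
proof -
  have qP: "q \<in> P" using q \<Lambda> by blast
  have "\<exists>q'\<in>\<Lambda>. \<exists>\<tau>'\<in>G. act \<tau> q = act \<tau>' q' \<and> \<tau> (b q) = \<tau>' (b q')"
    using q \<tau> by blast
  hence "\<exists>q'\<in>\<Lambda>. \<exists>\<tau>'\<in>G. act \<tau> q = act \<tau>' q' \<and> val b (act \<tau> q) = \<tau>' (b q')"
    unfolding val_def by (rule someI)
  then obtain q' \<tau>' where q': "q' \<in> \<Lambda>" "\<tau>' \<in> G" "act \<tau> q = act \<tau>' q'" "val b (act \<tau> q) = \<tau>' (b q')"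
    by blast
  have "q = q'" using reps[OF act_closed[OF \<tau> qP]] q \<tau> q'(1-3) by blast
  thus ?thesis using agree_on_fixed[OF qP \<tau> q'(2) _ A_mem[OF b q]] q' by simp
qed

lemma val_mem: "b \<in> carrier A \<Longrightarrow> p \<in> P \<Longrightarrow> val b p \<in> L"
  by (erule point_cases) (simp only: val_act, rule G_mem, assumption, rule fixed_L, rule A_mem)

lemma val_equivariant:
  assumes b: "b \<in> carrier A" and p: "p \<in> P" and \<sigma>: "\<sigma> \<in> G"
  shows "val b (act \<sigma> p) = \<sigma> (val b p)"
proof -
  obtain q \<tau> where q: "q \<in> \<Lambda>" "\<tau> \<in> G" "p = act \<tau> q" by (rule point_cases[OF p])
  have qP: "q \<in> P" using q(1) \<Lambda> by blast
  have "val b (act \<sigma> p) = (compose L \<sigma> \<tau>) (b q)"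
    unfolding q(3) act_compose[OF \<sigma> q(2) qP, symmetric] by (rule val_act[OF b q(1) G_compose[OF \<sigma> q(2)]])
  also have "\<dots> = \<sigma> (\<tau> (b q))" using fixed_L[OF A_mem[OF b q(1)]] by (simp add: compose_eq)
  finally show ?thesis unfolding q(3) val_act[OF b q(1,2)] .
qed

text \<open>By equivariance the value at a representative is fixed by the stabilizer.\<close>

lemma equivariant_eq_val:
  assumes f: "\<And>p. p \<in> P \<Longrightarrow> f p \<in> L" "\<And>\<sigma> p. \<sigma> \<in> G \<Longrightarrow> p \<in> P \<Longrightarrow> f (act \<sigma> p) = \<sigma> (f p)"
  shows "restrict f \<Lambda> \<in> carrier A" and "p \<in> P \<Longrightarrow> val (restrict f \<Lambda>) p = f p"
proof -
  have "f q \<in> fixed q" if "q \<in> \<Lambda>" for q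
  proof -
    have q: "q \<in> P" using that \<Lambda> by blast
    show ?thesis unfolding fixed_def using f(1)[OF q] f(2)[OF _ q] by force
  qed
  thus *: "restrict f \<Lambda> \<in> carrier A" by auto
  assume p: "p \<in> P"
  obtain q \<tau> where q: "q \<in> \<Lambda>" "\<tau> \<in> G" "p = act \<tau> q" by (rule point_cases[OF p])
  have qP: "q \<in> P" using q(1) \<Lambda> by blast
  show "val (restrict f \<Lambda>) p = f p"
    unfolding q(3) val_act[OF * q(1,2)] f(2)[OF q(2) qP] using q(1) by simp
qed

lemma A_closed:
  assumes "b \<in> carrier A" "b' \<in> carrier A"
  shows "(\<lambda>q\<in>\<Lambda>. b q + b' q) \<in> carrier A" "(\<lambda>q\<in>\<Lambda>. b q * b' q) \<in> carrier A"
  using A_mem[OF assms(1)] A_mem[OF assms(2)] fixed_subfield by (auto intro: subfield_add subfield_mult)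

lemma A_scale: "b \<in> carrier A \<Longrightarrow> c \<in> \<rat> \<Longrightarrow> (\<lambda>q\<in>\<Lambda>. c * b q) \<in> carrier A"
  using A_mem[of b] subfield_Rats[OF fixed_subfield] by (auto intro!: subfield_mult[OF fixed_subfield])

lemma A_one: "(\<lambda>q\<in>\<Lambda>. 1) \<in> carrier A"
  using subfield_1[OF fixed_subfield] by auto

lemma val_simps:
  assumes b: "b \<in> carrier A" "b' \<in> carrier A" and p: "p \<in> P"
  shows "val (\<lambda>q\<in>\<Lambda>. b q + b' q) p = val b p + val b' p"
    and "val (\<lambda>q\<in>\<Lambda>. b q * b' q) p = val b p * val b' p"
    and "c \<in> \<rat> \<Longrightarrow> val (\<lambda>q\<in>\<Lambda>. c * b q) p = c * val b p"
    and "val (\<lambda>q\<in>\<Lambda>. 1) p = 1"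
proof -
  obtain q \<tau> where q: "q \<in> \<Lambda>" "\<tau> \<in> G" "p = act \<tau> q" by (rule point_cases[OF p])
  note qL = fixed_L[OF A_mem[OF b(1) q(1)]] fixed_L[OF A_mem[OF b(2) q(1)]]
  note v = val_act[OF b(1) q(1,2)] val_act[OF b(2) q(1,2)]
  show "val (\<lambda>q\<in>\<Lambda>. b q + b' q) p = val b p + val b' p"
    unfolding q(3) val_act[OF A_closed(1)[OF b] q(1,2)] v using q qL by (simp add: emb_add)
  show "val (\<lambda>q\<in>\<Lambda>. b q * b' q) p = val b p * val b' p"
    unfolding q(3) val_act[OF A_closed(2)[OF b] q(1,2)] v using q qL by (simp add: emb_mult)
  show "val (\<lambda>q\<in>\<Lambda>. 1) p = 1"
    unfolding q(3) val_act[OF A_one q(1,2)] using q by (simp add: emb_1)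
  assume c: "c \<in> \<rat>"
  hence cL: "c \<in> L" using subfield_Rats[OF Ls] by blast
  show "val (\<lambda>q\<in>\<Lambda>. c * b q) p = c * val b p"
    unfolding q(3) val_act[OF A_scale[OF b(1) c] q(1,2)] v
    using q qL cL c by (simp add: emb_mult emb_Rats[OF Ls])
qed

abbreviation "M \<equiv> field_algebra F \<times>\<times> A"

lemma M_simps:
  "carrier M = F \<times> carrier A" "(z, b) \<otimes>\<^bsub>M\<^esub> (z', b') = (z * z', \<lambda>q\<in>\<Lambda>. b q * b' q)" "\<one>\<^bsub>M\<^esub> = (1, \<lambda>q\<in>\<Lambda>. 1)"
  by (simp_all add: DirProd_def)

sublocale monoid_alg M "\<rat>"
proof (intro monoid_alg.intro monoid_alg_axioms.intro subfield_Rats_CC)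
  interpret A: comm_monoid A by (rule prod_field_comm_monoid) (rule fixed_subfield)
  show "comm_monoid M"
  proof (rule comm_monoidI)
    show "\<one>\<^bsub>M\<^esub> \<in> carrier M" using A.one_closed subfield_1[OF Fs] by (simp add: DirProd_def)
    fix x y z assume "x \<in> carrier M" "y \<in> carrier M" "z \<in> carrier M"
    thus "(x \<otimes>\<^bsub>M\<^esub> y) \<otimes>\<^bsub>M\<^esub> z = x \<otimes>\<^bsub>M\<^esub> (y \<otimes>\<^bsub>M\<^esub> z)"
      by (auto simp: DirProd_def)
  next
    fix x y assume "x \<in> carrier M" "y \<in> carrier M"
    thus "x \<otimes>\<^bsub>M\<^esub> y \<in> carrier M" "x \<otimes>\<^bsub>M\<^esub> y = y \<otimes>\<^bsub>M\<^esub> x"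
      using A.m_closed A.m_comm
      by (auto simp: DirProd_def subfield_mult[OF Fs] mult.commute simp del: prod_field_simps)
  next
    fix x assume "x \<in> carrier M"
    thus "\<one>\<^bsub>M\<^esub> \<otimes>\<^bsub>M\<^esub> x = x" using A.l_one by (auto simp: DirProd_def)
  qed
qed

abbreviation "S \<equiv> base_change_relations \<rat> F A"

lemma kappa_mult:
  assumes "p \<in> P" "x \<in> carrier M" "y \<in> carrier M"
  shows "\<kappa> p (x \<otimes>\<^bsub>M\<^esub> y) = \<kappa> p x * \<kappa> p y"
  using assms by (cases x; cases y) (simp add: M_simps \<kappa>_def val_simps(2) del: prod_field_simps(1))

lemma kappa_one: "p \<in> P \<Longrightarrow> \<kappa> p \<one>\<^bsub>M\<^esub> = 1"
  by (simp add: M_simps \<kappa>_def val_simps(4)[OF A_one A_one] del: prod_field_simps(1))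

lemma relation_cases:
  assumes "t \<in> S"
  obtains x y b where "x \<in> F" "y \<in> F" "b \<in> carrier A" "t = single (x + y, b) 1 - single (x, b) 1 - single (y, b) 1"
  | x b b' where "x \<in> F" "b \<in> carrier A" "b' \<in> carrier A" "t = single (x, \<lambda>q\<in>\<Lambda>. b q + b' q) 1 - single (x, b) 1 - single (x, b') 1"
  | c x b where "c \<in> \<rat>" "x \<in> F" "b \<in> carrier A" "t = single (c * x, b) 1 - single (x, b) c"
  | c x b where "c \<in> \<rat>" "x \<in> F" "b \<in> carrier A" "t = single (x, \<lambda>q\<in>\<Lambda>. c * b q) 1 - single (x, b) c"
  using assms unfolding base_change_relations_def prod_field_simps(4,5) by (elim UnE CollectE exE conjE) blast+

lemma relation_mem:
  "x \<in> F \<Longrightarrow> y \<in> F \<Longrightarrow> b \<in> carrier A \<Longrightarrow> single (x + y, b) 1 - single (x, b) 1 - single (y, b) 1 \<in> S"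
  "x \<in> F \<Longrightarrow> b \<in> carrier A \<Longrightarrow> b' \<in> carrier A \<Longrightarrow> single (x, \<lambda>q\<in>\<Lambda>. b q + b' q) 1 - single (x, b) 1 - single (x, b') 1 \<in> S"
  "c \<in> \<rat> \<Longrightarrow> x \<in> F \<Longrightarrow> b \<in> carrier A \<Longrightarrow> single (c * x, b) 1 - single (x, b) c \<in> S"
  "c \<in> \<rat> \<Longrightarrow> x \<in> F \<Longrightarrow> b \<in> carrier A \<Longrightarrow> single (x, \<lambda>q\<in>\<Lambda>. c * b q) 1 - single (x, b) c \<in> S"
  unfolding base_change_relations_def prod_field_simps(4,5) by blast+

lemma single_M: "x \<in> F \<Longrightarrow> b \<in> carrier A \<Longrightarrow> c \<in> \<rat> \<Longrightarrow> single (x, b) c \<in> carrier R"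
  by (rule single_carrier) (simp_all add: M_simps del: prod_field_simps)

lemma S_carrier: "S \<subseteq> carrier R"
proof
  fix t assume "t \<in> S"
  have cF: "c * x \<in> F" if "c \<in> \<rat>" "x \<in> F" for c x
    using that subfield_Rats[OF Fs] subfield_mult[OF Fs] by blast
  from \<open>t \<in> S\<close> show "t \<in> carrier R"
  proof (cases rule: relation_cases)
    case (1 x y b)
    thus ?thesis using subfield_add[OF Fs] by (auto intro!: diff_carrier single_M simp del: prod_field_simps)
  next
    case (2 x b b')
    thus ?thesis using A_closed(1) by (auto intro!: diff_carrier single_M simp del: prod_field_simps)
  next
    case (3 c x b)
    thus ?thesis using cF by (auto intro!: diff_carrier single_M simp del: prod_field_simps)
  next
    case (4 c x b)
    thus ?thesis using A_scale by (auto intro!: diff_carrier single_M simp del: prod_field_simps)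
  qed
qed

lemma S_vanish:
  assumes "t \<in> S" "p \<in> P"
  shows "lin (\<kappa> p) t = 0"
proof -
  have d: "lin \<psi> (single x c - single y c') = c * \<psi> x - c' * \<psi> y"
    "lin \<psi> (single x c - single y c' - single z c'') = c * \<psi> x - c' * \<psi> y - c'' * \<psi> z" for \<psi> x y z c c' c''
  proof -
    show 1: "lin \<psi> (single x c - single y c') = c * \<psi> x - c' * \<psi> y"
      by (subst lin_diff[OF single_supp(2) single_supp(2)]) simp
    have "finite {w. (single x c - single y c') w \<noteq> 0}"
      by (rule finite_subset[of _ "{x, y}"]) (auto simp: single_def)
    thus "lin \<psi> (single x c - single y c' - single z c'') = c * \<psi> x - c' * \<psi> y - c'' * \<psi> z"
      by (subst lin_diff[OF _ single_supp(2)]) (simp_all add: 1)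
  qed
  from assms(1) show ?thesis
    by (cases rule: relation_cases)
      (simp_all add: d \<kappa>_def val_simps assms(2) algebra_simps del: prod_field_simps)
qed


text \<open>A family that separates the identity of \<open>F\<close> filters a sum over all automorphisms of \<open>L\<close>: only the
  automorphisms that restrict to the identity of \<open>F\<close> remain.\<close>

lemma family_average:
  obtains n :: nat and x y where "\<And>j. j < n \<Longrightarrow> x j \<in> F" "\<And>j. j < n \<Longrightarrow> y j \<in> F"
    "\<And>g. (\<Sum>j<n. y j * (\<Sum>\<sigma>\<in>G. \<sigma> (x j) * g \<sigma>)) =
      (\<Sum>\<sigma>\<in>{\<sigma>\<in>G. \<forall>z\<in>F. \<sigma> z = z}. g \<sigma>) / of_nat (card {\<sigma>\<in>G. \<forall>z\<in>F. \<sigma> z = z})"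
proof -
  let ?H = "{\<sigma>\<in>G. \<forall>z\<in>F. \<sigma> z = z}"
  define c :: complex where "c = inverse (of_nat (card ?H))"
  have c: "c \<in> F" unfolding c_def by (intro subfield_inverse subfield_of_nat Fs)
  have img: "\<sigma> ` F \<subseteq> F" if "\<sigma> \<in> embeddings F" for \<sigma>
    using galois_emb_mem[OF F that] by blast
  obtain n and x y :: "nat \<Rightarrow> complex" where xy: "\<And>j. j < n \<Longrightarrow> x j \<in> F" "\<And>j. j < n \<Longrightarrow> y j \<in> F"
    "\<And>\<sigma>. \<sigma> \<in> embeddings F \<Longrightarrow> (\<Sum>j<n. y j * \<sigma> (x j)) = (if \<sigma> = (\<lambda>x\<in>F. x) then 1 else 0)"
    by (rule separating_family[OF Fs embeddings_finite[OF galois_number_field[OF F]] subset_refl img emb_id[OF Fs]], assumption, rule that)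
  have sep: "(\<Sum>j<n. y j * \<sigma> (x j)) = (if \<forall>z\<in>F. \<sigma> z = z then 1 else 0)" if \<sigma>: "\<sigma> \<in> G" for \<sigma>
  proof -
    have "restrict \<sigma> F = (\<lambda>x\<in>F. x) \<longleftrightarrow> (\<forall>z\<in>F. \<sigma> z = z)"
      by (auto simp: fun_eq_iff restrict_def)
    moreover have "(\<Sum>j<n. y j * restrict \<sigma> F (x j)) = (\<Sum>j<n. y j * \<sigma> (x j))"
      using xy(1) by (intro sum.cong) auto
    ultimately show ?thesis using xy(3)[OF emb_restrict[OF Ls \<sigma> FL Fs]] by simp
  qed
  show thesis
  proof (rule that[of n x "\<lambda>j. c * y j"])
    show "c * y j \<in> F" if "j < n" for j using xy(2)[OF that] c by (intro subfield_mult Fs)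
    fix g :: "(complex \<Rightarrow> complex) \<Rightarrow> complex"
    have "(\<Sum>j<n. c * y j * (\<Sum>\<sigma>\<in>G. \<sigma> (x j) * g \<sigma>)) = (\<Sum>j<n. \<Sum>\<sigma>\<in>G. c * (g \<sigma> * (y j * \<sigma> (x j))))"
      unfolding sum_distrib_left by (simp add: mult_ac)
    also have "\<dots> = (\<Sum>\<sigma>\<in>G. c * (g \<sigma> * (\<Sum>j<n. y j * \<sigma> (x j))))"
      by (subst sum.swap) (simp add: sum_distrib_left)
    also have "\<dots> = (\<Sum>\<sigma>\<in>G. if \<forall>z\<in>F. \<sigma> z = z then c * g \<sigma> else 0)"
      by (intro sum.cong refl) (simp add: sep)
    also have "\<dots> = (\<Sum>\<sigma>\<in>?H. c * g \<sigma>)"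
      by (rule sum.inter_filter[OF G_finite, symmetric])
    also have "\<dots> = (\<Sum>\<sigma>\<in>?H. g \<sigma>) / of_nat (card ?H)"
      unfolding c_def divide_inverse sum_distrib_right by (simp only: mult.commute)
    finally show "(\<Sum>j<n. c * y j * (\<Sum>\<sigma>\<in>G. \<sigma> (x j) * g \<sigma>)) = (\<Sum>\<sigma>\<in>?H. g \<sigma>) / of_nat (card ?H)" .
  qed (use xy(1) in auto)
qed

lemma average_nonzero: "of_nat (card {\<sigma>\<in>G. \<forall>z\<in>F. \<sigma> z = z}) \<noteq> (0::complex)"
proof -
  have "(\<lambda>x\<in>L. x) \<in> {\<sigma>\<in>G. \<forall>z\<in>F. \<sigma> z = z}" using emb_id[OF Ls] FL by auto
  thus ?thesis using G_finite by (auto simp: card_eq_0_iff)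
qed

lemma lin_values:
  assumes f: "f \<in> carrier R" and p: "p \<in> P"
  shows "lin (\<kappa> p) f \<in> L"
    and "\<sigma> \<in> G \<Longrightarrow> \<sigma> (lin (\<kappa> p) f) = lin (\<lambda>zb. \<sigma> (fst zb) * val (snd zb) (act \<sigma> p)) f"
proof -
  have mem: "f m \<in> \<rat>" "f m \<in> L" "f m \<noteq> 0 \<Longrightarrow> fst m \<in> F" "f m \<noteq> 0 \<Longrightarrow> snd m \<in> carrier A" for m
    using carrierD(1)[OF f, of m] carrierD(3)[OF f, of m] subfield_Rats[OF Ls] by (cases m; auto simp: M_simps)+
  have kL: "\<kappa> p m \<in> L" if "f m \<noteq> 0" for m
    unfolding \<kappa>_def using mem[of m] that FL p by (intro subfield_mult[OF Ls] val_mem) auto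
  show "lin (\<kappa> p) f \<in> L"
    unfolding lin_def using kL mem(2) by (intro subfield_sum[OF Ls] subfield_mult[OF Ls]) auto
  assume \<sigma>: "\<sigma> \<in> G"
  have "\<sigma> (lin (\<kappa> p) f) = (\<Sum>m | f m \<noteq> 0. \<sigma> (f m * \<kappa> p m))"
    unfolding lin_def using kL mem(2) by (intro emb_sum[OF Ls \<sigma>] subfield_mult[OF Ls]) auto
  also have "\<dots> = (\<Sum>m | f m \<noteq> 0. f m * (\<sigma> (fst m) * val (snd m) (act \<sigma> p)))"
  proof (rule sum.cong[OF refl])
    fix m assume "m \<in> {m. f m \<noteq> 0}"
    hence m: "f m \<noteq> 0" by simp
    have b: "snd m \<in> carrier A" "fst m \<in> L" "val (snd m) p \<in> L"
      using mem(3,4)[OF m] FL p val_mem by blast+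
    show "\<sigma> (f m * \<kappa> p m) = f m * (\<sigma> (fst m) * val (snd m) (act \<sigma> p))"
      unfolding emb_mult[OF \<sigma> mem(2) kL[OF m]] emb_Rats[OF Ls \<sigma> mem(1)] val_equivariant[OF b(1) p \<sigma>]
      unfolding \<kappa>_def emb_mult[OF \<sigma> b(2,3)] ..
  qed
  finally show "\<sigma> (lin (\<kappa> p) f) = lin (\<lambda>zb. \<sigma> (fst zb) * val (snd zb) (act \<sigma> p)) f"
    unfolding lin_def .
qed

text \<open>The family of \<open>family_average\<close> gives \<open>z = \<Sum>\<^sub>j y\<^sub>j Tr(x\<^sub>j z)\<close> for \<open>z \<in> F\<close>, up to a factor. So \<open>f\<close> is
  congruent to \<open>\<Sum>\<^sub>j y\<^sub>j \<otimes> b\<^sub>j\<close> where \<open>b\<^sub>j\<close> is obtained from \<open>f\<close> by replacing every \<open>z \<otimes> b\<close> by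
  \<open>Tr(x\<^sub>j z) b\<close>. Expanding the trace, \<open>b\<^sub>j\<close> is a combination of conjugates of the values of \<open>f\<close>.\<close>

lemma base_change_kernel:
  assumes f: "f \<in> carrier R" and J: "ideal J R" "S \<subseteq> J" and vanish: "\<And>p. p \<in> P \<Longrightarrow> lin (\<kappa> p) f = 0"
  shows "f \<in> J"
proof -
  let ?H = "{\<sigma>\<in>G. \<forall>z\<in>F. \<sigma> z = z}"
  obtain n :: nat and x y where xy: "\<And>j. j < n \<Longrightarrow> x j \<in> F" "\<And>j. j < n \<Longrightarrow> y j \<in> F"
    "\<And>g. (\<Sum>j<n. y j * (\<Sum>\<sigma>\<in>G. \<sigma> (x j) * g \<sigma>)) = (\<Sum>\<sigma>\<in>?H. g \<sigma>) / of_nat (card ?H)"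
    by (rule family_average, rule that)
  define t where "t j z = (\<Sum>\<sigma>\<in>G. \<sigma> (x j * z))" for j z
  have t_Rats: "t j z \<in> \<rat>" if "j < n" "z \<in> F" for j z
    unfolding t_def using xy(1)[OF that(1)] that(2) FL subfield_mult[OF Ls]
    by (intro galois_trace_Rats[OF L]) auto
  have t_expand: "t j z = (\<Sum>\<sigma>\<in>G. \<sigma> (x j) * \<sigma> z)" if "j < n" "z \<in> F" for j z
    unfolding t_def
  proof (rule sum.cong[OF refl])
    fix \<sigma> assume "\<sigma> \<in> G"
    thus "\<sigma> (x j * z) = \<sigma> (x j) * \<sigma> z"
      using xy(1)[OF that(1)] that(2) FL by (intro emb_mult[of \<sigma> L]) auto
  qed
  have t_scale: "t j (c * z) = c * t j z" if "j < n" "z \<in> F" "c \<in> \<rat>" for j z c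
  proof -
    have cL: "c \<in> L" using that(3) subfield_Rats[OF Ls] by blast
    have zL: "x j * z \<in> L" using xy(1)[OF that(1)] that(2) FL subfield_mult[OF Ls] by blast
    have "\<sigma> (x j * (c * z)) = c * \<sigma> (x j * z)" if "\<sigma> \<in> G" for \<sigma>
      using emb_mult[OF that cL zL] emb_Rats[OF Ls that \<open>c \<in> \<rat>\<close>] by (simp add: mult_ac)
    thus ?thesis unfolding t_def sum_distrib_left by (intro sum.cong refl)
  qed
  have recon: "z = (\<Sum>j<n. y j * t j z)" if z: "z \<in> F" for z
  proof -
    have "(\<Sum>j<n. y j * t j z) = (\<Sum>j<n. y j * (\<Sum>\<sigma>\<in>G. \<sigma> (x j) * \<sigma> z))"
      using z by (intro sum.cong refl) (simp add: t_expand)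
    also have "\<dots> = (\<Sum>\<sigma>\<in>?H. \<sigma> z) / of_nat (card ?H)" by (rule xy(3))
    also have "(\<Sum>\<sigma>\<in>?H. \<sigma> z) = (\<Sum>\<sigma>\<in>?H. z)" using z by (intro sum.cong) auto
    also have "\<dots> / of_nat (card ?H) = z" using average_nonzero by simp
    finally show ?thesis by simp
  qed
  define \<l> where "\<l> j f = (\<lambda>q\<in>\<Lambda>. lin (\<lambda>zb. t j (fst zb) * snd zb q) f)" for j f
  define D where "D f \<longleftrightarrow> f - (\<lambda>m. \<Sum>j<n. single (y j, \<l> j f) 1 m) \<in> J" for f
  have supp: "fst m \<in> F" "snd m \<in> carrier A" if "f \<in> carrier R" "f m \<noteq> 0" for f m
    using carrierD(3)[OF that] by (cases m; auto simp: M_simps)+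
  have l_A: "\<l> j f \<in> carrier A" if "j < n" "f \<in> carrier R" for j f
  proof -
    have "lin (\<lambda>zb. t j (fst zb) * snd zb q) f \<in> fixed q" if q: "q \<in> \<Lambda>" for q
      unfolding lin_def
    proof (intro subfield_sum subfield_mult fixed_subfield)
      fix m assume "m \<in> {m. f m \<noteq> 0}"
      hence m: "f m \<noteq> 0" by simp
      show "f m \<in> fixed q" using carrierD(1)[OF \<open>f \<in> carrier R\<close>] subfield_Rats[OF fixed_subfield] by blast
      show "t j (fst m) \<in> fixed q"
        using t_Rats[OF \<open>j < n\<close> supp(1)[OF \<open>f \<in> carrier R\<close> m]] subfield_Rats[OF fixed_subfield] by blast
      show "snd m q \<in> fixed q" by (rule A_mem[OF supp(2)[OF \<open>f \<in> carrier R\<close> m] q])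
    qed
    thus ?thesis by (auto simp: \<l>_def)
  qed
  \<comment> \<open>The rest is a calculation with the congruence \<open>f - g \<in> J\<close>, which is compatible with sums.\<close>
  have refl: "f - f \<in> J" for f :: "complex \<times> ('p \<Rightarrow> complex) \<Rightarrow> complex"
    using ideal_0[OF J(1)] by (simp add: fun_diff_def)
  have sym: "g - f \<in> J" if "f - g \<in> J" for f g
    using ideal_diff[OF J(1) refl[of f] that] by (simp add: fun_diff_def)
  have trans: "f - h \<in> J" if "f - g \<in> J" "g - h \<in> J" for f g h
    using ideal_add[OF J(1) that] by (simp add: fun_diff_def)
  have add: "(\<lambda>m. f m + g m) - (\<lambda>m. f' m + g' m) \<in> J" if "f - f' \<in> J" "g - g' \<in> J" for f g f' g'
  proof -
    have "(\<lambda>m. f m + g m) - (\<lambda>m. f' m + g' m) = (\<lambda>m. (f - f') m + (g - g') m)" by (simp add: fun_eq_iff)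
    thus ?thesis using ideal_add[OF J(1) that] by simp
  qed
  have sum: "(\<lambda>m. \<Sum>i\<in>I. f i m) - (\<lambda>m. \<Sum>i\<in>I. g i m) \<in> J" if "\<And>i. i \<in> I \<Longrightarrow> f i - g i \<in> J"
    for I :: "nat set" and f g
  proof -
    have "(\<lambda>m. \<Sum>i\<in>I. f i m) - (\<lambda>m. \<Sum>i\<in>I. g i m) = (\<lambda>m. \<Sum>i\<in>I. (f i - g i) m)"
      by (simp add: fun_eq_iff sum_subtractf)
    thus ?thesis using ideal_sum[OF J(1), of I "\<lambda>i. f i - g i"] that by simp
  qed
  have rel_add1: "single (z + z', b) 1 - (\<lambda>m. single (z, b) 1 m + single (z', b) 1 m) \<in> J"
    if "z \<in> F" "z' \<in> F" "b \<in> carrier A" for z z' b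
    using relation_mem(1)[OF that] J(2) by (auto simp: fun_diff_def algebra_simps)
  have rel_add2: "single (z, \<lambda>q\<in>\<Lambda>. b q + b' q) 1 - (\<lambda>m. single (z, b) 1 m + single (z, b') 1 m) \<in> J"
    if "z \<in> F" "b \<in> carrier A" "b' \<in> carrier A" for z b b'
    using relation_mem(2)[OF that] J(2) by (auto simp: fun_diff_def algebra_simps)
  have rel3: "single (c * z, b) 1 - single (z, b) c \<in> J" if "c \<in> \<rat>" "z \<in> F" "b \<in> carrier A" for c z b
    using relation_mem(3)[OF that] J(2) by blast
  have rel4: "single (z, \<lambda>q\<in>\<Lambda>. c * b q) 1 - single (z, b) c \<in> J" if "c \<in> \<rat>" "z \<in> F" "b \<in> carrier A" for c z b
    using relation_mem(4)[OF that] J(2) by blast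
  have single_0: "single m 0 = (\<lambda>_. 0)" for m :: "complex \<times> ('p \<Rightarrow> complex)"
    by (simp add: single_def fun_eq_iff)
  have split_sum: "single (\<Sum>j\<in>T. u j, b) 1 - (\<lambda>m. \<Sum>j\<in>T. single (u j, b) 1 m) \<in> J"
    if "finite T" "\<And>j. j \<in> T \<Longrightarrow> u j \<in> F" "b \<in> carrier A" for T :: "nat set" and u b
    using that(1,2)
  proof (induction T rule: finite_induct)
    case empty
    show ?case using rel3[of 0 1 b] subfield_1[OF Fs] that(3) by (simp add: single_0 fun_diff_def)
  next
    case (insert j T)
    have uT: "(\<Sum>j\<in>T. u j) \<in> F" using insert.prems by (intro subfield_sum[OF Fs]) auto
    have "single (u j + (\<Sum>j\<in>T. u j), b) 1 - (\<lambda>m. single (u j, b) 1 m + single (\<Sum>j\<in>T. u j, b) 1 m) \<in> J"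
      using insert.prems uT that(3) by (intro rel_add1) auto
    moreover have "(\<lambda>m. single (u j, b) 1 m + single (\<Sum>j\<in>T. u j, b) 1 m) -
        (\<lambda>m. single (u j, b) 1 m + (\<Sum>j\<in>T. single (u j, b) 1 m)) \<in> J"
      using insert.prems by (intro add refl insert.IH) auto
    ultimately show ?case unfolding sum.insert[OF insert.hyps] by (rule trans)
  qed
  have D_single: "D (single (z, b) c)" if z: "z \<in> F" and b: "b \<in> carrier A" and c: "c \<in> \<rat>" for z b c
  proof -
    have czF: "c * z \<in> F" using z c subfield_Rats[OF Fs] subfield_mult[OF Fs] by blast
    have "single (z, b) c - single (c * z, b) 1 \<in> J" by (rule sym[OF rel3[OF c z b]])
    moreover have "single (c * z, b) 1 - (\<lambda>m. \<Sum>j<n. single (t j (c * z) * y j, b) 1 m) \<in> J"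
    proof -
      have "single (\<Sum>j<n. t j (c * z) * y j, b) 1 - (\<lambda>m. \<Sum>j<n. single (t j (c * z) * y j, b) 1 m) \<in> J"
        using t_Rats[OF _ czF] xy(2) b subfield_Rats[OF Fs]
        by (intro split_sum) (auto intro!: subfield_mult[OF Fs])
      also have "(\<Sum>j<n. t j (c * z) * y j) = c * z" using recon[OF czF] by (simp add: mult.commute)
      finally show ?thesis .
    qed
    moreover have "(\<lambda>m. \<Sum>j<n. single (t j (c * z) * y j, b) 1 m) -
        (\<lambda>m. \<Sum>j<n. single (y j, \<l> j (single (z, b) c)) 1 m) \<in> J"
    proof (rule sum)
      fix j assume "j \<in> {..<n}"
      hence j: "j < n" by simp
      have "single (t j (c * z) * y j, b) 1 - single (y j, b) (t j (c * z)) \<in> J"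
        by (rule rel3[OF t_Rats[OF j czF] xy(2)[OF j] b])
      moreover have "single (y j, b) (t j (c * z)) - single (y j, \<lambda>q\<in>\<Lambda>. t j (c * z) * b q) 1 \<in> J"
        by (rule sym[OF rel4[OF t_Rats[OF j czF] xy(2)[OF j] b]])
      moreover have "(\<lambda>q\<in>\<Lambda>. t j (c * z) * b q) = \<l> j (single (z, b) c)"
        by (simp add: \<l>_def t_scale[OF j z c] mult_ac)
      ultimately show "single (t j (c * z) * y j, b) 1 - single (y j, \<l> j (single (z, b) c)) 1 \<in> J"
        using trans by metis
    qed
    ultimately show ?thesis unfolding D_def using trans by blast
  qed
  have D_add: "D (\<lambda>m. f m + g m)" if f: "f \<in> carrier R" "D f" and g: "g \<in> carrier R" "D g" for f g
  proof -
    have "(\<lambda>m. f m + g m) - (\<lambda>m. (\<Sum>j<n. single (y j, \<l> j f) 1 m) + (\<Sum>j<n. single (y j, \<l> j g) 1 m)) \<in> J"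
      using f(2) g(2) unfolding D_def by (rule add)
    moreover have "(\<lambda>m. (\<Sum>j<n. single (y j, \<l> j f) 1 m) + (\<Sum>j<n. single (y j, \<l> j g) 1 m)) -
      (\<lambda>m. \<Sum>j<n. single (y j, \<l> j (\<lambda>m. f m + g m)) 1 m) \<in> J"
      unfolding sum.distrib[symmetric]
    proof (rule sum)
      fix j assume "j \<in> {..<n}"
      hence j: "j < n" by simp
      have "\<l> j (\<lambda>m. f m + g m) = (\<lambda>q\<in>\<Lambda>. \<l> j f q + \<l> j g q)"
        by (auto simp: \<l>_def lin_carrier_add[OF f(1) g(1)])
      thus "(\<lambda>m. single (y j, \<l> j f) 1 m + single (y j, \<l> j g) 1 m) - single (y j, \<l> j (\<lambda>m. f m + g m)) 1 \<in> J"
        using sym[OF rel_add2[OF xy(2)[OF j] l_A[OF j f(1)] l_A[OF j g(1)]]] by simp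
    qed
    ultimately show ?thesis unfolding D_def by (rule trans)
  qed
  have Df: "D f"
  proof (rule carrier_induct[OF f])
    fix m and c :: complex assume "m \<in> carrier M" "c \<in> \<rat>"
    thus "D (single m c)" by (cases m) (auto simp: M_simps intro!: D_single simp del: prod_field_simps)
  qed (rule D_add)
  have l_0: "\<l> j f = (\<lambda>q\<in>\<Lambda>. 0)" if j: "j < n" for j
    unfolding \<l>_def
  proof (rule restrict_ext)
    fix q assume q: "q \<in> \<Lambda>"
    have qP: "q \<in> P" using q \<Lambda> by blast
    have conj: "lin (\<lambda>zb. \<sigma> (fst zb) * snd zb q) f = 0" if \<sigma>: "\<sigma> \<in> G" for \<sigma>
    proof -
      obtain \<sigma>' where \<sigma>': "\<sigma>' \<in> G" "compose L \<sigma>' \<sigma> = (\<lambda>x\<in>L. x)" "compose L \<sigma> \<sigma>' = (\<lambda>x\<in>L. x)"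
        by (rule galois_inverse[OF L \<sigma>])
      have p: "act \<sigma>' q \<in> P" by (rule act_closed[OF \<sigma>'(1) qP])
      have "0 = \<sigma> (lin (\<kappa> (act \<sigma>' q)) f)" using vanish[OF p] emb_0[OF Ls \<sigma>] by simp
      also have "\<dots> = lin (\<lambda>zb. \<sigma> (fst zb) * val (snd zb) q) f"
        unfolding lin_values(2)[OF f p \<sigma>] act_inverse[OF \<sigma>'(1) \<sigma> \<sigma>'(3) qP] ..
      also have "\<dots> = lin (\<lambda>zb. \<sigma> (fst zb) * snd zb q) f"
      proof (rule lin_cong)
        fix m assume "f m \<noteq> 0"
        hence b: "snd m \<in> carrier A" by (rule supp(2)[OF f])
        have "val (snd m) q = snd m q"
          using val_act[OF b q emb_id[OF Ls]] act_id[OF qP] fixed_L[OF A_mem[OF b q]] by simp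
        thus "\<sigma> (fst m) * val (snd m) q = \<sigma> (fst m) * snd m q" by simp
      qed
      finally show ?thesis by simp
    qed
    have "lin (\<lambda>zb. t j (fst zb) * snd zb q) f = lin (\<lambda>zb. \<Sum>\<sigma>\<in>G. \<sigma> (x j) * (\<sigma> (fst zb) * snd zb q)) f"
      using supp(1)[OF f] by (intro lin_cong) (simp add: t_expand[OF j] sum_distrib_right sum_distrib_left mult_ac)
    also have "\<dots> = (\<Sum>\<sigma>\<in>G. \<sigma> (x j) * lin (\<lambda>zb. \<sigma> (fst zb) * snd zb q) f)"
      by (simp only: lin_sum_left lin_mult_left)
    also have "\<dots> = 0" by (simp add: conj)
    finally show "lin (\<lambda>zb. t j (fst zb) * snd zb q) f = 0" .
  qed
  have "(\<lambda>m. \<Sum>j<n. single (y j, \<l> j f) 1 m) - (\<lambda>m. \<Sum>j<n. (\<lambda>_. 0) m) \<in> J"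
  proof (rule sum)
    fix j assume "j \<in> {..<n}"
    thus "single (y j, \<l> j f) 1 - (\<lambda>_. 0) \<in> J"
      using rel4[OF Rats_0 xy(2)[of j] A_one] l_0[of j] by (simp add: single_0 fun_diff_def)
  qed
  from trans[OF Df[unfolded D_def] this] show ?thesis by (simp add: fun_diff_def)
qed

text \<open>The average of \<open>x\<^sub>j f\<close> over all automorphisms is equivariant under all of them, and weighting these averages
  by the \<open>y\<^sub>j\<close> leaves the average over the automorphisms fixing \<open>F\<close>, under which \<open>f\<close> is invariant.\<close>

lemma equivariant_eq_combination:
  assumes f: "f \<in> E"
  obtains n :: nat and y b where "\<And>j. j < n \<Longrightarrow> y j \<in> F" "\<And>j. j < n \<Longrightarrow> b j \<in> carrier A"
    "\<And>p. p \<in> P \<Longrightarrow> f p = (\<Sum>j<n. y j * val (b j) p)"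
proof -
  let ?H = "{\<sigma>\<in>G. \<forall>z\<in>F. \<sigma> z = z}"
  obtain n :: nat and x y where xy: "\<And>j. j < n \<Longrightarrow> x j \<in> F" "\<And>j. j < n \<Longrightarrow> y j \<in> F"
    "\<And>g. (\<Sum>j<n. y j * (\<Sum>\<sigma>\<in>G. \<sigma> (x j) * g \<sigma>)) = (\<Sum>\<sigma>\<in>?H. g \<sigma>) / of_nat (card ?H)"
    by (rule family_average, rule that)
  interpret G: group "gal_group L" by (rule gal_group_group[OF L])
  define iv where "iv \<sigma> = inv\<^bsub>gal_group L\<^esub> \<sigma>" for \<sigma>
  note G_eq = carrier_gal_group[OF L]
  have iv: "iv \<sigma> \<in> G" "compose L (iv \<sigma>) \<sigma> = (\<lambda>x\<in>L. x)" "compose L \<sigma> (iv \<sigma>) = (\<lambda>x\<in>L. x)" if "\<sigma> \<in> G" for \<sigma>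
    using G.inv_closed[of \<sigma>] G.l_inv[of \<sigma>] G.r_inv[of \<sigma>] that
    by (simp_all add: iv_def G_eq gal_group_mult gal_group_one)
  have iv_compose: "iv (compose L \<sigma> \<tau>) = compose L (iv \<tau>) (iv \<sigma>)" if "\<sigma> \<in> G" "\<tau> \<in> G" for \<sigma> \<tau>
    using G.inv_mult_group[of \<sigma> \<tau>] that by (simp add: iv_def G_eq gal_group_mult)
  have fL: "f p \<in> L" if "p \<in> P" for p using f that by (simp add: E_def)
  define b where "b j p = (\<Sum>\<sigma>\<in>G. \<sigma> (x j * f (act (iv \<sigma>) p)))" for j p
  have mem: "x j * f (act (iv \<sigma>) p) \<in> L" if "j < n" "p \<in> P" "\<sigma> \<in> G" for j p \<sigma>
  proof (rule subfield_mult[OF Ls])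
    show "x j \<in> L" using xy(1)[OF that(1)] FL by blast
    show "f (act (iv \<sigma>) p) \<in> L" by (rule fL[OF act_closed[OF iv(1)[OF that(3)] that(2)]])
  qed
  have bL: "b j p \<in> L" if "j < n" "p \<in> P" for j p
    unfolding b_def by (rule subfield_sum[OF Ls G_mem[OF _ mem[OF that]]])
  have b_equi: "b j (act \<tau> p) = \<tau> (b j p)" if j: "j < n" and \<tau>: "\<tau> \<in> G" and p: "p \<in> P" for j \<tau> p
  proof -
    have "b j (act \<tau> p) = (\<Sum>\<sigma>\<in>G. compose L \<tau> \<sigma> (x j * f (act (iv (compose L \<tau> \<sigma>)) (act \<tau> p))))"
      unfolding b_def by (rule sum_embeddings_translate[OF L \<tau>, symmetric])
    also have "\<dots> = (\<Sum>\<sigma>\<in>G. \<tau> (\<sigma> (x j * f (act (iv \<sigma>) p))))"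
    proof (rule sum.cong[OF refl])
      fix \<sigma> assume \<sigma>: "\<sigma> \<in> G"
      have "act (iv (compose L \<tau> \<sigma>)) (act \<tau> p) = act (iv \<sigma>) (act (iv \<tau>) (act \<tau> p))"
        unfolding iv_compose[OF \<tau> \<sigma>] by (rule act_compose[OF iv(1)[OF \<sigma>] iv(1)[OF \<tau>] act_closed[OF \<tau> p]])
      also have "act (iv \<tau>) (act \<tau> p) = p" by (rule act_inverse[OF \<tau> iv(1,2)[OF \<tau>] p])
      finally show "compose L \<tau> \<sigma> (x j * f (act (iv (compose L \<tau> \<sigma>)) (act \<tau> p))) = \<tau> (\<sigma> (x j * f (act (iv \<sigma>) p)))"
        using mem[OF j p \<sigma>] by (simp add: compose_eq)
    qed
    also have "\<dots> = \<tau> (b j p)"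
      unfolding b_def by (rule emb_sum[OF Ls \<tau> G_mem[OF _ mem[OF j p]], symmetric])
    finally show ?thesis .
  qed
  show thesis
  proof (rule that[of n y "\<lambda>j. restrict (b j) \<Lambda>"])
    show "restrict (b j) \<Lambda> \<in> carrier A" if "j < n" for j
      by (rule equivariant_eq_val(1)) (use bL b_equi that in auto)
    fix p assume p: "p \<in> P"
    have "(\<Sum>j<n. y j * val (restrict (b j) \<Lambda>) p) = (\<Sum>j<n. y j * b j p)"
    proof (rule sum.cong[OF refl])
      fix j assume "j \<in> {..<n}"
      hence "val (restrict (b j) \<Lambda>) p = b j p"
        by (intro equivariant_eq_val(2)[OF _ _ p]) (use bL b_equi in auto)
      thus "y j * val (restrict (b j) \<Lambda>) p = y j * b j p" by simp
    qed
    also have "\<dots> = (\<Sum>j<n. y j * (\<Sum>\<sigma>\<in>G. \<sigma> (x j) * \<sigma> (f (act (iv \<sigma>) p))))"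
      unfolding b_def
    proof (intro sum.cong refl arg_cong2[of _ _ _ _ "(*)"])
      fix j \<sigma> assume "j \<in> {..<n}" and \<sigma>: "\<sigma> \<in> G"
      hence "x j \<in> L" using xy(1) FL by auto
      thus "\<sigma> (x j * f (act (iv \<sigma>) p)) = \<sigma> (x j) * \<sigma> (f (act (iv \<sigma>) p))"
        by (rule emb_mult[OF \<sigma> _ fL[OF act_closed[OF iv(1)[OF \<sigma>] p]]])
    qed
    also have "\<dots> = (\<Sum>\<sigma>\<in>?H. \<sigma> (f (act (iv \<sigma>) p))) / of_nat (card ?H)" by (rule xy(3))
    also have "(\<Sum>\<sigma>\<in>?H. \<sigma> (f (act (iv \<sigma>) p))) = (\<Sum>\<sigma>\<in>?H. f p)"
    proof (rule sum.cong[OF refl])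
      fix \<sigma> assume \<sigma>: "\<sigma> \<in> ?H"
      hence \<sigma>G: "\<sigma> \<in> G" by simp
      have "f (act \<sigma> (act (iv \<sigma>) p)) = \<sigma> (f (act (iv \<sigma>) p))"
        using f \<sigma> act_closed[OF iv(1)[OF \<sigma>G] p] by (simp add: E_def)
      thus "\<sigma> (f (act (iv \<sigma>) p)) = f p"
        using act_inverse[OF iv(1)[OF \<sigma>G] \<sigma>G iv(3)[OF \<sigma>G] p] by simp
    qed
    also have "\<dots> / of_nat (card ?H) = f p" using average_nonzero by simp
    finally show "f p = (\<Sum>j<n. y j * val (restrict (b j) \<Lambda>) p)" by (rule sym)
  qed (use xy(2) in auto)
qed

abbreviation "W \<equiv> base_change \<rat> F A"

theorem W_iso: "quotient_eval P \<kappa> \<in> algebra_iso F W (function_algebra P E)"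
  and W_representative: "Y \<in> carrier W \<Longrightarrow> (SOME f. f \<in> Y) \<in> carrier R"
proof -
  have image: "(\<lambda>f. \<lambda>p\<in>P. lin (\<kappa> p) f) ` carrier R = E"
  proof
    show "(\<lambda>f. \<lambda>p\<in>P. lin (\<kappa> p) f) ` carrier R \<subseteq> E"
    proof (rule image_subsetI)
      fix f assume f: "f \<in> carrier R"
      have "lin (\<kappa> (act \<sigma> p)) f = \<sigma> (lin (\<kappa> p) f)" if \<sigma>: "\<sigma> \<in> G" "\<forall>x\<in>F. \<sigma> x = x" and p: "p \<in> P" for \<sigma> p
      proof -
        have "fst m \<in> F" if "f m \<noteq> 0" for m
          using carrierD(3)[OF f that] by (cases m) (simp add: M_simps)
        thus ?thesis unfolding lin_values(2)[OF f p \<sigma>(1)] \<kappa>_def using \<sigma>(2) by (intro lin_cong) simp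
      qed
      thus "(\<lambda>p\<in>P. lin (\<kappa> p) f) \<in> E"
        unfolding E_def using lin_values(1)[OF f] act_closed by auto
    qed
    show "E \<subseteq> (\<lambda>f. \<lambda>p\<in>P. lin (\<kappa> p) f) ` carrier R"
    proof
      fix g assume g: "g \<in> E"
      obtain n :: nat and y b where yb: "\<And>j. j < n \<Longrightarrow> y j \<in> F" "\<And>j. j < n \<Longrightarrow> b j \<in> carrier A"
        "\<And>p. p \<in> P \<Longrightarrow> g p = (\<Sum>j<n. y j * val (b j) p)"
        by (rule equivariant_eq_combination[OF g], rule that)
      define f where "f = (\<lambda>m. \<Sum>j<n. single (y j, b j) 1 m)"
      have s: "single (y j, b j) 1 \<in> carrier R" if "j \<in> {..<n}" for j
        using yb that by (intro single_M) auto
      have f: "f \<in> carrier R" unfolding f_def by (rule sum_carrier) (rule s)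
      have "lin (\<kappa> p) f = g p" if "p \<in> P" for p
        unfolding f_def yb(3)[OF that] using lin_carrier_sum[of "{..<n}" "\<lambda>j. single (y j, b j) 1", OF s]
        by (simp add: \<kappa>_def)
      hence "(\<lambda>p\<in>P. lin (\<kappa> p) f) = g"
        using g by (intro extensionalityI[of _ P]) (auto simp: E_def)
      thus "g \<in> (\<lambda>f. \<lambda>p\<in>P. lin (\<kappa> p) f) ` carrier R" using f by blast
    qed
  qed
  have u: "single (c, \<one>\<^bsub>A\<^esub>) 1 \<in> carrier R" if "c \<in> F" for c
    using that A_one by (intro single_M) auto
  have u': "lin (\<kappa> p) (single (c, \<one>\<^bsub>A\<^esub>) 1) = c" if "c \<in> F" "p \<in> P" for c p
    using val_simps(4)[OF A_one A_one that(2)] by (simp add: \<kappa>_def)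
  note main = quotient_eval_iso[where P = P and \<kappa> = \<kappa> and S = S and F = F and u = "\<lambda>c. single (c, \<one>\<^bsub>A\<^esub>) 1",
      OF kappa_mult kappa_one S_carrier S_vanish base_change_kernel u u']
  show "quotient_eval P \<kappa> \<in> algebra_iso F W (function_algebra P E)"
    unfolding base_change_def image[symmetric] by (rule main(1))
  show "(SOME f. f \<in> Y) \<in> carrier R" if "Y \<in> carrier W"
    by (rule main(2)) (use that in \<open>simp_all add: base_change_def\<close>)
qed

text \<open>Sending \<open>act \<tau> q\<close> to the restriction of \<open>\<tau>\<close> identifies the orbit of \<open>q\<close> with the embeddings
  of the fixed field of its stabilizer.\<close>

lemma sum_field_trace:
  assumes b: "b \<in> carrier A"
  shows "(\<Sum>q\<in>\<Lambda>. field_trace \<rat> (fixed q) (b q)) = (\<Sum>p\<in>P. val b p)"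
proof -
  have orbit: "field_trace \<rat> (fixed q) (b q) = (\<Sum>p | p \<in> P \<and> (\<exists>\<tau>\<in>G. p = act \<tau> q). val b p)" if q: "q \<in> \<Lambda>" for q
  proof -
    have qP: "q \<in> P" using q \<Lambda> by blast
    have fixL: "fixed q \<subseteq> L" using fixed_L by blast
    define O' where "O' = {p. p \<in> P \<and> (\<exists>\<tau>\<in>G. p = act \<tau> q)}"
    have "\<forall>\<sigma>\<in>embeddings (fixed q). \<exists>\<tau>. \<tau> \<in> G \<and> (\<forall>x\<in>fixed q. \<tau> x = \<sigma> x)"
      using extend_embedding[OF galois_number_field[OF L] fixed_subfield fixL] by metis
    from bchoice[OF this] obtain ex where
      ex: "\<And>\<sigma>. \<sigma> \<in> embeddings (fixed q) \<Longrightarrow> ex \<sigma> \<in> G"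
        "\<And>\<sigma> x. \<sigma> \<in> embeddings (fixed q) \<Longrightarrow> x \<in> fixed q \<Longrightarrow> ex \<sigma> x = \<sigma> x" by blast
    have "bij_betw (\<lambda>\<sigma>. act (ex \<sigma>) q) (embeddings (fixed q)) O'"
      unfolding bij_betw_def
    proof
      show "inj_on (\<lambda>\<sigma>. act (ex \<sigma>) q) (embeddings (fixed q))"
      proof (rule inj_onI)
        fix \<sigma> \<tau> assume \<sigma>: "\<sigma> \<in> embeddings (fixed q)" and \<tau>: "\<tau> \<in> embeddings (fixed q)"
          and eq: "act (ex \<sigma>) q = act (ex \<tau>) q"
        show "\<sigma> = \<tau>"
        proof (rule embeddings_ext[OF \<sigma> \<tau>])
          fix x assume x: "x \<in> fixed q"
          show "\<sigma> x = \<tau> x"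
            using agree_on_fixed[OF qP ex(1)[OF \<sigma>] ex(1)[OF \<tau>] eq x] ex(2)[OF \<sigma> x] ex(2)[OF \<tau> x] by simp
        qed
      qed
      have "act \<tau> q \<in> (\<lambda>\<sigma>. act (ex \<sigma>) q) ` embeddings (fixed q)" if \<tau>: "\<tau> \<in> G" for \<tau>
      proof -
        define \<sigma> where "\<sigma> = restrict \<tau> (fixed q)"
        have \<sigma>: "\<sigma> \<in> embeddings (fixed q)" unfolding \<sigma>_def by (rule emb_restrict[OF Ls \<tau> fixL fixed_subfield])
        note \<rho> = ex(1)[OF \<sigma>]
        obtain \<rho>' where \<rho>': "\<rho>' \<in> G" "compose L \<rho>' (ex \<sigma>) = (\<lambda>x\<in>L. x)" "compose L (ex \<sigma>) \<rho>' = (\<lambda>x\<in>L. x)"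
          by (rule galois_inverse[OF L \<rho>])
        define H where "H = {\<sigma>\<in>G. act \<sigma> q = q}"
        interpret G: group "gal_group L" by (rule gal_group_group[OF L])
        have H: "subgroup H (gal_group L)"
        proof (rule G.subgroupI)
          show "H \<subseteq> carrier (gal_group L)" by (auto simp: H_def carrier_gal_group[OF L])
          have "(\<lambda>x\<in>L. x) \<in> H" using emb_id[OF Ls] act_id[OF qP] by (simp add: H_def)
          thus "H \<noteq> {}" by blast
          fix h assume h: "h \<in> H"
          hence hG: "h \<in> G" by (simp add: H_def)
          have inv: "inv\<^bsub>gal_group L\<^esub> h \<in> G" "compose L (inv\<^bsub>gal_group L\<^esub> h) h = (\<lambda>x\<in>L. x)"
            using G.inv_closed[of h] G.l_inv[of h] hG
            by (simp_all add: carrier_gal_group[OF L] gal_group_mult gal_group_one)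
          show "inv\<^bsub>gal_group L\<^esub> h \<in> H"
            using act_inverse[OF hG inv qP] h inv(1) by (simp add: H_def)
          fix h' assume "h' \<in> H"
          thus "h \<otimes>\<^bsub>gal_group L\<^esub> h' \<in> H"
            using h act_compose[OF _ _ qP] G_compose by (simp add: H_def gal_group_mult)
        qed
        have "compose L \<rho>' \<tau> \<in> H"
        proof (rule fixes_fixed_field_imp_mem[OF L H])
          show "compose L \<rho>' \<tau> \<in> carrier (gal_group L)"
            using G_compose[OF \<rho>'(1) \<tau>] by (simp add: carrier_gal_group[OF L])
          fix x assume xL: "x \<in> L" and "\<And>h. h \<in> H \<Longrightarrow> h x = x"
          hence x: "x \<in> fixed q" by (simp add: fixed_def H_def)
          have "\<tau> x = ex \<sigma> x" using ex(2)[OF \<sigma> x] x by (simp add: \<sigma>_def)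
          thus "compose L \<rho>' \<tau> x = x" using inverse_apply[OF \<rho>'(2) xL] xL by (simp add: compose_eq)
        qed
        hence "act \<rho>' (act \<tau> q) = q" using act_compose[OF \<rho>'(1) \<tau> qP] by (simp add: H_def)
        hence "act (ex \<sigma>) q = act \<tau> q"
          using act_inverse[OF \<rho>'(1) \<rho> \<rho>'(3) act_closed[OF \<tau> qP]] by simp
        thus ?thesis using \<sigma> by (metis imageI)
      qed
      thus "(\<lambda>\<sigma>. act (ex \<sigma>) q) ` embeddings (fixed q) = O'"
        using ex(1) act_closed[OF _ qP] unfolding O'_def by blast
    qed
    from sum.reindex_bij_betw[OF this, of "val b"]
    have "(\<Sum>\<sigma>\<in>embeddings (fixed q). val b (act (ex \<sigma>) q)) = (\<Sum>p\<in>O'. val b p)" .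
    moreover have "val b (act (ex \<sigma>) q) = \<sigma> (b q)" if "\<sigma> \<in> embeddings (fixed q)" for \<sigma>
      using val_act[OF b q ex(1)[OF that]] ex(2)[OF that A_mem[OF b q]] by simp
    moreover have "embeddings_over \<rat> (fixed q) = embeddings (fixed q)"
      using emb_Rats[OF fixed_subfield] by (auto simp: embeddings_over_def)
    ultimately show ?thesis by (simp add: field_trace_def O'_def)
  qed
  define rep where "rep p = (THE q. q \<in> \<Lambda> \<and> (\<exists>\<tau>\<in>G. p = act \<tau> q))" for p
  have rep: "rep p \<in> \<Lambda> \<and> (\<exists>\<tau>\<in>G. p = act \<tau> (rep p))" if "p \<in> P" for p
    unfolding rep_def by (rule theI'[OF reps[OF that]])
  have rep_eq: "{p. p \<in> P \<and> (\<exists>\<tau>\<in>G. p = act \<tau> q)} = {p \<in> P. rep p = q}" if "q \<in> \<Lambda>" for q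
    using rep reps that by blast
  have "(\<Sum>q\<in>\<Lambda>. field_trace \<rat> (fixed q) (b q)) = (\<Sum>q\<in>\<Lambda>. \<Sum>p\<in>{p \<in> P. rep p = q}. val b p)"
    by (intro sum.cong refl) (simp only: orbit rep_eq)
  also have "\<dots> = (\<Sum>p\<in>P. val b p)"
    using rep by (intro sum.group finite_P finite_subset[OF \<Lambda> finite_P]) auto
  finally show ?thesis .
qed

text \<open>If complex conjugation is central in the group, the fixed fields are stable under it, and the trace
  form becomes the standard Hermitian form on functions. It is symmetric because complex
  conjugation permutes the points.\<close>

theorem W_form:
  assumes real: "F \<subseteq> \<real>" and cnj_L: "\<And>x. x \<in> L \<Longrightarrow> cnj x \<in> L"
    and cnj_central: "\<And>\<sigma> x. \<sigma> \<in> G \<Longrightarrow> x \<in> L \<Longrightarrow> \<sigma> (cnj x) = cnj (\<sigma> x)"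
    and Y: "Y \<in> carrier W"
  shows "base_change_form A (\<lambda>b. \<Sum>q\<in>\<Lambda>. field_trace \<rat> (fixed q) (cnj (b q) * b q)) Y =
    (\<Sum>p\<in>P. quotient_eval P \<kappa> Y p * cnj (quotient_eval P \<kappa> Y p))"
proof -
  define \<iota> where "\<iota> = (\<lambda>x\<in>L. cnj x)"
  have \<iota>: "\<iota> \<in> G"
    using Ls by (auto simp: \<iota>_def embeddings_iff subfield_1 subfield_add subfield_mult)
  have cnj_A: "(\<lambda>q\<in>\<Lambda>. cnj (b q)) \<in> carrier A" if b: "b \<in> carrier A" for b
  proof -
    have "cnj (b q) \<in> fixed q" if "q \<in> \<Lambda>" for q
    proof -
      have bq: "b q \<in> fixed q" by (rule A_mem[OF b that])
      have "\<sigma> (cnj (b q)) = cnj (b q)" if "\<sigma> \<in> G" "act \<sigma> q = q" for \<sigma>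
        using cnj_central[OF that(1) fixed_L[OF bq]] bq that by (simp add: fixed_def)
      thus ?thesis using cnj_L[OF fixed_L[OF bq]] by (simp add: fixed_def)
    qed
    thus ?thesis by auto
  qed
  have val_cnj: "val (\<lambda>q\<in>\<Lambda>. cnj (b q)) p = cnj (val b p)" if b: "b \<in> carrier A" and p: "p \<in> P" for b p
  proof -
    obtain q \<tau> where q: "q \<in> \<Lambda>" "\<tau> \<in> G" "p = act \<tau> q" by (rule point_cases[OF p])
    show ?thesis unfolding q(3) val_act[OF b q(1,2)] val_act[OF cnj_A[OF b] q(1,2)]
      using q(1) cnj_central[OF q(2) fixed_L[OF A_mem[OF b q(1)]]] by simp
  qed
  define Q where "Q b = (\<Sum>q\<in>\<Lambda>. field_trace \<rat> (fixed q) (cnj (b q) * b q))" for b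
  have Q: "Q b = (\<Sum>p\<in>P. cnj (val b p) * val b p)" if b: "b \<in> carrier A" for b
  proof -
    have "Q b = (\<Sum>q\<in>\<Lambda>. field_trace \<rat> (fixed q) ((\<lambda>q\<in>\<Lambda>. (\<lambda>q\<in>\<Lambda>. cnj (b q)) q * b q) q))"
      unfolding Q_def by (intro sum.cong) auto
    also have "\<dots> = (\<Sum>p\<in>P. val (\<lambda>q\<in>\<Lambda>. (\<lambda>q\<in>\<Lambda>. cnj (b q)) q * b q) p)"
      by (rule sum_field_trace[OF A_closed(2)[OF cnj_A[OF b] b]])
    also have "\<dots> = (\<Sum>p\<in>P. cnj (val b p) * val b p)"
      by (intro sum.cong refl) (simp only: val_simps(2)[OF cnj_A[OF b] b] val_cnj[OF b])
    finally show ?thesis .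
  qed
  have sym: "(\<Sum>p\<in>P. cnj (val b p) * val b' p) = (\<Sum>p\<in>P. val b p * cnj (val b' p))"
    if b: "b \<in> carrier A" "b' \<in> carrier A" for b b'
  proof -
    have conj: "val b (act \<iota> p) = cnj (val b p)" if "b \<in> carrier A" "p \<in> P" for b p
      using val_equivariant[OF that \<iota>] val_mem[OF that] by (simp add: \<iota>_def)
    have "compose L \<iota> \<iota> = (\<lambda>x\<in>L. x)" using cnj_L by (auto simp: \<iota>_def compose_def)
    hence inv: "act \<iota> (act \<iota> p) = p" if "p \<in> P" for p by (rule act_inverse[OF \<iota> \<iota> _ that])
    have "bij_betw (act \<iota>) P P"
      by (rule bij_betwI[where g = "act \<iota>"]) (auto simp: inv intro: act_closed[OF \<iota>])
    from sum.reindex_bij_betw[OF this, of "\<lambda>p. val b p * cnj (val b' p)"]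
    have "(\<Sum>p\<in>P. val b p * cnj (val b' p)) = (\<Sum>p\<in>P. val b (act \<iota> p) * cnj (val b' (act \<iota> p)))" ..
    also have "\<dots> = (\<Sum>p\<in>P. cnj (val b p) * val b' p)"
      by (rule sum.cong[OF refl]) (simp only: conj[OF b(1)] conj[OF b(2)] complex_cnj_cnj)
    finally show ?thesis ..
  qed
  have bil: "bilin A Q b b' = (\<Sum>p\<in>P. val b p * cnj (val b' p))" if b: "b \<in> carrier A" "b' \<in> carrier A" for b b'
  proof -
    have "Q (b \<oplus>\<^bsub>A\<^esub> b') = (\<Sum>p\<in>P. cnj (val b p + val b' p) * (val b p + val b' p))"
      unfolding prod_field_simps(4) Q[OF A_closed(1)[OF b]]
      by (intro sum.cong refl) (simp only: val_simps(1)[OF b])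
    also have "\<dots> = Q b + Q b' + ((\<Sum>p\<in>P. cnj (val b p) * val b' p) + (\<Sum>p\<in>P. val b p * cnj (val b' p)))"
      unfolding Q[OF b(1)] Q[OF b(2)] sum.distrib[symmetric]
      by (intro sum.cong refl) (simp add: algebra_simps)
    also have "\<dots> = Q b + Q b' + 2 * (\<Sum>p\<in>P. val b p * cnj (val b' p))" unfolding sym[OF b] by simp
    finally show ?thesis by (simp add: bilin_def)
  qed
  have "base_change_form A Q Y = 1 * (\<Sum>p\<in>P. quotient_eval P \<kappa> Y p * cnj (quotient_eval P \<kappa> Y p))"
    unfolding base_change_form_def
  proof (rule induced_form_eq_sum[OF _ W_representative[OF Y]])
    show "\<rat> \<subseteq> (\<real> :: complex set)" by (auto elim!: Rats_cases')
    fix m m' assume "m \<in> carrier M" "m' \<in> carrier M"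
    then obtain z b z' b' where m: "m = (z, b)" "z \<in> F" "b \<in> carrier A" and m': "m' = (z', b')" "z' \<in> F" "b' \<in> carrier A"
      by (cases m; cases m') (auto simp: M_simps simp del: prod_field_simps)
    have "cnj z' = z'" using m'(2) real by (auto simp: Reals_cnj_iff)
    thus "(case m of (s, a) \<Rightarrow> \<lambda>(t, b). s * t * bilin A Q a b) m' = 1 * (\<Sum>p\<in>P. \<kappa> p m * cnj (\<kappa> p m'))"
      by (simp add: m(1) m'(1) bil[OF m(3) m'(3)] \<kappa>_def sum_distrib_left mult_ac)
  qed
  thus ?thesis unfolding Q_def by simp
qed

end

section \<open>Isomorphisms of algebras\<close>

text \<open>An isomorphism constrains the operations on the carriers only. To invert one, the results of the operations
  have to lie in the carrier.\<close>

definition closed_algebra :: "complex set \<Rightarrow> (complex, 'a) module \<Rightarrow> bool" where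
  "closed_algebra F A \<longleftrightarrow> \<one>\<^bsub>A\<^esub> \<in> carrier A \<and>
     (\<forall>x\<in>carrier A. \<forall>y\<in>carrier A. x \<otimes>\<^bsub>A\<^esub> y \<in> carrier A \<and> x \<oplus>\<^bsub>A\<^esub> y \<in> carrier A) \<and>
     (\<forall>c\<in>F. \<forall>x\<in>carrier A. c \<odot>\<^bsub>A\<^esub> x \<in> carrier A)"

lemma (in monoid_alg) quotient_closed:
  assumes S: "S \<subseteq> carrier R" and u: "\<And>c. c \<in> F \<Longrightarrow> u c \<in> carrier R"
  shows "closed_algebra F (quotient_algebra R S u)"
proof -
  define J where "J = Idl\<^bsub>R\<^esub> S"
  interpret J: ideal J R unfolding J_def by (rule R.genideal_ideal[OF S])
  interpret Q: ring "R Quot J" by (rule J.quotient_is_ring)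
  have u': "J +>\<^bsub>R\<^esub> u c \<in> carrier (R Quot J)" if "c \<in> F" for c
    using u[OF that] by (simp add: FactRing_def R.a_rcosetsI[OF J.a_subset])
  show ?thesis
    unfolding closed_algebra_def quotient_algebra_def Let_def J_def[symmetric]
    using Q.one_closed Q.m_closed Q.a_closed u' by simp
qed

lemma algebra_iso_D:
  assumes "h \<in> algebra_iso F A B"
  shows "x \<in> carrier A \<Longrightarrow> h x \<in> carrier B"
    and "x \<in> carrier A \<Longrightarrow> y \<in> carrier A \<Longrightarrow> h (x \<otimes>\<^bsub>A\<^esub> y) = h x \<otimes>\<^bsub>B\<^esub> h y"
    and "x \<in> carrier A \<Longrightarrow> y \<in> carrier A \<Longrightarrow> h (x \<oplus>\<^bsub>A\<^esub> y) = h x \<oplus>\<^bsub>B\<^esub> h y"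
    and "h \<one>\<^bsub>A\<^esub> = \<one>\<^bsub>B\<^esub>"
    and "c \<in> F \<Longrightarrow> x \<in> carrier A \<Longrightarrow> h (c \<odot>\<^bsub>A\<^esub> x) = c \<odot>\<^bsub>B\<^esub> h x"
    and "bij_betw h (carrier A) (carrier B)"
  using assms by (auto simp: algebra_iso_def ring_iso_def ring_hom_def)

lemma algebra_iso_I:
  assumes "\<And>x. x \<in> carrier A \<Longrightarrow> h x \<in> carrier B"
    and "\<And>x y. x \<in> carrier A \<Longrightarrow> y \<in> carrier A \<Longrightarrow> h (x \<otimes>\<^bsub>A\<^esub> y) = h x \<otimes>\<^bsub>B\<^esub> h y"
    and "\<And>x y. x \<in> carrier A \<Longrightarrow> y \<in> carrier A \<Longrightarrow> h (x \<oplus>\<^bsub>A\<^esub> y) = h x \<oplus>\<^bsub>B\<^esub> h y"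
    and "h \<one>\<^bsub>A\<^esub> = \<one>\<^bsub>B\<^esub>"
    and "\<And>c x. c \<in> F \<Longrightarrow> x \<in> carrier A \<Longrightarrow> h (c \<odot>\<^bsub>A\<^esub> x) = c \<odot>\<^bsub>B\<^esub> h x"
    and "bij_betw h (carrier A) (carrier B)"
  shows "h \<in> algebra_iso F A B"
  using assms by (auto simp: algebra_iso_def ring_iso_def ring_hom_def)

lemma algebra_iso_comp:
  assumes A: "closed_algebra F A" and h: "h \<in> algebra_iso F A B" and g: "g \<in> algebra_iso F B C"
  shows "(\<lambda>x. g (h x)) \<in> algebra_iso F A C"
proof (rule algebra_iso_I)
  show "bij_betw (\<lambda>x. g (h x)) (carrier A) (carrier C)"
    using bij_betw_trans[OF algebra_iso_D(6)[OF h] algebra_iso_D(6)[OF g]] by (simp add: o_def)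
qed (simp_all add: algebra_iso_D(1-5)[OF h] algebra_iso_D(1-5)[OF g])

lemma algebra_iso_inverse:
  assumes A: "closed_algebra F A" and h: "h \<in> algebra_iso F A B"
  shows "inv_into (carrier A) h \<in> algebra_iso F B A"
proof -
  let ?g = "inv_into (carrier A) h"
  note bij = algebra_iso_D(6)[OF h]
  have gh: "?g (h x) = x" if "x \<in> carrier A" for x
    using bij that by (simp add: bij_betw_def)
  have hg: "h (?g y) = y" and g: "?g y \<in> carrier A" if "y \<in> carrier B" for y
    using bij that by (auto simp: bij_betw_def f_inv_into_f inv_into_into)
  have cl: "\<one>\<^bsub>A\<^esub> \<in> carrier A"
    "\<And>x y. x \<in> carrier A \<Longrightarrow> y \<in> carrier A \<Longrightarrow> x \<otimes>\<^bsub>A\<^esub> y \<in> carrier A"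
    "\<And>x y. x \<in> carrier A \<Longrightarrow> y \<in> carrier A \<Longrightarrow> x \<oplus>\<^bsub>A\<^esub> y \<in> carrier A"
    "\<And>c x. c \<in> F \<Longrightarrow> x \<in> carrier A \<Longrightarrow> c \<odot>\<^bsub>A\<^esub> x \<in> carrier A"
    using A by (auto simp: closed_algebra_def)
  show ?thesis
  proof (rule algebra_iso_I)
    show "?g y \<in> carrier A" if "y \<in> carrier B" for y by (rule g[OF that])
    show "?g \<one>\<^bsub>B\<^esub> = \<one>\<^bsub>A\<^esub>" using gh[OF cl(1)] algebra_iso_D(4)[OF h] by simp
    show "bij_betw ?g (carrier B) (carrier A)" by (rule bij_betw_inv_into[OF bij])
    show "?g (x \<otimes>\<^bsub>B\<^esub> y) = ?g x \<otimes>\<^bsub>A\<^esub> ?g y" if "x \<in> carrier B" "y \<in> carrier B" for x y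
      using gh[OF cl(2)[OF g[OF that(1)] g[OF that(2)]]] algebra_iso_D(2)[OF h g[OF that(1)] g[OF that(2)]] hg that
      by simp
    show "?g (x \<oplus>\<^bsub>B\<^esub> y) = ?g x \<oplus>\<^bsub>A\<^esub> ?g y" if "x \<in> carrier B" "y \<in> carrier B" for x y
      using gh[OF cl(3)[OF g[OF that(1)] g[OF that(2)]]] algebra_iso_D(3)[OF h g[OF that(1)] g[OF that(2)]] hg that
      by simp
    show "?g (c \<odot>\<^bsub>B\<^esub> x) = c \<odot>\<^bsub>A\<^esub> ?g x" if "c \<in> F" "x \<in> carrier B" for c x
      using gh[OF cl(4)[OF that(1) g[OF that(2)]]] algebra_iso_D(5)[OF h that(1) g[OF that(2)]] hg that by simp
  qed
qed

lemma algebra_iso_closed: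
  assumes A: "closed_algebra F A" and h: "h \<in> algebra_iso F A B"
  shows "closed_algebra F B"
proof -
  have img: "\<exists>x\<in>carrier A. y = h x" if "y \<in> carrier B" for y
    using algebra_iso_D(6)[OF h] that by (auto simp: bij_betw_def)
  note D = algebra_iso_D[OF h]
  show ?thesis
    unfolding closed_algebra_def
  proof (intro conjI ballI)
    show "\<one>\<^bsub>B\<^esub> \<in> carrier B" using D(1)[of "\<one>\<^bsub>A\<^esub>"] A D(4) by (simp add: closed_algebra_def)
    fix y assume "y \<in> carrier B"
    then obtain x where x: "x \<in> carrier A" "y = h x" using img by blast
    show "c \<odot>\<^bsub>B\<^esub> y \<in> carrier B" if "c \<in> F" for c
      using D(1)[of "c \<odot>\<^bsub>A\<^esub> x"] A D(5)[OF that x(1)] that x by (simp add: closed_algebra_def)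
    fix y' assume "y' \<in> carrier B"
    then obtain x' where x': "x' \<in> carrier A" "y' = h x'" using img by blast
    show "y \<otimes>\<^bsub>B\<^esub> y' \<in> carrier B"
      using D(1)[of "x \<otimes>\<^bsub>A\<^esub> x'"] A D(2)[OF x(1) x'(1)] x x' by (simp add: closed_algebra_def)
    show "y \<oplus>\<^bsub>B\<^esub> y' \<in> carrier B"
      using D(1)[of "x \<oplus>\<^bsub>A\<^esub> x'"] A D(3)[OF x(1) x'(1)] x x' by (simp add: closed_algebra_def)
  qed
qed

lemma prod_algebra_cong:
  assumes "\<And>i. i \<in> I \<Longrightarrow> A i = B i"
  shows "prod_algebra I A = prod_algebra I B"
  unfolding prod_algebra_def using assms by (simp cong: PiE_cong restrict_cong)

section \<open>CM-types as a Galois set\<close>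

text \<open>An embedding of a stable subfield \<open>Z\<close> is the restriction of an automorphism, so \<open>Z\<close> is Galois. This
  transfers properties of the elements of \<open>K\<close> to its Galois closure.\<close>

lemma galois_closure_eqI:
  assumes K: "number_field K" and Z: "subfield Z CC" "K \<subseteq> Z" "Z \<subseteq> galois_closure K"
    and stable: "\<And>\<tau> x. \<tau> \<in> embeddings (galois_closure K) \<Longrightarrow> x \<in> Z \<Longrightarrow> \<tau> x \<in> Z"
  shows "Z = galois_closure K"
proof
  let ?L = "galois_closure K"
  have L: "number_field ?L" by (rule galois_number_field[OF galois_closure_galois[OF K]])
  have "\<sigma> x \<in> Z" if \<sigma>: "\<sigma> \<in> embeddings Z" and x: "x \<in> Z" for \<sigma> x
  proof -
    obtain \<tau> where \<tau>: "\<tau> \<in> embeddings ?L" "\<And>a. a \<in> Z \<Longrightarrow> \<tau> a = \<sigma> a"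
      by (rule extend_embedding[OF L Z(1,3) \<sigma>], rule that)
    show ?thesis using stable[OF \<tau>(1) x] \<tau>(2)[OF x] by simp
  qed
  hence "galois_over_rat Z"
    unfolding galois_over_rat_def using number_field_subset[OF L Z(1,3)] by blast
  thus "?L \<subseteq> Z" by (rule galois_closure_minimal[OF Z(2)])
qed (rule Z(3))

lemma galois_closure_totally_real:
  assumes K0: "totally_real K\<^sub>0"
  shows "galois_closure K\<^sub>0 \<subseteq> \<real>"
proof -
  let ?F = "galois_closure K\<^sub>0"
  have nf: "number_field K\<^sub>0" using K0 by (simp add: totally_real_def)
  note F = galois_closure_galois[OF nf]
  note Fs = galois_subfield[OF F]
  define Z where "Z = {x\<in>?F. \<forall>\<sigma>\<in>embeddings ?F. \<sigma> x \<in> \<real>}"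
  have "Z = ?F"
  proof (rule galois_closure_eqI[OF nf])
    show "subfield Z CC"
      unfolding Z_def
      by (rule subfield_CC_I)
        (auto simp: emb_1 emb_add emb_mult emb_uminus[OF Fs] emb_inverse[OF Fs] subfield_1[OF Fs]
          subfield_add[OF Fs] subfield_mult[OF Fs] subfield_uminus[OF Fs] subfield_inverse[OF Fs])
    show "K\<^sub>0 \<subseteq> Z"
    proof
      fix x assume x: "x \<in> K\<^sub>0"
      have "\<sigma> x \<in> \<real>" if "\<sigma> \<in> embeddings ?F" for \<sigma>
      proof -
        have "restrict \<sigma> K\<^sub>0 ` K\<^sub>0 \<subseteq> \<real>"
          using emb_restrict[OF Fs that galois_closure_superset number_field_subfield[OF nf]] K0
          unfolding totally_real_def by blast
        thus ?thesis using x by auto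
      qed
      thus "x \<in> Z" using x galois_closure_superset[of K\<^sub>0] by (auto simp: Z_def)
    qed
    show "Z \<subseteq> ?F" by (auto simp: Z_def)
    fix \<tau> x assume \<tau>: "\<tau> \<in> embeddings ?F" and x: "x \<in> Z"
    have xF: "x \<in> ?F" using x by (simp add: Z_def)
    have "\<sigma> (\<tau> x) \<in> \<real>" if \<sigma>: "\<sigma> \<in> embeddings ?F" for \<sigma>
    proof -
      have "\<tau> ` ?F \<subseteq> ?F" using galois_emb_mem[OF F \<tau>] by blast
      hence "compose ?F \<sigma> \<tau> x \<in> \<real>" using emb_compose[OF Fs \<tau> \<sigma>] x by (simp add: Z_def)
      thus ?thesis using xF by (simp add: compose_eq)
    qed
    thus "\<tau> x \<in> Z" using galois_emb_mem[OF F \<tau> xF] by (simp add: Z_def)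
  qed
  moreover have "Z \<subseteq> \<real>"
  proof
    fix x assume x: "x \<in> Z"
    hence "(\<lambda>x\<in>?F. x) x \<in> \<real>" using emb_id[OF Fs] unfolding Z_def by blast
    thus "x \<in> \<real>" using x by (simp add: Z_def)
  qed
  ultimately show ?thesis by simp
qed

lemma sqrt_of_negative:
  fixes a z :: complex
  assumes "a \<in> \<real>" "0 < Re a" "z * z = - a"
  shows "z = csqrt (- a) \<or> z = - csqrt (- a)" and "cnj z = - z" and "z \<noteq> 0"
proof -
  note r = csqrt_neg[OF subset_refl assms(1,2)]
  have "z * z = csqrt (- a) * csqrt (- a)" using assms(3) r(1) by simp
  thus *: "z = csqrt (- a) \<or> z = - csqrt (- a)" by (simp add: square_eq_iff)
  from * show "cnj z = - z" "z \<noteq> 0" using r(2,3) by auto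
qed

locale cm_situation =
  fixes K K\<^sub>0 :: "complex set" and N :: nat and \<phi> :: "nat \<Rightarrow> complex \<Rightarrow> complex" and d :: complex
  assumes K: "number_field K" and K0: "totally_real K\<^sub>0" and sub: "K\<^sub>0 \<subseteq> K"
    and \<phi>: "bij_betw \<phi> {1..N} (embeddings K\<^sub>0)" and d: "totally_positive K\<^sub>0 d"
    and K_eq: "K = adjoin K\<^sub>0 (csqrt (- d))"
begin

abbreviation "s \<equiv> csqrt (- d)"
abbreviation "F \<equiv> galois_closure K\<^sub>0"
abbreviation "L \<equiv> galois_closure K"

lemma K0_nf: "number_field K\<^sub>0" using K0 by (simp add: totally_real_def)
lemma K0s: "subfield K\<^sub>0 CC" by (rule number_field_subfield[OF K0_nf])
lemma Ks: "subfield K CC" by (rule number_field_subfield[OF K])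

lemma K0_emb_real: "\<sigma> \<in> embeddings K\<^sub>0 \<Longrightarrow> x \<in> K\<^sub>0 \<Longrightarrow> \<sigma> x \<in> \<real>"
  using K0 by (auto simp: totally_real_def)

lemma K0_real: "K\<^sub>0 \<subseteq> \<real>"
  using K0_emb_real[OF emb_id[OF K0s]] by auto

lemma d_K0: "d \<in> K\<^sub>0" and d_pos: "\<sigma> \<in> embeddings K\<^sub>0 \<Longrightarrow> 0 < Re (\<sigma> d)"
  using d by (auto simp: totally_positive_def)

lemma d_pos0: "0 < Re d"
  using d_pos[OF emb_id[OF K0s]] d_K0 by simp

lemma s_sq: "s * s = - d"
  using csqrt_neg(1)[OF K0_real d_K0 d_pos0] .

lemma K_elements: "K = {u + v * s |u v. u \<in> K\<^sub>0 \<and> v \<in> K\<^sub>0}"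
  unfolding K_eq by (rule adjoin_csqrt(1)[OF K0s K0_real d_K0 d_pos0])

lemma s_K: "s \<in> K"
  unfolding K_elements using subfield_0[OF K0s] subfield_1[OF K0s] by force

lemma K_cases:
  assumes "x \<in> K"
  obtains u v where "x = u + v * s" "u \<in> K\<^sub>0" "v \<in> K\<^sub>0"
  using assms K_elements by blast

lemma F: "galois_over_rat F" by (rule galois_closure_galois[OF K0_nf])
lemma L: "galois_over_rat L" by (rule galois_closure_galois[OF K])
lemma Fs: "subfield F CC" by (rule galois_subfield[OF F])
lemma Ls: "subfield L CC" by (rule galois_subfield[OF L])
lemma KL: "K \<subseteq> L" by (rule galois_closure_superset)
lemma K0F: "K\<^sub>0 \<subseteq> F" by (rule galois_closure_superset)
lemma FL: "F \<subseteq> L" by (rule galois_closure_minimal[OF order_trans[OF sub KL] L])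
lemma F_real: "F \<subseteq> \<real>" by (rule galois_closure_totally_real[OF K0])

lemma L_mem: "\<sigma> \<in> embeddings L \<Longrightarrow> x \<in> L \<Longrightarrow> \<sigma> x \<in> L"
  by (rule galois_emb_mem[OF L])

lemma emb_K_extend:
  assumes "\<psi> \<in> embeddings K"
  obtains \<tau> where "\<tau> \<in> embeddings L" "\<And>x. x \<in> K \<Longrightarrow> \<tau> x = \<psi> x"
  by (rule extend_embedding[OF galois_number_field[OF L] Ks KL assms], rule that)

lemma emb_K_L: "\<psi> \<in> embeddings K \<Longrightarrow> x \<in> K \<Longrightarrow> \<psi> x \<in> L"
  using KL L_mem by (metis emb_K_extend subsetD)

lemma emb_K0_F:
  assumes "\<sigma> \<in> embeddings K\<^sub>0" "x \<in> K\<^sub>0"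
  shows "\<sigma> x \<in> F"
proof -
  obtain \<tau> where \<tau>: "\<tau> \<in> embeddings F" "\<And>x. x \<in> K\<^sub>0 \<Longrightarrow> \<tau> x = \<sigma> x"
    by (rule extend_embedding[OF galois_number_field[OF F] K0s K0F assms(1)], rule that)
  have "\<tau> x \<in> F" using galois_emb_mem[OF F \<tau>(1)] assms(2) K0F by blast
  thus ?thesis using \<tau>(2)[OF assms(2)] by simp
qed

lemma res_K0: "\<psi> \<in> embeddings K \<Longrightarrow> restrict \<psi> K\<^sub>0 \<in> embeddings K\<^sub>0"
  by (rule emb_restrict[OF Ks _ sub K0s])

lemma emb_K_K0_real: "\<psi> \<in> embeddings K \<Longrightarrow> x \<in> K\<^sub>0 \<Longrightarrow> \<psi> x \<in> \<real>"
  using K0_emb_real[OF res_K0] by (metis restrict_apply')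

lemma emb_K_s:
  assumes \<psi>: "\<psi> \<in> embeddings K"
  shows "\<psi> s * \<psi> s = - \<psi> d" "\<psi> d \<in> \<real>" "0 < Re (\<psi> d)"
proof -
  show "\<psi> d \<in> \<real>" by (rule emb_K_K0_real[OF \<psi> d_K0])
  show "0 < Re (\<psi> d)" using d_pos[OF res_K0[OF \<psi>]] d_K0 by simp
  have "\<psi> s * \<psi> s = \<psi> (- d)" using emb_mult[OF \<psi> s_K s_K] s_sq by simp
  thus "\<psi> s * \<psi> s = - \<psi> d" using emb_uminus[OF Ks \<psi>] d_K0 sub by auto
qed

lemma emb_K_value:
  assumes "\<psi> \<in> embeddings K" "u \<in> K\<^sub>0" "v \<in> K\<^sub>0"
  shows "\<psi> (u + v * s) = \<psi> u + \<psi> v * \<psi> s"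
proof -
  have "u \<in> K" "v \<in> K" using assms sub by auto
  thus ?thesis using s_K assms(1) by (simp add: emb_add emb_mult subfield_mult[OF Ks])
qed

lemma emb_K_eqI:
  assumes "\<psi> \<in> embeddings K" "\<psi>' \<in> embeddings K" "restrict \<psi> K\<^sub>0 = restrict \<psi>' K\<^sub>0" "\<psi> s = \<psi>' s"
  shows "\<psi> = \<psi>'"
proof (rule embeddings_ext[OF assms(1,2)])
  fix x assume "x \<in> K"
  then obtain u v where x: "x = u + v * s" "u \<in> K\<^sub>0" "v \<in> K\<^sub>0" by (rule K_cases)
  have "\<psi> u = \<psi>' u" "\<psi> v = \<psi>' v" using fun_cong[OF assms(3), of u] fun_cong[OF assms(3), of v] x by simp_all
  thus "\<psi> x = \<psi>' x" unfolding x(1) emb_K_value[OF assms(1) x(2,3)] emb_K_value[OF assms(2) x(2,3)] assms(4) by simp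
qed

text \<open>Complex conjugation commutes with the embeddings of \<open>K\<close>, because the embeddings of \<open>K\<^sub>0\<close> are real and
  square roots of negative numbers are imaginary; this property passes to the Galois closure.\<close>

lemma emb_K_cnj:
  assumes x: "x \<in> K"
  shows "cnj x \<in> K" and "\<psi> \<in> embeddings K \<Longrightarrow> \<psi> (cnj x) = cnj (\<psi> x)"
proof -
  obtain u v where uv: "x = u + v * s" "u \<in> K\<^sub>0" "v \<in> K\<^sub>0" by (rule K_cases[OF x])
  have real: "cnj u = u" "cnj v = v" using uv K0_real by (auto simp: Reals_cnj_iff)
  have cx: "cnj x = u + (- v) * s"
    using csqrt_neg(2)[OF K0_real d_K0 d_pos0] by (simp add: uv(1) real)
  show "cnj x \<in> K" unfolding cx K_elements using uv subfield_uminus[OF K0s] by blast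
  assume \<psi>: "\<psi> \<in> embeddings K"
  have r: "cnj (\<psi> u) = \<psi> u" "cnj (\<psi> v) = \<psi> v"
    using emb_K_K0_real[OF \<psi>] uv by (auto simp: Reals_cnj_iff)
  have "cnj (\<psi> s) = - \<psi> s" by (rule sqrt_of_negative(2)[OF emb_K_s(2,3,1)[OF \<psi>]])
  moreover have "\<psi> (- v) = - \<psi> v" using emb_uminus[OF Ks \<psi>] uv sub by auto
  ultimately show "\<psi> (cnj x) = cnj (\<psi> x)"
    unfolding cx emb_K_value[OF \<psi> uv(2) subfield_uminus[OF K0s uv(3)]] unfolding uv(1) emb_K_value[OF \<psi> uv(2,3)]
    by (simp add: r)
qed

lemma cnj_central: "x \<in> L \<Longrightarrow> cnj x \<in> L" "\<sigma> \<in> embeddings L \<Longrightarrow> x \<in> L \<Longrightarrow> \<sigma> (cnj x) = cnj (\<sigma> x)"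
proof -
  define Z where "Z = {x\<in>L. cnj x \<in> L \<and> (\<forall>\<sigma>\<in>embeddings L. \<sigma> (cnj x) = cnj (\<sigma> x))}"
  have "Z = L"
  proof (rule galois_closure_eqI[OF K])
    show "subfield Z CC"
      unfolding Z_def
      by (rule subfield_CC_I)
        (auto simp: emb_1 emb_add emb_mult emb_uminus[OF Ls] emb_inverse[OF Ls] subfield_1[OF Ls]
          subfield_add[OF Ls] subfield_mult[OF Ls] subfield_uminus[OF Ls] subfield_inverse[OF Ls])
    show "K \<subseteq> Z"
    proof
      fix x assume x: "x \<in> K"
      have "\<sigma> (cnj x) = cnj (\<sigma> x)" if \<sigma>: "\<sigma> \<in> embeddings L" for \<sigma>
        using emb_K_cnj(2)[OF x emb_restrict[OF Ls \<sigma> KL Ks]] emb_K_cnj(1)[OF x] x by simp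
      thus "x \<in> Z" using x emb_K_cnj(1)[OF x] KL by (auto simp: Z_def)
    qed
    show "Z \<subseteq> L" by (auto simp: Z_def)
    fix \<tau> x assume \<tau>: "\<tau> \<in> embeddings L" and x: "x \<in> Z"
    have xL: "x \<in> L" "cnj x \<in> L" and eq: "\<And>\<sigma>. \<sigma> \<in> embeddings L \<Longrightarrow> \<sigma> (cnj x) = cnj (\<sigma> x)"
      using x by (auto simp: Z_def)
    have "\<sigma> (cnj (\<tau> x)) = cnj (\<sigma> (\<tau> x))" if \<sigma>: "\<sigma> \<in> embeddings L" for \<sigma>
    proof -
      have "compose L \<sigma> \<tau> \<in> embeddings L" using emb_compose[OF Ls \<tau> \<sigma>] L_mem[OF \<tau>] by blast
      from eq[OF this] show ?thesis using xL eq[OF \<tau>] by (simp add: compose_eq)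
    qed
    moreover have "cnj (\<tau> x) \<in> L" using eq[OF \<tau>] L_mem[OF \<tau> xL(2)] by simp
    ultimately show "\<tau> x \<in> Z" using L_mem[OF \<tau> xL(1)] by (simp add: Z_def)
  qed
  thus "x \<in> L \<Longrightarrow> cnj x \<in> L" "\<sigma> \<in> embeddings L \<Longrightarrow> x \<in> L \<Longrightarrow> \<sigma> (cnj x) = cnj (\<sigma> x)"
    unfolding Z_def by blast+
qed

definition bar :: "(complex \<Rightarrow> complex) \<Rightarrow> complex \<Rightarrow> complex" where "bar \<psi> = compose K cnj \<psi>"

lemma bar: "\<psi> \<in> embeddings K \<Longrightarrow> bar \<psi> \<in> embeddings K"
  unfolding bar_def by (rule emb_cnj[OF Ks])

lemma bar_apply: "x \<in> K \<Longrightarrow> bar \<psi> x = cnj (\<psi> x)"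
  by (simp add: bar_def compose_eq)

lemma bar_bar: "\<psi> \<in> embeddings K \<Longrightarrow> bar (bar \<psi>) = \<psi>"
  by (rule embeddings_ext[OF bar[OF bar]]) (auto simp: bar_apply)

lemma bar_K0: "\<psi> \<in> embeddings K \<Longrightarrow> restrict (bar \<psi>) K\<^sub>0 = restrict \<psi> K\<^sub>0"
  using sub emb_K_K0_real by (auto simp: fun_eq_iff bar_apply subset_iff Reals_cnj_iff restrict_def)

text \<open>Complex conjugation pairs the embeddings, and a CM-type contains one member of every pair.\<close>

lemma CM_type_iff:
  "CM_type K \<Phi> \<longleftrightarrow> \<Phi> \<subseteq> embeddings K \<and> (\<forall>\<psi>\<in>embeddings K. bar \<psi> \<in> \<Phi> \<longleftrightarrow> \<psi> \<notin> \<Phi>)"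
proof
  assume "CM_type K \<Phi>"
  hence *: "\<Phi> \<subseteq> embeddings K" "\<Phi> \<inter> bar ` \<Phi> = {}" "\<Phi> \<union> bar ` \<Phi> = embeddings K"
    by (auto simp: CM_type_def bar_def)
  have "bar \<psi> \<in> \<Phi> \<longleftrightarrow> \<psi> \<notin> \<Phi>" if \<psi>: "\<psi> \<in> embeddings K" for \<psi>
  proof
    assume b: "bar \<psi> \<in> \<Phi>"
    have "bar (bar \<psi>) \<in> bar ` \<Phi>" using b by (rule imageI)
    thus "\<psi> \<notin> \<Phi>" using *(2) bar_bar[OF \<psi>] by auto
  next
    assume n: "\<psi> \<notin> \<Phi>"
    hence "\<psi> \<in> bar ` \<Phi>" using *(3) \<psi> by blast
    then obtain \<psi>' where p: "\<psi>' \<in> \<Phi>" "\<psi> = bar \<psi>'" by (elim imageE)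
    have "\<psi>' \<in> embeddings K" using p(1) *(1) by blast
    thus "bar \<psi> \<in> \<Phi>" using p bar_bar by simp
  qed
  thus "\<Phi> \<subseteq> embeddings K \<and> (\<forall>\<psi>\<in>embeddings K. bar \<psi> \<in> \<Phi> \<longleftrightarrow> \<psi> \<notin> \<Phi>)" using *(1) by blast
next
  assume *: "\<Phi> \<subseteq> embeddings K \<and> (\<forall>\<psi>\<in>embeddings K. bar \<psi> \<in> \<Phi> \<longleftrightarrow> \<psi> \<notin> \<Phi>)"
  have "\<Phi> \<inter> bar ` \<Phi> = {}" using * by blast
  moreover have "\<Phi> \<union> bar ` \<Phi> = embeddings K"
  proof
    show "\<Phi> \<union> bar ` \<Phi> \<subseteq> embeddings K" using * bar by blast
    show "embeddings K \<subseteq> \<Phi> \<union> bar ` \<Phi>"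
    proof
      fix \<psi> assume \<psi>: "\<psi> \<in> embeddings K"
      show "\<psi> \<in> \<Phi> \<union> bar ` \<Phi>"
      proof (cases "\<psi> \<in> \<Phi>")
        case False
        hence "bar \<psi> \<in> \<Phi>" using * \<psi> by blast
        hence "bar (bar \<psi>) \<in> bar ` \<Phi>" by (rule imageI)
        thus ?thesis using bar_bar[OF \<psi>] by simp
      qed simp
    qed
  qed
  ultimately show "CM_type K \<Phi>" using * by (simp add: CM_type_def bar_def[abs_def])
qed

abbreviation "I \<equiv> {1..N}"

definition a :: "nat \<Rightarrow> complex" where "a i = \<phi> i d"

lemma phi: "i \<in> I \<Longrightarrow> \<phi> i \<in> embeddings K\<^sub>0"
  using \<phi> by (auto simp: bij_betw_def)

lemma phi_cases:
  assumes "\<sigma> \<in> embeddings K\<^sub>0"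
  obtains i where "i \<in> I" "\<sigma> = \<phi> i"
proof -
  have "\<sigma> \<in> \<phi> ` I" using assms \<phi> unfolding bij_betw_def by simp
  thus thesis by (rule imageE) (rule that)
qed

lemma a: "i \<in> I \<Longrightarrow> a i \<in> F" "i \<in> I \<Longrightarrow> 0 < Re (a i)"
  using emb_K0_F[OF phi d_K0] d_pos[OF phi] by (auto simp: a_def)

text \<open>The extension of \<open>\<phi>\<^sub>i\<close> to \<open>K\<close> that sends \<open>\<surd>-d\<close> to the principal square root; the only other extension is
  \<open>bar (e i)\<close>.\<close>

definition e :: "nat \<Rightarrow> complex \<Rightarrow> complex" where
  "e i = (SOME \<psi>. \<psi> \<in> embeddings K \<and> restrict \<psi> K\<^sub>0 = \<phi> i \<and> \<psi> s = csqrt (- a i))"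

lemma emb_K_over:
  assumes \<psi>: "\<psi> \<in> embeddings K" and i: "restrict \<psi> K\<^sub>0 = \<phi> i"
  shows "\<psi> s = csqrt (- a i) \<or> \<psi> s = - csqrt (- a i)"
proof -
  have "\<psi> d = a i" using fun_cong[OF i, of d] d_K0 by (simp add: a_def)
  thus ?thesis using sqrt_of_negative(1)[OF emb_K_s(2,3,1)[OF \<psi>]] by simp
qed

lemma bar_s:
  assumes "\<psi> \<in> embeddings K"
  shows "bar \<psi> s = - \<psi> s"
  using sqrt_of_negative(2)[OF emb_K_s(2,3,1)[OF assms]] by (simp add: bar_apply[OF s_K])

lemma e:
  assumes i: "i \<in> I"
  shows "e i \<in> embeddings K" "restrict (e i) K\<^sub>0 = \<phi> i" "e i s = csqrt (- a i)"
proof -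
  obtain \<psi> where \<psi>: "\<psi> \<in> embeddings K" "\<And>x. x \<in> K\<^sub>0 \<Longrightarrow> \<psi> x = \<phi> i x"
    by (rule extend_embedding[OF K K0s sub phi[OF i]], rule that)
  have res: "restrict \<psi> K\<^sub>0 = \<phi> i"
    using phi[OF i] \<psi>(2) by (intro extensionalityI[of _ K\<^sub>0]) (auto simp: embeddings_iff)
  have "\<exists>\<psi>. \<psi> \<in> embeddings K \<and> restrict \<psi> K\<^sub>0 = \<phi> i \<and> \<psi> s = csqrt (- a i)"
    using emb_K_over[OF \<psi>(1) res]
  proof
    assume "\<psi> s = csqrt (- a i)"
    thus ?thesis using \<psi>(1) res by blast
  next
    assume "\<psi> s = - csqrt (- a i)"
    hence "bar \<psi> s = csqrt (- a i)" using bar_s[OF \<psi>(1)] by simp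
    thus ?thesis using bar[OF \<psi>(1)] bar_K0[OF \<psi>(1)] res by auto
  qed
  from someI_ex[OF this] show "e i \<in> embeddings K" "restrict (e i) K\<^sub>0 = \<phi> i" "e i s = csqrt (- a i)"
    unfolding e_def by blast+
qed

lemma emb_K_cases:
  assumes "\<psi> \<in> embeddings K"
  obtains i where "i \<in> I" "restrict \<psi> K\<^sub>0 = \<phi> i" "\<psi> = e i \<or> \<psi> = bar (e i)"
proof -
  obtain i where i: "i \<in> I" "restrict \<psi> K\<^sub>0 = \<phi> i" by (rule phi_cases[OF res_K0[OF assms]])
  note ei = e[OF i(1)]
  have "\<psi> = e i \<or> \<psi> = bar (e i)"
    using emb_K_over[OF assms i(2)]
  proof
    assume "\<psi> s = csqrt (- a i)"
    hence "\<psi> = e i" using i ei by (intro emb_K_eqI[OF assms ei(1)]) simp_all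
    thus ?thesis ..
  next
    assume "\<psi> s = - csqrt (- a i)"
    hence "\<psi> = bar (e i)"
      using i ei bar_s[OF ei(1)] bar_K0[OF ei(1)] by (intro emb_K_eqI[OF assms bar[OF ei(1)]]) simp_all
    thus ?thesis ..
  qed
  thus thesis by (rule that[OF i])
qed

lemma phi_inj: "i \<in> I \<Longrightarrow> j \<in> I \<Longrightarrow> \<phi> i = \<phi> j \<Longrightarrow> i = j"
  using inj_onD[OF bij_betw_imp_inj_on[OF \<phi>]] by simp

definition CM :: "(complex \<Rightarrow> complex) set set" where "CM = {\<Phi>. CM_type K \<Phi>}"

definition signs :: "(complex \<Rightarrow> complex) set \<Rightarrow> nat set" where
  "signs \<Phi> = {i\<in>I. bar (e i) \<in> \<Phi>}"

text \<open>A CM-type chooses one of the two extensions of every embedding of \<open>K\<^sub>0\<close>, that is, a sign for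
  every square root.\<close>

lemma signs_bij: "bij_betw signs CM (Pow I)"
  unfolding bij_betw_def
proof
  have mem: "\<psi> \<in> \<Phi> \<longleftrightarrow> (\<exists>i\<in>I. \<psi> = (if i \<in> signs \<Phi> then bar (e i) else e i))" if \<Phi>: "CM_type K \<Phi>" for \<Phi> \<psi>
  proof
    assume \<psi>: "\<psi> \<in> \<Phi>"
    have \<psi>K: "\<psi> \<in> embeddings K" using \<psi> \<Phi> by (auto simp: CM_type_iff)
    obtain i where i: "i \<in> I" "\<psi> = e i \<or> \<psi> = bar (e i)" by (rule emb_K_cases[OF \<psi>K])
    have "bar (e i) \<in> \<Phi> \<longleftrightarrow> e i \<notin> \<Phi>" using \<Phi> e(1)[OF i(1)] by (auto simp: CM_type_iff)
    hence "\<psi> = (if i \<in> signs \<Phi> then bar (e i) else e i)" using i \<psi> by (auto simp: signs_def)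
    thus "\<exists>i\<in>I. \<psi> = (if i \<in> signs \<Phi> then bar (e i) else e i)" using i(1) by blast
  next
    assume "\<exists>i\<in>I. \<psi> = (if i \<in> signs \<Phi> then bar (e i) else e i)"
    then obtain i where i: "i \<in> I" "\<psi> = (if i \<in> signs \<Phi> then bar (e i) else e i)" by blast
    have "bar (e i) \<in> \<Phi> \<longleftrightarrow> e i \<notin> \<Phi>" using \<Phi> e(1)[OF i(1)] by (auto simp: CM_type_iff)
    thus "\<psi> \<in> \<Phi>" using i by (auto simp: signs_def split: if_splits)
  qed
  show "inj_on signs CM"
  proof (rule inj_onI)
    fix \<Phi> \<Psi> assume "\<Phi> \<in> CM" "\<Psi> \<in> CM" and eq: "signs \<Phi> = signs \<Psi>"
    hence T: "CM_type K \<Phi>" "CM_type K \<Psi>" by (simp_all add: CM_def)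
    show "\<Phi> = \<Psi>" by (rule Set.set_eqI) (simp only: mem[OF T(1)] mem[OF T(2)] eq)
  qed
  show "signs ` CM = Pow I"
  proof
    show "signs ` CM \<subseteq> Pow I" by (auto simp: signs_def)
    show "Pow I \<subseteq> signs ` CM"
    proof
      fix A assume A: "A \<in> Pow I"
      define \<Phi> where "\<Phi> = (\<lambda>i. if i \<in> A then bar (e i) else e i) ` I"
      have ne: "bar (e i) \<noteq> e i" if "i \<in> I" for i
        using bar_s[OF e(1)[OF that]] sqrt_of_negative(3)[OF emb_K_s(2,3,1)[OF e(1)[OF that]]] by auto
      have idx: "i = j" if "i \<in> I" "j \<in> I" "restrict \<psi> K\<^sub>0 = \<phi> i" "\<psi> = (if j \<in> A then bar (e j) else e j)" for i j \<psi>
      proof -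
        have "restrict \<psi> K\<^sub>0 = \<phi> j" using that(2,4) e[OF that(2)] bar_K0[OF e(1)[OF that(2)]] by simp
        thus ?thesis using phi_inj[OF that(1,2)] that(3) by simp
      qed
      have e_mem: "e i \<in> \<Phi> \<longleftrightarrow> i \<notin> A" and be_mem: "bar (e i) \<in> \<Phi> \<longleftrightarrow> i \<in> A" if i: "i \<in> I" for i
      proof -
        show "e i \<in> \<Phi> \<longleftrightarrow> i \<notin> A"
        proof
          assume "e i \<in> \<Phi>"
          then obtain j where j: "j \<in> I" "e i = (if j \<in> A then bar (e j) else e j)" unfolding \<Phi>_def by (elim imageE)
          have "i = j" by (rule idx[OF i j(1) e(2)[OF i] j(2)])
          thus "i \<notin> A" using j ne[OF i] by (auto split: if_splits)
        next
          assume "i \<notin> A"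
          thus "e i \<in> \<Phi>" unfolding \<Phi>_def using i by (intro image_eqI[of _ _ i]) auto
        qed
        show "bar (e i) \<in> \<Phi> \<longleftrightarrow> i \<in> A"
        proof
          assume "bar (e i) \<in> \<Phi>"
          then obtain j where j: "j \<in> I" "bar (e i) = (if j \<in> A then bar (e j) else e j)" unfolding \<Phi>_def by (elim imageE)
          have "restrict (bar (e i)) K\<^sub>0 = \<phi> i" using bar_K0[OF e(1)[OF i]] e(2)[OF i] by simp
          hence "i = j" by (rule idx[OF i j(1) _ j(2)])
          thus "i \<in> A" using j ne[OF i] by (auto split: if_splits)
        next
          assume "i \<in> A"
          thus "bar (e i) \<in> \<Phi>" unfolding \<Phi>_def using i by (intro image_eqI[of _ _ i]) auto
        qed
      qed
      have "CM_type K \<Phi>"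
        unfolding CM_type_iff
      proof (intro conjI ballI)
        show "\<Phi> \<subseteq> embeddings K" unfolding \<Phi>_def using e(1) bar by auto
        fix \<psi> assume "\<psi> \<in> embeddings K"
        then obtain i where i: "i \<in> I" "\<psi> = e i \<or> \<psi> = bar (e i)" by (rule emb_K_cases)
        from i(2) show "bar \<psi> \<in> \<Phi> \<longleftrightarrow> \<psi> \<notin> \<Phi>"
          using e_mem[OF i(1)] be_mem[OF i(1)] bar_bar[OF e(1)[OF i(1)]] by auto
      qed
      moreover have "signs \<Phi> = A" using A be_mem by (auto simp: signs_def)
      ultimately show "A \<in> signs ` CM" by (auto simp: CM_def)
    qed
  qed
qed

sublocale V: multiquadratic F I a CM signs
  by (rule multiquadratic.intro) (use Fs F_real a signs_bij in auto)

text \<open>Describes the selected square root without reference to principal square roots, which automorphisms do not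
  respect.\<close>

lemma rho_eq:
  assumes \<Phi>: "\<Phi> \<in> CM" and \<psi>: "\<psi> \<in> \<Phi>" and i: "i \<in> I" "restrict \<psi> K\<^sub>0 = \<phi> i"
  shows "V.\<rho> \<Phi> i = \<psi> s"
proof -
  have T: "CM_type K \<Phi>" using \<Phi> by (simp add: CM_def)
  have \<psi>K: "\<psi> \<in> embeddings K" using T \<psi> by (auto simp: CM_type_iff)
  obtain j where j: "j \<in> I" "restrict \<psi> K\<^sub>0 = \<phi> j" "\<psi> = e j \<or> \<psi> = bar (e j)" by (rule emb_K_cases[OF \<psi>K])
  have ji: "j = i" using phi_inj[OF j(1) i(1)] j(2) i(2) by simp
  have ex: "bar (e i) \<in> \<Phi> \<longleftrightarrow> e i \<notin> \<Phi>" using T e(1)[OF i(1)] by (auto simp: CM_type_iff)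
  note ei = e(3)[OF i(1)] bar_s[OF e(1)[OF i(1)]]
  show ?thesis
    using j(3) unfolding ji
  proof
    assume eq: "\<psi> = e i"
    hence "i \<notin> signs \<Phi>" using ex \<psi> by (simp add: signs_def)
    thus ?thesis using eq ei by (simp add: V.rho[OF i(1)] V.r_def)
  next
    assume eq: "\<psi> = bar (e i)"
    hence "i \<in> signs \<Phi>" using \<psi> i(1) by (simp add: signs_def)
    thus ?thesis using eq ei by (simp add: V.rho[OF i(1)] V.r_def)
  qed
qed

lemma CM_over:
  assumes \<Phi>: "\<Phi> \<in> CM" and i: "i \<in> I"
  obtains \<psi> where "\<psi> \<in> \<Phi>" "restrict \<psi> K\<^sub>0 = \<phi> i"
proof -
  have "bar (e i) \<in> \<Phi> \<or> e i \<in> \<Phi>" using \<Phi> e(1)[OF i] by (auto simp: CM_def CM_type_iff)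
  thus thesis using that e(2)[OF i] bar_K0[OF e(1)[OF i]] by auto
qed

definition act :: "(complex \<Rightarrow> complex) \<Rightarrow> (complex \<Rightarrow> complex) set \<Rightarrow> (complex \<Rightarrow> complex) set" where
  "act \<sigma> \<Phi> = compose K \<sigma> ` \<Phi>"

lemma comp_emb: "\<sigma> \<in> embeddings L \<Longrightarrow> \<psi> \<in> embeddings K \<Longrightarrow> compose K \<sigma> \<psi> \<in> embeddings K"
  using emb_K_L by (intro emb_compose[OF Ks]) auto

lemma comp_bar:
  assumes "\<sigma> \<in> embeddings L" "\<psi> \<in> embeddings K"
  shows "compose K \<sigma> (bar \<psi>) = bar (compose K \<sigma> \<psi>)"
  using cnj_central(2)[OF assms(1) emb_K_L[OF assms(2)]]
  by (intro embeddings_ext[OF comp_emb[OF assms(1) bar[OF assms(2)]] bar[OF comp_emb[OF assms]]])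
    (simp add: bar_apply compose_eq)

lemma comp_comp:
  assumes "\<sigma> \<in> embeddings L" "\<tau> \<in> embeddings L" "\<psi> \<in> embeddings K"
  shows "compose K (compose L \<sigma> \<tau>) \<psi> = compose K \<sigma> (compose K \<tau> \<psi>)"
  using emb_K_L[OF assms(3)] by (auto simp: compose_def fun_eq_iff)

lemma comp_id: "\<psi> \<in> embeddings K \<Longrightarrow> compose K (\<lambda>x\<in>L. x) \<psi> = \<psi>"
  using emb_K_L by (auto simp: compose_def fun_eq_iff embeddings_iff extensional_def)

lemma comp_cancel:
  assumes "\<sigma> \<in> embeddings L" "\<sigma>' \<in> embeddings L" "compose L \<sigma>' \<sigma> = (\<lambda>x\<in>L. x)" "\<psi> \<in> embeddings K"
  shows "compose K \<sigma>' (compose K \<sigma> \<psi>) = \<psi>"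
  using comp_comp[OF assms(2,1,4)] comp_id[OF assms(4)] assms(3) by simp

lemma CM_emb: "\<Phi> \<in> CM \<Longrightarrow> \<psi> \<in> \<Phi> \<Longrightarrow> \<psi> \<in> embeddings K"
  by (auto simp: CM_def CM_type_iff)

lemma act_mem:
  assumes "\<sigma> \<in> embeddings L" "\<Phi> \<subseteq> embeddings K" "\<psi> \<in> embeddings K"
  shows "compose K \<sigma> \<psi> \<in> act \<sigma> \<Phi> \<longleftrightarrow> \<psi> \<in> \<Phi>"
proof
  assume "compose K \<sigma> \<psi> \<in> act \<sigma> \<Phi>"
  then obtain \<psi>' where p: "\<psi>' \<in> \<Phi>" "compose K \<sigma> \<psi> = compose K \<sigma> \<psi>'" unfolding act_def by (elim imageE)
  have p': "\<psi>' \<in> embeddings K" using p(1) assms(2) by blast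
  obtain \<sigma>' where s: "\<sigma>' \<in> embeddings L" "compose L \<sigma>' \<sigma> = (\<lambda>x\<in>L. x)" by (rule galois_inverse[OF L assms(1)])
  have "\<psi> = compose K \<sigma>' (compose K \<sigma> \<psi>)" by (rule comp_cancel[OF assms(1) s assms(3), symmetric])
  also have "\<dots> = \<psi>'" unfolding p(2) by (rule comp_cancel[OF assms(1) s p'])
  finally show "\<psi> \<in> \<Phi>" using p(1) by simp
qed (simp add: act_def)

lemma act_closed:
  assumes \<sigma>: "\<sigma> \<in> embeddings L" and \<Phi>: "\<Phi> \<in> CM"
  shows "act \<sigma> \<Phi> \<in> CM"
proof -
  have T: "CM_type K \<Phi>" using \<Phi> by (simp add: CM_def)
  have sub\<Phi>: "\<Phi> \<subseteq> embeddings K" using T by (simp add: CM_type_iff)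
  obtain \<sigma>' where s: "\<sigma>' \<in> embeddings L" "compose L \<sigma>' \<sigma> = (\<lambda>x\<in>L. x)" "compose L \<sigma> \<sigma>' = (\<lambda>x\<in>L. x)"
    by (rule galois_inverse[OF L \<sigma>])
  have "CM_type K (act \<sigma> \<Phi>)"
    unfolding CM_type_iff
  proof (intro conjI ballI)
    show "act \<sigma> \<Phi> \<subseteq> embeddings K" unfolding act_def using comp_emb[OF \<sigma>] sub\<Phi> by blast
    fix \<psi> assume \<psi>: "\<psi> \<in> embeddings K"
    define \<psi>' where "\<psi>' = compose K \<sigma>' \<psi>"
    have p': "\<psi>' \<in> embeddings K" unfolding \<psi>'_def by (rule comp_emb[OF s(1) \<psi>])
    have eq: "\<psi> = compose K \<sigma> \<psi>'" unfolding \<psi>'_def by (rule comp_cancel[OF s(1) \<sigma> s(3) \<psi>, symmetric])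
    have "bar \<psi>' \<in> \<Phi> \<longleftrightarrow> \<psi>' \<notin> \<Phi>" using T p' by (simp add: CM_type_iff)
    thus "bar \<psi> \<in> act \<sigma> \<Phi> \<longleftrightarrow> \<psi> \<notin> act \<sigma> \<Phi>"
      unfolding eq comp_bar[OF \<sigma> p', symmetric] act_mem[OF \<sigma> sub\<Phi> p'] act_mem[OF \<sigma> sub\<Phi> bar[OF p']] .
  qed
  thus ?thesis by (simp add: CM_def)
qed

lemma act_compose:
  assumes "\<sigma> \<in> embeddings L" "\<tau> \<in> embeddings L" "\<Phi> \<in> CM"
  shows "act (compose L \<sigma> \<tau>) \<Phi> = act \<sigma> (act \<tau> \<Phi>)"
  unfolding act_def image_image
  by (rule image_cong[OF refl]) (rule comp_comp[OF assms(1,2) CM_emb[OF assms(3)]])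

lemma act_id: "\<Phi> \<in> CM \<Longrightarrow> act (\<lambda>x\<in>L. x) \<Phi> = \<Phi>"
  unfolding act_def using comp_id[OF CM_emb] by (simp cong: image_cong)

lemma act_cancel:
  assumes "\<sigma> \<in> embeddings L" "\<sigma>' \<in> embeddings L" "compose L \<sigma>' \<sigma> = (\<lambda>x\<in>L. x)" "\<Phi> \<in> CM"
  shows "act \<sigma>' (act \<sigma> \<Phi>) = \<Phi>"
  using act_compose[OF assms(2,1,4)] act_id[OF assms(4)] assms(3) by simp

lemma CM_finite: "finite CM"
proof (rule finite_subset)
  show "CM \<subseteq> Pow (embeddings K)" using CM_emb by blast
qed (simp add: embeddings_finite[OF K])

lemma conjugate_iff:
  assumes "\<Phi> \<in> CM" "\<Psi> \<in> CM"
  shows "conjugate_types K \<Phi> \<Psi> \<longleftrightarrow> (\<exists>\<tau>\<in>embeddings L. \<Phi> = act \<tau> \<Psi>)"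
proof
  assume "conjugate_types K \<Phi> \<Psi>"
  then obtain \<tau> where \<tau>: "\<tau> \<in> embeddings L" "\<Psi> = act \<tau> \<Phi>"
    by (auto simp: conjugate_types_def carrier_gal_group[OF L] act_def)
  obtain \<tau>' where t: "\<tau>' \<in> embeddings L" "compose L \<tau>' \<tau> = (\<lambda>x\<in>L. x)" by (rule galois_inverse[OF L \<tau>(1)])
  have "\<Phi> = act \<tau>' \<Psi>" unfolding \<tau>(2) by (rule act_cancel[OF \<tau>(1) t assms(1), symmetric])
  thus "\<exists>\<tau>\<in>embeddings L. \<Phi> = act \<tau> \<Psi>" using t(1) by blast
next
  assume "\<exists>\<tau>\<in>embeddings L. \<Phi> = act \<tau> \<Psi>"
  then obtain \<tau> where \<tau>: "\<tau> \<in> embeddings L" "\<Phi> = act \<tau> \<Psi>" by blast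
  obtain \<tau>' where t: "\<tau>' \<in> embeddings L" "compose L \<tau>' \<tau> = (\<lambda>x\<in>L. x)" by (rule galois_inverse[OF L \<tau>(1)])
  have "\<Psi> = act \<tau>' \<Phi>" unfolding \<tau>(2) by (rule act_cancel[OF \<tau>(1) t assms(2), symmetric])
  thus "conjugate_types K \<Phi> \<Psi>"
    using t(1) by (auto simp: conjugate_types_def carrier_gal_group[OF L] act_def)
qed

text \<open>The group of the reflex field is the stabilizer of the CM-type: every embedding in \<open>\<Phi>\<close> extends to \<open>L\<close>, so
  \<open>\<Phi>\<close> and the union of cosets determine each other.\<close>

lemma reflex_group_iff:
  assumes \<Phi>: "\<Phi> \<in> CM" and \<sigma>: "\<sigma> \<in> embeddings L"
  shows "\<sigma> \<in> reflex_group K \<Phi> \<longleftrightarrow> act \<sigma> \<Phi> = \<Phi>"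
proof -
  have S: "S_type K \<Phi> = {\<tau> \<in> embeddings L. restrict \<tau> K \<in> \<Phi>}"
    by (auto simp: S_type_def coset_of_embedding_def carrier_gal_group[OF L])
  have coset: "\<sigma> <#\<^bsub>gal_group L\<^esub> S_type K \<Phi> = compose L \<sigma> ` S_type K \<Phi>" for \<sigma>
    by (auto simp: l_coset_def gal_group_mult)
  have res: "restrict (compose L \<sigma> \<tau>) K = compose K \<sigma> (restrict \<tau> K)" for \<sigma> \<tau>
    using KL by (auto simp: compose_def restrict_def fun_eq_iff)
  have comp: "compose L \<sigma> \<tau> \<in> embeddings L" if "\<sigma> \<in> embeddings L" "\<tau> \<in> embeddings L" for \<sigma> \<tau>
    using emb_compose[OF Ls that(2,1)] L_mem[OF that(2)] by blast
  have stable: "compose L \<sigma> ` S_type K \<Phi> \<subseteq> S_type K \<Phi>" if "\<sigma> \<in> embeddings L" "act \<sigma> \<Phi> = \<Phi>" for \<sigma>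
  proof (rule image_subsetI)
    fix \<tau> assume "\<tau> \<in> S_type K \<Phi>"
    hence \<tau>: "\<tau> \<in> embeddings L" "restrict \<tau> K \<in> \<Phi>" by (simp_all add: S)
    have "compose K \<sigma> (restrict \<tau> K) \<in> act \<sigma> \<Phi>" unfolding act_def using \<tau>(2) by (rule imageI)
    thus "compose L \<sigma> \<tau> \<in> S_type K \<Phi>"
      using comp[OF that(1) \<tau>(1)] that(2) by (simp add: S res)
  qed
  obtain \<sigma>' where s: "\<sigma>' \<in> embeddings L" "compose L \<sigma>' \<sigma> = (\<lambda>x\<in>L. x)" "compose L \<sigma> \<sigma>' = (\<lambda>x\<in>L. x)"
    by (rule galois_inverse[OF L \<sigma>])
  have "compose L \<sigma> ` S_type K \<Phi> = S_type K \<Phi> \<longleftrightarrow> act \<sigma> \<Phi> = \<Phi>"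
  proof
    assume eq: "act \<sigma> \<Phi> = \<Phi>"
    have eq': "act \<sigma>' \<Phi> = \<Phi>" using act_cancel[OF \<sigma> s(1,2) \<Phi>] eq by simp
    show "compose L \<sigma> ` S_type K \<Phi> = S_type K \<Phi>"
    proof
      show "S_type K \<Phi> \<subseteq> compose L \<sigma> ` S_type K \<Phi>"
      proof
        fix \<tau> assume \<tau>: "\<tau> \<in> S_type K \<Phi>"
        have tL: "\<tau> \<in> embeddings L" using \<tau> by (simp add: S)
        have "compose L \<sigma> (compose L \<sigma>' \<tau>) = \<tau>"
        proof (rule embeddings_ext[OF comp[OF \<sigma> comp[OF s(1) tL]] tL])
          fix x assume x: "x \<in> L"
          show "compose L \<sigma> (compose L \<sigma>' \<tau>) x = \<tau> x"
            using fun_cong[OF s(3), of "\<tau> x"] x L_mem[OF tL x] by (simp add: compose_eq)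
        qed
        moreover have "compose L \<sigma>' \<tau> \<in> S_type K \<Phi>" using stable[OF s(1) eq'] \<tau> by blast
        ultimately show "\<tau> \<in> compose L \<sigma> ` S_type K \<Phi>" by (metis imageI)
      qed
    qed (rule stable[OF \<sigma> eq])
  next
    assume eq: "compose L \<sigma> ` S_type K \<Phi> = S_type K \<Phi>"
    have "act \<sigma> \<Phi> \<subseteq> \<Phi>"
      unfolding act_def
    proof (rule image_subsetI)
      fix \<psi> assume \<psi>: "\<psi> \<in> \<Phi>"
      have \<psi>K: "\<psi> \<in> embeddings K" by (rule CM_emb[OF \<Phi> \<psi>])
      obtain \<tau> where \<tau>: "\<tau> \<in> embeddings L" "\<And>x. x \<in> K \<Longrightarrow> \<tau> x = \<psi> x" by (rule emb_K_extend[OF \<psi>K], rule that)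
      have r: "restrict \<tau> K = \<psi>"
        using \<psi>K \<tau>(2) by (intro extensionalityI[of _ K]) (auto simp: embeddings_iff)
      have "\<tau> \<in> S_type K \<Phi>" using \<tau>(1) r \<psi> by (simp add: S)
      hence "compose L \<sigma> \<tau> \<in> S_type K \<Phi>" using eq by blast
      thus "compose K \<sigma> \<psi> \<in> \<Phi>" using r by (simp add: S res)
    qed
    \<comment> \<open>No CM-type is properly contained in another one.\<close>
    moreover have "\<Psi> = \<Phi>'" if "\<Psi> \<in> CM" "\<Phi>' \<in> CM" "\<Psi> \<subseteq> \<Phi>'" for \<Psi> \<Phi>'
    proof
      show "\<Phi>' \<subseteq> \<Psi>"
      proof
        fix \<psi> assume p: "\<psi> \<in> \<Phi>'"
        have pK: "\<psi> \<in> embeddings K" by (rule CM_emb[OF that(2) p])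
        have "bar \<psi> \<notin> \<Phi>'" using that(2) p pK by (simp add: CM_def CM_type_iff)
        hence "bar \<psi> \<notin> \<Psi>" using that(3) by blast
        thus "\<psi> \<in> \<Psi>" using that(1) pK by (simp add: CM_def CM_type_iff)
      qed
    qed (rule that(3))
    ultimately show "act \<sigma> \<Phi> = \<Phi>" using act_closed[OF \<sigma> \<Phi>] \<Phi> by blast
  qed
  thus ?thesis using \<sigma> by (simp add: reflex_group_def coset carrier_gal_group[OF L])
qed

lemma rho_act:
  assumes \<sigma>: "\<sigma> \<in> embeddings L" "\<And>x. x \<in> F \<Longrightarrow> \<sigma> x = x" and \<Phi>: "\<Phi> \<in> CM" and i: "i \<in> I"
  shows "V.\<rho> (act \<sigma> \<Phi>) i = \<sigma> (V.\<rho> \<Phi> i)"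
proof -
  obtain \<psi> where \<psi>: "\<psi> \<in> \<Phi>" "restrict \<psi> K\<^sub>0 = \<phi> i" by (rule CM_over[OF \<Phi> i])
  note \<psi>K = CM_emb[OF \<Phi> \<psi>(1)]
  have "restrict (compose K \<sigma> \<psi>) K\<^sub>0 = \<phi> i"
  proof (rule extensionalityI[of _ K\<^sub>0])
    show "\<phi> i \<in> extensional K\<^sub>0" using phi[OF i] by (simp add: embeddings_iff)
    fix x assume x: "x \<in> K\<^sub>0"
    have "\<psi> x = \<phi> i x" using fun_cong[OF \<psi>(2), of x] x by simp
    moreover have "\<phi> i x \<in> F" by (rule emb_K0_F[OF phi[OF i] x])
    ultimately show "restrict (compose K \<sigma> \<psi>) K\<^sub>0 x = \<phi> i x" using x sub \<sigma>(2) by (auto simp: compose_eq)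
  qed simp
  moreover have "compose K \<sigma> \<psi> \<in> act \<sigma> \<Phi>" unfolding act_def using \<psi>(1) by (rule imageI)
  ultimately have "V.\<rho> (act \<sigma> \<Phi>) i = compose K \<sigma> \<psi> s"
    by (intro rho_eq[OF act_closed[OF \<sigma>(1) \<Phi>] _ i])
  also have "\<dots> = \<sigma> (\<psi> s)" using s_K by (simp add: compose_eq)
  also have "\<psi> s = V.\<rho> \<Phi> i" by (rule rho_eq[OF \<Phi> \<psi>(1) i \<psi>(2), symmetric])
  finally show ?thesis .
qed

lemma rho_L: "\<Phi> \<in> CM \<Longrightarrow> i \<in> I \<Longrightarrow> V.\<rho> \<Phi> i \<in> L"
  by (metis CM_over rho_eq emb_K_L[OF CM_emb s_K])

lemma v_L: "\<Phi> \<in> CM \<Longrightarrow> B \<subseteq> I \<Longrightarrow> V.v B \<Phi> \<in> L"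
  unfolding V.v_def using rho_L by (intro subfield_prod[OF Ls]) auto

lemma v_act:
  assumes \<sigma>: "\<sigma> \<in> embeddings L" "\<And>x. x \<in> F \<Longrightarrow> \<sigma> x = x" and \<Phi>: "\<Phi> \<in> CM" and B: "B \<subseteq> I"
  shows "V.v B (act \<sigma> \<Phi>) = \<sigma> (V.v B \<Phi>)"
proof -
  have "\<sigma> (V.v B \<Phi>) = (\<Prod>i\<in>B. \<sigma> (V.\<rho> \<Phi> i))"
    unfolding V.v_def using rho_L[OF \<Phi>] B by (intro emb_prod[OF Ls \<sigma>(1)]) auto
  also have "\<dots> = V.v B (act \<sigma> \<Phi>)"
    unfolding V.v_def using rho_act[OF \<sigma> \<Phi>] B by (intro prod.cong) auto
  finally show ?thesis by simp
qed

end

locale cm_representatives = cm_situation +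
  fixes \<Lambda> :: "(complex \<Rightarrow> complex) set set"
  assumes reps: "representatives_of_CM_types K \<Lambda>"
begin

lemma Lambda_CM: "\<Lambda> \<subseteq> CM"
  using reps by (auto simp: representatives_of_CM_types_def CM_def)

lemma representatives:
  assumes \<Phi>: "\<Phi> \<in> CM"
  shows "\<exists>!\<Psi>. \<Psi> \<in> \<Lambda> \<and> (\<exists>\<tau>\<in>embeddings L. \<Phi> = act \<tau> \<Psi>)"
proof -
  have "\<exists>!\<Psi>. \<Psi> \<in> \<Lambda> \<and> conjugate_types K \<Phi> \<Psi>"
    using reps \<Phi> by (simp add: representatives_of_CM_types_def CM_def)
  moreover have "\<Psi> \<in> \<Lambda> \<and> conjugate_types K \<Phi> \<Psi> \<longleftrightarrow> \<Psi> \<in> \<Lambda> \<and> (\<exists>\<tau>\<in>embeddings L. \<Phi> = act \<tau> \<Psi>)" for \<Psi>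
    using conjugate_iff[OF \<Phi>] Lambda_CM by blast
  ultimately show ?thesis by simp
qed

sublocale W: galois_set L F CM act \<Lambda>
proof (rule galois_set.intro)
  show "\<exists>!\<Psi>. \<Psi> \<in> \<Lambda> \<and> (\<exists>\<tau>\<in>embeddings L. \<Phi> = act \<tau> \<Psi>)" if "\<Phi> \<in> CM" for \<Phi>
    by (rule representatives[OF that])
qed (use L F FL act_closed act_id act_compose CM_finite Lambda_CM in auto)

lemma reflex_field_eq: "\<Phi> \<in> CM \<Longrightarrow> reflex_field K \<Phi> = W.fixed \<Phi>"
proof -
  assume \<Phi>: "\<Phi> \<in> CM"
  have "reflex_group K \<Phi> \<subseteq> embeddings L" by (auto simp: reflex_group_def carrier_gal_group[OF L])
  thus ?thesis unfolding reflex_field_def W.fixed_def using reflex_group_iff[OF \<Phi>] by blast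
qed

text \<open>Both images are the algebra of functions that are equivariant under the automorphisms fixing \<open>F\<close>: the
  Fourier coefficients of such a function are fixed by these automorphisms, hence lie in \<open>F\<close>.\<close>

lemma E_eq: "V.E = W.E"
proof
  show "V.E \<subseteq> W.E"
  proof
    fix g assume "g \<in> V.E"
    then obtain x where x: "\<And>B. x B \<in> F" "g = (\<lambda>p\<in>CM. \<Sum>B\<in>Pow I. x B * V.v B p)"
      unfolding V.E_def by blast
    have mem: "x B * V.v B p \<in> L" if "p \<in> CM" "B \<in> Pow I" for p B
      using x(1) FL v_L that by (intro subfield_mult[OF Ls]) auto
    have gv: "g p = (\<Sum>B\<in>Pow I. x B * V.v B p)" if "p \<in> CM" for p using that by (simp add: x(2))
    have "g (act \<sigma> p) = \<sigma> (g p)" if \<sigma>: "\<sigma> \<in> embeddings L" "\<And>x. x \<in> F \<Longrightarrow> \<sigma> x = x" and p: "p \<in> CM" for \<sigma> p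
    proof -
      have "\<sigma> (g p) = (\<Sum>B\<in>Pow I. \<sigma> (x B * V.v B p))"
        unfolding gv[OF p] by (rule emb_sum[OF Ls \<sigma>(1) mem[OF p]])
      also have "\<dots> = (\<Sum>B\<in>Pow I. x B * V.v B (act \<sigma> p))"
      proof (rule sum.cong[OF refl])
        fix B assume B: "B \<in> Pow I"
        have "x B \<in> L" using x(1) FL by blast
        thus "\<sigma> (x B * V.v B p) = x B * V.v B (act \<sigma> p)"
          using emb_mult[OF \<sigma>(1) _ v_L[OF p]] \<sigma>(2)[OF x(1)] v_act[OF \<sigma> p] B by simp
      qed
      also have "\<dots> = g (act \<sigma> p)" by (rule gv[OF act_closed[OF \<sigma>(1) p], symmetric])
      finally show ?thesis ..
    qed
    moreover have "g p \<in> L" if "p \<in> CM" for p unfolding gv[OF that] by (rule subfield_sum[OF Ls mem[OF that]])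
    moreover have "g \<in> extensional CM" by (simp add: x(2))
    ultimately show "g \<in> W.E" by (simp add: W.E_def)
  qed
  show "W.E \<subseteq> V.E"
  proof
    fix g assume g: "g \<in> W.E"
    have gL: "g p \<in> L" if "p \<in> CM" for p using g that by (simp add: W.E_def)
    show "g \<in> V.E"
    proof (rule V.inversion)
      show "g \<in> extensional CM" using g by (simp add: W.E_def)
      fix B assume B: "B \<subseteq> I"
      have mem: "g p * cnj (V.v B p) \<in> L" if "p \<in> CM" for p
        using that by (intro subfield_mult[OF Ls] gL cnj_central(1) v_L B)
      show "(\<Sum>p\<in>CM. g p * cnj (V.v B p)) \<in> F"
      proof (rule fixed_by_embeddings_imp_mem[OF galois_number_field[OF L] Fs FL])
        show "(\<Sum>p\<in>CM. g p * cnj (V.v B p)) \<in> L" by (rule subfield_sum[OF Ls mem])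
        fix \<tau> assume \<tau>: "\<tau> \<in> embeddings L" "\<And>x. x \<in> F \<Longrightarrow> \<tau> x = x"
        have "\<tau> (\<Sum>p\<in>CM. g p * cnj (V.v B p)) = (\<Sum>p\<in>CM. \<tau> (g p * cnj (V.v B p)))"
          by (rule emb_sum[OF Ls \<tau>(1) mem])
        also have "\<dots> = (\<Sum>p\<in>CM. g (act \<tau> p) * cnj (V.v B (act \<tau> p)))"
        proof (rule sum.cong[OF refl])
          fix p assume p: "p \<in> CM"
          have "g (act \<tau> p) = \<tau> (g p)" using g \<tau> p by (simp add: W.E_def)
          thus "\<tau> (g p * cnj (V.v B p)) = g (act \<tau> p) * cnj (V.v B (act \<tau> p))"
            using emb_mult[OF \<tau>(1) gL[OF p] cnj_central(1)[OF v_L[OF p B]]] cnj_central(2)[OF \<tau>(1) v_L[OF p B]]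
            by (simp add: v_act[OF \<tau> p B])
        qed
        also have "\<dots> = (\<Sum>p\<in>CM. g p * cnj (V.v B p))"
        proof (rule sum.reindex_bij_betw)
          obtain \<tau>' where t: "\<tau>' \<in> embeddings L" "compose L \<tau>' \<tau> = (\<lambda>x\<in>L. x)" "compose L \<tau> \<tau>' = (\<lambda>x\<in>L. x)"
            by (rule galois_inverse[OF L \<tau>(1)])
          show "bij_betw (act \<tau>) CM CM"
            by (rule bij_betwI[where g = "act \<tau>'"])
              (simp_all add: act_closed[OF \<tau>(1)] act_closed[OF t(1)] act_cancel[OF \<tau>(1) t(1,2)] act_cancel[OF t(1) \<tau>(1) t(3)])
        qed
        finally show "\<tau> (\<Sum>p\<in>CM. g p * cnj (V.v B p)) = (\<Sum>p\<in>CM. g p * cnj (V.v B p))" .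
      qed
    qed
  qed
qed

lemma reflex_algebra_eq: "reflex_algebra K \<Lambda> = W.A"
  unfolding reflex_algebra_def using reflex_field_eq Lambda_CM by (intro prod_algebra_cong) auto

lemma trace_form_eq: "trace_form K \<Lambda> = (\<lambda>b. \<Sum>q\<in>\<Lambda>. field_trace \<rat> (W.fixed q) (cnj (b q) * b q))"
  unfolding trace_form_def using reflex_field_eq Lambda_CM by (intro ext sum.cong) auto

lemma factor_eq: "pfister_factor K\<^sub>0 \<phi> d = V.L"
  by (simp add: fun_eq_iff pfister_factor_def V.L_def V.r_def a_def)

lemma pfister_algebra_eq: "pfister_algebra K\<^sub>0 N \<phi> d = V.V"
  by (simp add: pfister_algebra_def factor_eq)

lemma pfister_form_eq:
  "pfister_form K\<^sub>0 N \<phi> d = tensor_form I (\<lambda>i. field_algebra (V.L i)) (\<lambda>i. field_norm F (V.L i))"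
  by (simp add: pfister_form_def factor_eq)

lemma V_closed: "closed_algebra F V.V"
  unfolding tensor_algebra_def
  by (rule V.quotient_closed[OF V.relations_carrier V.single_carrier[OF V.M.one_closed]])

lemma W_closed: "closed_algebra F W.W"
  unfolding base_change_def
proof (rule W.quotient_closed[OF W.S_carrier])
  show "single (c, \<one>\<^bsub>W.A\<^esub>) 1 \<in> carrier W.R" if "c \<in> F" for c
    using that W.A_one by (intro W.single_M) auto
qed

theorem isomorphism_exists: "\<exists>h. h \<in> algebra_iso F W.W V.V"
proof -
  have "inv_into (carrier V.V) (quotient_eval CM V.\<kappa>) \<in> algebra_iso F (function_algebra CM W.E) V.V"
    using algebra_iso_inverse[OF V_closed V.V_iso] unfolding E_eq .
  from algebra_iso_comp[OF W_closed W.W_iso this] show ?thesis by blast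
qed

text \<open>Through the identification with functions, an isomorphism becomes an automorphism of the algebra of equivariant
  functions, and both forms become sums of squared absolute values.\<close>

theorem isomorphism_isometry:
  assumes h: "h \<in> algebra_iso F W.W V.V" and w: "w \<in> carrier W.W"
  shows "pfister_form K\<^sub>0 N \<phi> d (h w) = base_change_form (reflex_algebra K \<Lambda>) (trace_form K \<Lambda>) w / 2 ^ N"
proof -
  let ?E = "function_algebra CM W.E"
  define qW where "qW = quotient_eval CM W.\<kappa>"
  define qV where "qV = quotient_eval CM V.\<kappa>"
  have qW: "qW \<in> algebra_iso F W.W ?E" unfolding qW_def by (rule W.W_iso)
  have qV: "qV \<in> algebra_iso F V.V ?E" unfolding qV_def by (rule V.V_iso[unfolded E_eq])
  define \<alpha> where "\<alpha> f = qV (h (inv_into (carrier W.W) qW f))" for f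
  have E_closed: "closed_algebra F ?E" by (rule algebra_iso_closed[OF W_closed qW])
  have "(\<lambda>x. qV (h x)) \<in> algebra_iso F W.W ?E" by (rule algebra_iso_comp[OF W_closed h qV])
  from algebra_iso_comp[OF E_closed algebra_iso_inverse[OF W_closed qW] this]
  have \<alpha>: "\<alpha> \<in> algebra_iso F (function_algebra CM V.E) (function_algebra CM V.E)"
    unfolding \<alpha>_def[abs_def] E_eq .
  have qWw: "qW w \<in> V.E" using algebra_iso_D(1)[OF qW w] unfolding E_eq by simp
  have "inv_into (carrier W.W) qW (qW w) = w"
    using algebra_iso_D(6)[OF qW] w by (simp add: bij_betw_def)
  hence \<alpha>w: "\<alpha> (qW w) = qV (h w)" by (simp add: \<alpha>_def)
  have "pfister_form K\<^sub>0 N \<phi> d (h w) = (\<Sum>p\<in>CM. qV (h w) p * cnj (qV (h w) p)) / 2 ^ N"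
    unfolding pfister_form_eq qV_def using V.V_form[OF algebra_iso_D(1)[OF h w]] by simp
  also have "(\<Sum>p\<in>CM. qV (h w) p * cnj (qV (h w) p)) = (\<Sum>p\<in>CM. qW w p * cnj (qW w p))"
    using V.automorphism_preserves_norm[OF \<alpha> qWw] by (simp only: \<alpha>w)
  also have "\<dots> = base_change_form (reflex_algebra K \<Lambda>) (trace_form K \<Lambda>) w"
    unfolding reflex_algebra_eq trace_form_eq qW_def
    by (rule W.W_form[OF F_real cnj_central w, symmetric])
  finally show ?thesis .
qed

end

theorem theorem4p1:
  fixes K K\<^sub>0 :: "complex set" and N :: nat
    and \<phi> :: "nat \<Rightarrow> complex \<Rightarrow> complex" and d :: complex
    and \<Lambda> :: "(complex \<Rightarrow> complex) set set"
  assumes "CM_field K" and "ring.dimension CC (2 * N) \<rat> K"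
    and "maximal_totally_real_subfield K\<^sub>0 K"
    and "bij_betw \<phi> {1..N} (embeddings K\<^sub>0)"
    and "totally_positive K\<^sub>0 d" and "K = adjoin K\<^sub>0 (csqrt (- d))"
    and "representatives_of_CM_types K \<Lambda>"
  shows "(\<exists>h. h \<in> algebra_iso (galois_closure K\<^sub>0)
                  (base_change \<rat> (galois_closure K\<^sub>0) (reflex_algebra K \<Lambda>))
                  (pfister_algebra K\<^sub>0 N \<phi> d)) \<and>
         (\<forall>h \<in> algebra_iso (galois_closure K\<^sub>0)
                  (base_change \<rat> (galois_closure K\<^sub>0) (reflex_algebra K \<Lambda>))
                  (pfister_algebra K\<^sub>0 N \<phi> d).
            \<forall>w \<in> carrier (base_change \<rat> (galois_closure K\<^sub>0) (reflex_algebra K \<Lambda>)).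
              pfister_form K\<^sub>0 N \<phi> d (h w) =
                base_change_form (reflex_algebra K \<Lambda>) (trace_form K \<Lambda>) w / 2 ^ N)"
proof -
  interpret cm_representatives K K\<^sub>0 N \<phi> d \<Lambda>
  proof unfold_locales
    show "number_field K" using assms(1) by (simp add: CM_field_def totally_imaginary_def)
    show "totally_real K\<^sub>0" "K\<^sub>0 \<subseteq> K" using assms(3) by (simp_all add: maximal_totally_real_subfield_def)
  qed (rule assms)+
  show ?thesis
  proof (intro conjI ballI)
    show "\<exists>h. h \<in> algebra_iso (galois_closure K\<^sub>0) (base_change \<rat> (galois_closure K\<^sub>0) (reflex_algebra K \<Lambda>))
        (pfister_algebra K\<^sub>0 N \<phi> d)"
      unfolding reflex_algebra_eq pfister_algebra_eq by (rule isomorphism_exists)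
    fix h w
    assume "h \<in> algebra_iso (galois_closure K\<^sub>0) (base_change \<rat> (galois_closure K\<^sub>0) (reflex_algebra K \<Lambda>))
        (pfister_algebra K\<^sub>0 N \<phi> d)"
      and "w \<in> carrier (base_change \<rat> (galois_closure K\<^sub>0) (reflex_algebra K \<Lambda>))"
    thus "pfister_form K\<^sub>0 N \<phi> d (h w) = base_change_form (reflex_algebra K \<Lambda>) (trace_form K \<Lambda>) w / 2 ^ N"
      using isomorphism_isometry[of h w] by (simp only: reflex_algebra_eq pfister_algebra_eq)
  qed
qed

end
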